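(* Let $i,j,k$ be integers such that $i>j>0$ and $k>2i+j$. Let $\alpha=(k,k)$, $\beta=(k+1,k-1)$ and $\gamma=(2k-2i-2j,2i,2j)$. Then for every positive integer $N$, \[ g_{N\alpha,N\beta}^{N\gamma}=\frac{N}{2}+\begin{cases}1 & \text{if } N \text{ is even},\\ -\tfrac12 & \text{if } N \text{ is odd}.\end{cases} \] In particular, $g_{\alpha,\beta}^{\gamma}=0$ and $g_{N\alpha,N\beta}^{N\gamma}>0$ for all $N>1$.
   Context: A partition is a finite nonincreasing sequence of positive integers (trailing zeros may be appended); its weight is the sum of its parts. For a partition $\lambda=(\lambda_1,\lambda_2,\dots)$ and a positive integer $N$, $N\lambda=(N\lambda_1,N\lambda_2,\dots)$. Irreducible complex representations $V_\lambda$ of the symmetric group $\mathfrak{S}_n$ are indexed by partitions $\lambda$ of weight $n$. For partitions $\lambda,\mu,\nu$ of the same weight $n$, the Kronecker coefficient $g_{\mu,\nu}^{\lambda}$ is the multiplicity of $V_\lambda$ in the tensor product $V_\mu\otimes V_\nu$ (with diagonal $\mathfrak{S}_n$-action). *)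

theory Defs
  imports Complex_Main "HOL-Combinatorics.Permutations" "HOL-Library.Function_Algebras"
begin

section \<open>Complex function spaces\<close>

definition cscale :: "complex \<Rightarrow> ('x \<Rightarrow> complex) \<Rightarrow> 'x \<Rightarrow> complex" where
  "cscale c f = (\<lambda>x. c * f x)"

global_interpretation cfun: vector_space cscale
  by standard (auto simp: cscale_def algebra_simps)


section \<open>Representations and multiplicities\<close>

text \<open>
  A representation of \<open>G\<close> is given by a complex function space \<open>V\<close> together with an action
  \<open>\<rho>\<close> of \<open>G\<close> by linear maps that preserves \<open>V\<close>.
\<close>

definition submodule :: "'g set \<Rightarrow> ('g \<Rightarrow> ('x \<Rightarrow> complex) \<Rightarrow> 'x \<Rightarrow> complex)
    \<Rightarrow> ('x \<Rightarrow> complex) set \<Rightarrow> bool" where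
  "submodule G \<rho> U \<longleftrightarrow> cfun.subspace U \<and> (\<forall>g\<in>G. \<forall>u\<in>U. \<rho> g u \<in> U)"

definition irreducible_rep :: "'g set \<Rightarrow> ('g \<Rightarrow> ('x \<Rightarrow> complex) \<Rightarrow> 'x \<Rightarrow> complex)
    \<Rightarrow> ('x \<Rightarrow> complex) set \<Rightarrow> bool" where
  "irreducible_rep G \<rho> U \<longleftrightarrow> submodule G \<rho> U \<and> U \<noteq> {0} \<and>
     (\<forall>U'. submodule G \<rho> U' \<and> U' \<subseteq> U \<longrightarrow> U' = {0} \<or> U' = U)"

definition isomorphic_rep :: "'g set
    \<Rightarrow> ('g \<Rightarrow> ('x \<Rightarrow> complex) \<Rightarrow> 'x \<Rightarrow> complex) \<Rightarrow> ('x \<Rightarrow> complex) set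
    \<Rightarrow> ('g \<Rightarrow> ('y \<Rightarrow> complex) \<Rightarrow> 'y \<Rightarrow> complex) \<Rightarrow> ('y \<Rightarrow> complex) set \<Rightarrow> bool" where
  "isomorphic_rep G \<rho> V \<sigma> W \<longleftrightarrow> (\<exists>T. bij_betw T V W \<and>
     (\<forall>u\<in>V. \<forall>v\<in>V. T (u + v) = T u + T v) \<and>
     (\<forall>c. \<forall>v\<in>V. T (cscale c v) = cscale c (T v)) \<and>
     (\<forall>g\<in>G. \<forall>v\<in>V. T (\<rho> g v) = \<sigma> g (T v)))"

definition direct_sum_decomposition ::
    "('x \<Rightarrow> complex) set set \<Rightarrow> ('x \<Rightarrow> complex) set \<Rightarrow> bool" where
  "direct_sum_decomposition \<U> W \<longleftrightarrow> finite \<U> \<and> (\<forall>U\<in>\<U>. cfun.subspace U) \<and>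
     W = {\<Sum>U\<in>\<U>. f U | f. \<forall>U\<in>\<U>. f U \<in> U} \<and>
     (\<forall>f. (\<forall>U\<in>\<U>. f U \<in> U) \<and> (\<Sum>U\<in>\<U>. f U) = 0 \<longrightarrow> (\<forall>U\<in>\<U>. f U = 0))"

text \<open>
  The number of summands isomorphic to \<open>V\<close> in a decomposition of \<open>W\<close> into irreducible
  submodules. A set of summands suffices, since the nonzero summands of an internal direct sum
  are distinct as subspaces even when they are isomorphic.
\<close>

definition multiplicity_rep :: "'g set
    \<Rightarrow> ('g \<Rightarrow> ('x \<Rightarrow> complex) \<Rightarrow> 'x \<Rightarrow> complex) \<Rightarrow> ('x \<Rightarrow> complex) set
    \<Rightarrow> ('g \<Rightarrow> ('y \<Rightarrow> complex) \<Rightarrow> 'y \<Rightarrow> complex) \<Rightarrow> ('y \<Rightarrow> complex) set \<Rightarrow> nat" where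
  "multiplicity_rep G \<rho> V \<sigma> W = (THE m. \<exists>\<U>. direct_sum_decomposition \<U> W \<and>
     (\<forall>U\<in>\<U>. irreducible_rep G \<sigma> U) \<and> m = card {U\<in>\<U>. isomorphic_rep G \<rho> V \<sigma> U})"


section \<open>The irreducible representations of the symmetric group\<close>

type_synonym perm = "nat \<Rightarrow> nat"

definition symgrp :: "nat \<Rightarrow> perm set" where
  "symgrp n = {p. p permutes {1..n}}"

text \<open>
  An element \<open>\<Sum>\<^sub>p x\<^sub>p p\<close> of the group algebra is encoded by its coefficient function, so the
  product is convolution. Since \<open>(p x)\<^sub>h = x\<^bsub>p\<^sup>-\<^sup>1h\<^esub>\<close>, left multiplication by a permutation is
  the function \<open>left_act\<close>.
\<close>

definition grpalg :: "nat \<Rightarrow> (perm \<Rightarrow> complex) set" where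
  "grpalg n = {x. \<forall>p. p \<notin> symgrp n \<longrightarrow> x p = 0}"

definition grpalg_mult :: "nat \<Rightarrow> (perm \<Rightarrow> complex) \<Rightarrow> (perm \<Rightarrow> complex) \<Rightarrow> perm \<Rightarrow> complex" where
  "grpalg_mult n x y = (\<lambda>p. \<Sum>q\<in>symgrp n. x q * y (inv q \<circ> p))"

definition left_act :: "perm \<Rightarrow> (perm \<Rightarrow> complex) \<Rightarrow> perm \<Rightarrow> complex" where
  "left_act p x = (\<lambda>h. x (inv p \<circ> h))"

text \<open>
  Partitions are nonincreasing lists of parts. The boxes of the Young diagram of \<open>lam\<close> are
  numbered \<open>1, 2, \<dots>\<close> row by row; \<open>r\<close> and \<open>c\<close> are zero-based row and column indices.
\<close>

definition tab_entry :: "nat list \<Rightarrow> nat \<Rightarrow> nat \<Rightarrow> nat" where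
  "tab_entry lam r c = sum_list (take r lam) + c + 1"

definition tab_row :: "nat list \<Rightarrow> nat \<Rightarrow> nat set" where
  "tab_row lam r = {tab_entry lam r c | c. r < length lam \<and> c < lam ! r}"

definition tab_col :: "nat list \<Rightarrow> nat \<Rightarrow> nat set" where
  "tab_col lam c = {tab_entry lam r c | r. r < length lam \<and> c < lam ! r}"

definition row_group :: "nat list \<Rightarrow> perm set" where
  "row_group lam = {p \<in> symgrp (sum_list lam). \<forall>r. p ` tab_row lam r = tab_row lam r}"

definition col_group :: "nat list \<Rightarrow> perm set" where
  "col_group lam = {p \<in> symgrp (sum_list lam). \<forall>c. p ` tab_col lam c = tab_col lam c}"

definition row_symmetrizer :: "nat list \<Rightarrow> perm \<Rightarrow> complex" where
  "row_symmetrizer lam = (\<lambda>p. if p \<in> row_group lam then 1 else 0)"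

definition col_antisymmetrizer :: "nat list \<Rightarrow> perm \<Rightarrow> complex" where
  "col_antisymmetrizer lam = (\<lambda>p. if p \<in> col_group lam then of_int (sign p) else 0)"

definition young_symmetrizer :: "nat list \<Rightarrow> perm \<Rightarrow> complex" where
  "young_symmetrizer lam =
     grpalg_mult (sum_list lam) (row_symmetrizer lam) (col_antisymmetrizer lam)"

text \<open>
  The left ideal generated by the Young symmetrizer is the irreducible representation indexed by
  \<open>lam\<close>, normalised so that \<open>[n]\<close> gives the trivial representation and \<open>[1, \<dots>, 1]\<close> the sign.
\<close>

definition specht :: "nat list \<Rightarrow> (perm \<Rightarrow> complex) set" where
  "specht lam =
     {grpalg_mult (sum_list lam) x (young_symmetrizer lam) | x. x \<in> grpalg (sum_list lam)}"

lemma left_act_grpalg_mult: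
  assumes p: "p \<in> symgrp n"
  shows "left_act p (grpalg_mult n x y) = grpalg_mult n (left_act p x) y"
proof
  fix h
  have bp: "bij p" using p by (auto simp: symgrp_def intro: permutes_bij)
  have "left_act p (grpalg_mult n x y) h = (\<Sum>q\<in>symgrp n. x q * y (inv q \<circ> (inv p \<circ> h)))"
    by (simp add: left_act_def grpalg_mult_def)
  also have "\<dots> = (\<Sum>q\<in>symgrp n. x (inv p \<circ> q) * y (inv q \<circ> h))"
  proof (rule sum.reindex_bij_witness[of _ "\<lambda>q. inv p \<circ> q" "\<lambda>q. p \<circ> q"])
    fix q assume q: "q \<in> symgrp n"
    have bq: "bij q" using q by (auto simp: symgrp_def intro: permutes_bij)
    show "inv p \<circ> (p \<circ> q) = q" "p \<circ> (inv p \<circ> q) = q"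
      using bp by (auto simp: fun_eq_iff bij_is_inj bij_is_surj surj_f_inv_f)
    show "p \<circ> q \<in> symgrp n" "inv p \<circ> q \<in> symgrp n"
      using p q by (auto simp: symgrp_def intro: permutes_compose permutes_inv)
    show "x (inv p \<circ> (p \<circ> q)) * y (inv (p \<circ> q) \<circ> h) = x q * y (inv q \<circ> (inv p \<circ> h))"
      using bp bq by (simp add: o_inv_distrib o_assoc bij_is_inj)
  qed
  finally show "left_act p (grpalg_mult n x y) h = grpalg_mult n (left_act p x) y h"
    by (simp add: left_act_def grpalg_mult_def)
qed

lemma left_act_grpalg:
  assumes "p \<in> symgrp n" "x \<in> grpalg n"
  shows "left_act p x \<in> grpalg n"
proof -
  have "h \<in> symgrp n" if "inv p \<circ> h \<in> symgrp n" for h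
  proof -
    have "p \<circ> (inv p \<circ> h) \<in> symgrp n"
      using assms(1) that by (auto simp: symgrp_def intro: permutes_compose)
    moreover have "p \<circ> (inv p \<circ> h) = h"
      using assms(1) by (auto simp: symgrp_def fun_eq_iff permutes_inverses)
    ultimately show ?thesis by simp
  qed
  then show ?thesis using assms(2) by (auto simp: grpalg_def left_act_def)
qed

lemma submodule_specht: "submodule (symgrp (sum_list lam)) left_act (specht lam)"
  unfolding submodule_def
proof (intro conjI ballI)
  let ?n = "sum_list lam" and ?y = "young_symmetrizer lam"
  have add: "grpalg_mult ?n (x + x') ?y = grpalg_mult ?n x ?y + grpalg_mult ?n x' ?y" for x x'
    by (simp add: grpalg_mult_def fun_eq_iff algebra_simps sum.distrib)
  have scale: "grpalg_mult ?n (cscale c x) ?y = cscale c (grpalg_mult ?n x ?y)" for c x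
    by (simp add: grpalg_mult_def cscale_def fun_eq_iff sum_distrib_left mult.assoc)
  have zero: "grpalg_mult ?n 0 ?y = 0"
    by (simp add: grpalg_mult_def fun_eq_iff)
  have gr: "0 \<in> grpalg ?n"
    "x \<in> grpalg ?n \<Longrightarrow> x' \<in> grpalg ?n \<Longrightarrow> x + x' \<in> grpalg ?n"
    "x \<in> grpalg ?n \<Longrightarrow> cscale c x \<in> grpalg ?n" for x x' c
    by (auto simp: grpalg_def cscale_def)
  have specht_iff: "u \<in> specht lam \<longleftrightarrow> (\<exists>x\<in>grpalg ?n. u = grpalg_mult ?n x ?y)" for u
    by (auto simp: specht_def)
  show "cfun.subspace (specht lam)"
  proof (rule cfun.subspaceI)
    show "0 \<in> specht lam"
      unfolding specht_iff using gr(1) by (intro bexI[of _ 0]) (simp_all only: zero)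
  next
    fix u v assume "u \<in> specht lam" "v \<in> specht lam"
    then obtain x x' where x: "x \<in> grpalg ?n" "x' \<in> grpalg ?n"
      and "u = grpalg_mult ?n x ?y" "v = grpalg_mult ?n x' ?y"
      unfolding specht_iff by blast
    then have "u + v = grpalg_mult ?n (x + x') ?y" by (simp only: add)
    with gr(2)[OF x] show "u + v \<in> specht lam" unfolding specht_iff by blast
  next
    fix c u assume "u \<in> specht lam"
    then obtain x where x: "x \<in> grpalg ?n" and "u = grpalg_mult ?n x ?y"
      unfolding specht_iff by blast
    then have "cscale c u = grpalg_mult ?n (cscale c x) ?y" by (simp only: scale)
    with gr(3)[OF x] show "cscale c u \<in> specht lam" unfolding specht_iff by blast
  qed
  fix p u assume p: "p \<in> symgrp ?n" and "u \<in> specht lam"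
  then obtain x where x: "x \<in> grpalg ?n" and "u = grpalg_mult ?n x ?y"
    unfolding specht_iff by blast
  then have "left_act p u = grpalg_mult ?n (left_act p x) ?y"
    by (simp only: left_act_grpalg_mult[OF p])
  with left_act_grpalg[OF p x] show "left_act p u \<in> specht lam" unfolding specht_iff by blast
qed


section \<open>Kronecker coefficients\<close>

text \<open>
  The tensor product of two function spaces is realised inside the functions on pairs, where
  \<open>v \<otimes> w\<close> is the function \<open>(x, y) \<mapsto> v x w y\<close>; the diagonal action is determined by
  \<open>diag_act_tensor\<close>.
\<close>

definition tensor :: "('x \<Rightarrow> complex) \<Rightarrow> ('y \<Rightarrow> complex) \<Rightarrow> 'x \<times> 'y \<Rightarrow> complex" where
  "tensor v w = (\<lambda>(x, y). v x * w y)"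

definition tensor_space ::
    "('x \<Rightarrow> complex) set \<Rightarrow> ('y \<Rightarrow> complex) set \<Rightarrow> ('x \<times> 'y \<Rightarrow> complex) set" where
  "tensor_space V W = cfun.span {tensor v w | v w. v \<in> V \<and> w \<in> W}"

definition diag_act :: "perm \<Rightarrow> (perm \<times> perm \<Rightarrow> complex) \<Rightarrow> perm \<times> perm \<Rightarrow> complex" where
  "diag_act p F = (\<lambda>(x, y). F (inv p \<circ> x, inv p \<circ> y))"

lemma diag_act_tensor: "diag_act p (tensor v w) = tensor (left_act p v) (left_act p w)"
  by (simp add: diag_act_def tensor_def left_act_def fun_eq_iff)

text \<open>\<open>kronecker mu nu lam\<close> is \<open>g\<^bsub>\<mu>,\<nu>\<^esub>\<^sup>\<lambda>\<close>, for partitions of equal weight.\<close>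

definition kronecker :: "nat list \<Rightarrow> nat list \<Rightarrow> nat list \<Rightarrow> nat" where
  "kronecker mu nu lam =
     multiplicity_rep (symgrp (sum_list lam)) left_act (specht lam)
       diag_act (tensor_space (specht mu) (specht nu))"

definition dilate :: "nat \<Rightarrow> nat list \<Rightarrow> nat list" where
  "dilate N lam = map (\<lambda>part. N * part) lam"

end

theory Submission
  imports Defs "HOL-Library.FuncSet"
begin

text \<open>
  The Kronecker coefficient is the rank, hence the trace, of the idempotent that the Young
  symmetrizers of the three shapes define on the functions on pairs of permutations; so it is
  the scalar product of three characters. The Jacobi-Trudi determinant expresses these
  characters by permutation characters: the character and the determinant both have norm one,
  and their scalar product is one because Young symmetrizers kill all words that are not
  dominated by the shape. Products of permutation characters count contingency tables, so the
  coefficient is an alternating sum of numbers of tables. Pieri's rule turns it into numbers of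
  chains of horizontal strips. As the first shape is a rectangle and the second is a
  difference of two permutation modules with adjacent parameters, almost all chains cancel
  by shifting one coordinate at a time; what remains is the number of integers in four
  intervals.
\<close>

section \<open>Horizontal strips\<close>

text \<open>\<open>kronecker\<close> is a definite description over all decompositions of the tensor
  product W, so that it denotes a number has to be earned: for a primitive idempotent e, each
  summand isomorphic to the left ideal of e contributes one dimension to eW and every other summand
  none. The count is thus dim eW for every decomposition, and Maschke's theorem supplies one.

  In the counting half everything hinges on the order in which the entries of a two-by-two table
  become strips. With the lower left entry first, the tables for (m, m) and for (m + 1, m - 1)
  differ by a shift of the summation index and the sum telescopes; a reflection brings the two
  surviving ends into the same form. Two further unit shifts, of the sizes of the inner and of the
  middle partition, leave only boundary cases.

  The two answers for even and odd N come from rounding: the parts of N\<gamma> are even, the second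
  shape is N boxes away from the rectangle, and the ends of the final intervals involve halves of
  such numbers. The inequalities on i, j, k say that the halved parts of N\<gamma> have gaps of at
  least N.\<close>

definition simplex :: "int \<Rightarrow> (int \<times> int \<times> int) set" where
  "simplex r = {(p, q, s). 0 \<le> p \<and> 0 \<le> q \<and> 0 \<le> s \<and> p + q + s = r}"

lemma finite_simplex: "finite (simplex r)"
  by (rule finite_subset[of _ "{0..r} \<times> {0..r} \<times> {0..r}"]) (auto simp: simplex_def)

text \<open>
  The coefficient of \<open>x\<^sup>a y\<^sup>b z\<^sup>c\<close> in the product of the alternant \<open>(x - y)(x - z)(y - z)\<close> with the
  complete symmetric polynomials of the degrees in the list. For a partition it becomes, after
  the shift by \<open>(2, 1, 0)\<close>, the number \<open>kostka\<close>.
\<close>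

fun alt_coeff :: "int list \<Rightarrow> int \<Rightarrow> int \<Rightarrow> int \<Rightarrow> int" where
  "alt_coeff [] a b c =
     of_bool (a = 2 \<and> b = 1 \<and> c = 0) - of_bool (a = 1 \<and> b = 2 \<and> c = 0)
     - of_bool (a = 2 \<and> b = 0 \<and> c = 1) + of_bool (a = 1 \<and> b = 0 \<and> c = 2)
     + of_bool (a = 0 \<and> b = 2 \<and> c = 1) - of_bool (a = 0 \<and> b = 1 \<and> c = 2)"
| "alt_coeff (r # rs) a b c = (\<Sum>(p, q, s)\<in>simplex r. alt_coeff rs (a - p) (b - q) (c - s))"

lemma alt_coeff_swap12: "alt_coeff rs b a c = - alt_coeff rs a b c"
proof (induction rs arbitrary: a b c)
  case (Cons r rs)
  have "alt_coeff (r # rs) b a c = (\<Sum>(p, q, s)\<in>simplex r. alt_coeff rs (b - q) (a - p) (c - s))"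
    unfolding alt_coeff.simps
    by (rule sum.reindex_bij_witness[of _ "\<lambda>(p, q, s). (q, p, s)" "\<lambda>(p, q, s). (q, p, s)"])
      (auto simp: simplex_def)
  also have "\<dots> = (\<Sum>(p, q, s)\<in>simplex r. - alt_coeff rs (a - p) (b - q) (c - s))"
    by (rule sum.cong[OF refl], simp only: split_paired_all prod.case, rule Cons.IH)
  finally show ?case by (simp add: sum_negf case_prod_unfold)
qed (simp add: conj_ac)

lemma alt_coeff_swap23: "alt_coeff rs a c b = - alt_coeff rs a b c"
proof (induction rs arbitrary: a b c)
  case (Cons r rs)
  have "alt_coeff (r # rs) a c b = (\<Sum>(p, q, s)\<in>simplex r. alt_coeff rs (a - p) (c - s) (b - q))"
    unfolding alt_coeff.simps
    by (rule sum.reindex_bij_witness[of _ "\<lambda>(p, q, s). (p, s, q)" "\<lambda>(p, q, s). (p, s, q)"])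
      (auto simp: simplex_def)
  also have "\<dots> = (\<Sum>(p, q, s)\<in>simplex r. - alt_coeff rs (a - p) (b - q) (c - s))"
    by (rule sum.cong[OF refl], simp only: split_paired_all prod.case, rule Cons.IH)
  finally show ?case by (simp add: sum_negf case_prod_unfold)
qed (simp add: conj_ac)

lemma alt_coeff_negative: "c < 0 \<Longrightarrow> alt_coeff rs a b c = 0"
proof (induction rs arbitrary: a b c)
  case (Cons r rs)
  show ?case unfolding alt_coeff.simps using Cons
    by (intro sum.neutral) (auto simp: simplex_def)
qed simp

text \<open>Fixed points of the involution do no harm: the sum equals its own negative, which forces
  0 over the integers.\<close>

lemma sum_involution_neg:
  fixes F :: "'a \<Rightarrow> int"
  assumes "\<And>m. m \<in> S \<Longrightarrow> f m \<in> S" "\<And>m. m \<in> S \<Longrightarrow> f (f m) = m"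
    and "\<And>m. m \<in> S \<Longrightarrow> F (f m) = - F m"
  shows "sum F S = 0"
proof -
  have "sum F S = sum (\<lambda>m. - F m) S"
    using assms by (intro sum.reindex_bij_witness[of _ f f]) auto
  then show ?thesis by (simp add: sum_negf)
qed

text \<open>Interlacing with (a, b, c), the usual description of horizontal strips. The parameter s
  is the size of the inner partition, not the number of boxes removed; hence the a + b + c - r in
  \<open>kostka_pieri\<close>.\<close>

definition strip :: "int \<Rightarrow> int \<Rightarrow> int \<Rightarrow> int \<Rightarrow> (int \<times> int \<times> int) set" where
  "strip a b c s = {(x, y, z). b \<le> x \<and> x \<le> a \<and> c \<le> y \<and> y \<le> b \<and> 0 \<le> z \<and> z \<le> c \<and> x + y + z = s}"

lemma finite_strip: "finite (strip a b c s)"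
  by (rule finite_subset[of _ "{b..a} \<times> {c..b} \<times> {0..c}"]) (auto simp: strip_def)

definition kostka :: "int list \<Rightarrow> int \<Rightarrow> int \<Rightarrow> int \<Rightarrow> int" where
  "kostka rs a b c = alt_coeff rs (a + 2) (b + 1) c"

text \<open>Terms outside the strips cancel in pairs by exchanging two coordinates.\<close>

lemma kostka_pieri:
  assumes "a \<ge> b" "b \<ge> c"
  shows "kostka (r # rs) a b c =
    (\<Sum>(x, y, z)\<in>strip a b c (a + b + c - r). kostka rs x y z)"
proof -
  define F where "F = (\<lambda>(x, y, z). alt_coeff rs x y z)"
  define S where "S = {(x, y, z). x \<le> a + 2 \<and> y \<le> b + 1 \<and> z \<le> c \<and> x + y + z = a + b + c + 3 - r}"
  \<comment> \<open>In \<open>S1\<close> the first two coordinates are both at most b + 1, in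
    \<open>S2\<close> the last two are both at most c. So exchanging them respects the upper bounds
    of \<open>S\<close>.\<close>
  define S1 where "S1 = {(x, y, z). (x, y, z) \<in> S \<and> x \<le> b + 1}"
  define S2 where "S2 = {(x, y, z). (x, y, z) \<in> S \<and> x > b + 1 \<and> y \<le> c}"
  define S3 where "S3 = {(x, y, z). (x, y, z) \<in> S \<and> x > b + 1 \<and> y > c}"
  have S: "S = S1 \<union> (S2 \<union> S3)" "S1 \<inter> (S2 \<union> S3) = {}" "S2 \<inter> S3 = {}"
    by (auto simp: S1_def S2_def S3_def)
  have img: "S = (\<lambda>(p, q, s). (a + 2 - p, b + 1 - q, c - s)) ` simplex r"
  proof (rule set_eqI)
    fix m :: "int \<times> int \<times> int"
    obtain x y z where m: "m = (x, y, z)" by (cases m)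
    show "m \<in> S \<longleftrightarrow> m \<in> (\<lambda>(p, q, s). (a + 2 - p, b + 1 - q, c - s)) ` simplex r"
      unfolding m
      by (auto simp: S_def simplex_def intro!: image_eqI[of _ _ "(a + 2 - x, b + 1 - y, c - z)"])
  qed
  have fin: "finite S" unfolding img using finite_simplex by simp
  have "finite (S1 \<union> (S2 \<union> S3))" using fin unfolding S(1) .
  then have fin': "finite S1" "finite (S2 \<union> S3)" "finite S2" "finite S3" by simp_all
  have "kostka (r # rs) a b c = sum F S"
    unfolding kostka_def alt_coeff.simps img by (subst sum.reindex) (auto simp: inj_on_def F_def case_prod_unfold)
  also have "\<dots> = sum F S1 + (sum F S2 + sum F S3)"
    unfolding S(1) sum.union_disjoint[OF fin'(1,2) S(2)] sum.union_disjoint[OF fin'(3,4) S(3)] ..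
  also have "sum F S1 = 0"
    by (rule sum_involution_neg[where f = "\<lambda>(x, y, z). (y, x, z)"])
      (use assms in \<open>auto simp: S1_def S_def F_def intro: alt_coeff_swap12\<close>)
  also have "sum F S2 = 0"
    by (rule sum_involution_neg[where f = "\<lambda>(x, y, z). (x, z, y)"])
      (use assms in \<open>auto simp: S2_def S_def F_def intro: alt_coeff_swap23\<close>)
  \<comment> \<open>In \<open>S3\<close> the first two coordinates are already bounded below; the
    third is cut off at 0 because negative exponents have coefficient 0.\<close>
  also have "sum F S3 = sum F {(x, y, z). (x, y, z) \<in> S3 \<and> z \<ge> 0}"
    by (rule sum.mono_neutral_right) (use fin' in \<open>auto simp: F_def\<close>, meson alt_coeff_negative not_le)
  also have "\<dots> = (\<Sum>(x, y, z)\<in>strip a b c (a + b + c - r). kostka rs x y z)"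
    by (rule sum.reindex_bij_witness
      [of _ "\<lambda>(x, y, z). (x + 2, y + 1, z)" "\<lambda>(x, y, z). (x - 2, y - 1, z)"])
      (auto simp: S3_def S_def strip_def F_def kostka_def)
  finally show ?thesis by simp
qed

section \<open>Kostka numbers of short lists and chains of two strips\<close>

lemma kostka_nil:
  assumes "a \<ge> b" "b \<ge> c" "c \<ge> 0"
  shows "kostka [] a b c = (if (a, b, c) = (0, 0, 0) then 1 else 0)"
  using assms by (auto simp: kostka_def of_bool_def)

lemma kostka_one:
  assumes "a \<ge> b" "b \<ge> c" "c \<ge> 0"
  shows "kostka [r] a b c = (if b = 0 \<and> c = 0 \<and> a = r then 1 else 0)"
proof -
  have "kostka [r] a b c
      = (\<Sum>m\<in>strip a b c (a + b + c - r). if m = (0, 0, 0) then 1 else 0)"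
    unfolding kostka_pieri[OF assms(1,2)]
    by (rule sum.cong[OF refl]) (use assms in \<open>auto simp: strip_def kostka_nil split: if_splits\<close>)
  also have "\<dots> = (if b = 0 \<and> c = 0 \<and> a = r then 1 else 0)"
    unfolding sum.delta[OF finite_strip] using assms by (auto simp: strip_def)
  finally show ?thesis .
qed

lemma kostka_two:
  assumes "a \<ge> b" "b \<ge> c" "c \<ge> 0"
  shows "kostka [e, f] a b c = (if c = 0 \<and> a + b = e + f \<and> b \<le> e \<and> b \<le> f then 1 else 0)"
proof -
  have "kostka [e, f] a b c
      = (\<Sum>m\<in>strip a b c (a + b + c - e). if m = (f, 0, 0) then 1 else 0)"
    unfolding kostka_pieri[OF assms(1,2)]
    by (rule sum.cong[OF refl]) (use assms in \<open>auto simp: strip_def kostka_one split: if_splits\<close>)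
  also have "\<dots> = (if c = 0 \<and> a + b = e + f \<and> b \<le> e \<and> b \<le> f then 1 else 0)"
    unfolding sum.delta[OF finite_strip] using assms by (auto simp: strip_def)
  finally show ?thesis .
qed

text \<open>A horizontal strip has at most one box in each column, hence at most a boxes inside (a,
  b, c).\<close>

lemma kostka_large:
  assumes "a \<ge> b" "b \<ge> c" "c \<ge> 0" "r > a"
  shows "kostka (r # rs) a b c = 0"
proof -
  have "strip a b c (a + b + c - r) = {}" using assms by (auto simp: strip_def)
  then show ?thesis by (simp only: kostka_pieri[OF assms(1,2)] sum.empty)
qed

text \<open>A strip of a boxes takes the bottom box of every column, which moves each remaining row
  up by one: only (b, c, 0) is left.\<close>

lemma kostka_top:
  assumes "a \<ge> b" "b \<ge> c" "c \<ge> 0"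
  shows "kostka (a # rs) a b c = kostka rs b c 0"
proof -
  have "strip a b c (a + b + c - a) = {(b, c, 0)}" using assms by (auto simp: strip_def)
  then show ?thesis by (simp only: kostka_pieri[OF assms(1,2)]) simp
qed

text \<open>The six lists and signs are the terms of the three-by-three Jacobi-Trudi determinant.
  Each list but the first either begins with more than a, or, after a strip of a boxes, continues
  with more than b; so only the first term survives.\<close>

lemma kostka_orthonormal:
  assumes "a \<ge> b" "b \<ge> c" "c \<ge> 0"
  shows "kostka [a, b, c] a b c - kostka [a + 1, b - 1, c] a b c
    - kostka [a, b + 1, c - 1] a b c + kostka [a + 1, b + 1, c - 2] a b c
    + kostka [a + 2, b - 1, c - 1] a b c - kostka [a + 2, b, c - 2] a b c = 1"
  using assms by (simp add: kostka_large kostka_top kostka_one kostka_nil)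

text \<open>The partitions \<open>(x, y, z)\<close> of \<open>s\<close> for which \<open>(a, b, c) / (x, y, z)\<close> and \<open>(x, y, z) / (u, v)\<close> are horizontal strips.\<close>

definition chains :: "int \<Rightarrow> int \<Rightarrow> int \<Rightarrow> int \<Rightarrow> int \<Rightarrow> int \<Rightarrow> (int \<times> int \<times> int) set" where
  "chains a b c u v s = {(x, y, z)\<in>strip a b c s. y \<le> u \<and> u \<le> x \<and> z \<le> v \<and> v \<le> y}"

lemma finite_chains: "finite (chains a b c u v s)"
  by (rule finite_subset[OF _ finite_strip[of a b c s]]) (auto simp: chains_def)

text \<open>The first two entries are removed as strips and give the chains. What is left is a
  two-row partition (u, v) of e + f, which by \<open>kostka_two\<close> contributes 1 exactly when v
  is at most e and f.\<close>

lemma kostka_four: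
  assumes "a \<ge> b" "b \<ge> c" "c \<ge> 0" "a + b + c = q + p + e + f" "e \<ge> 0" "f \<ge> 0"
  shows "kostka [q, p, e, f] a b c =
    (\<Sum>v\<in>{0..min e f}. int (card (chains a b c (e + f - v) v (a + b + c - q))))"
proof -
  define T where "T = strip a b c (a + b + c - q)"
  have inner: "kostka [p, e, f] x y z =
      (\<Sum>v\<in>{0..min e f}. if (x, y, z) \<in> chains a b c (e + f - v) v (a + b + c - q) then 1 else 0)"
    if m: "(x, y, z) \<in> T" for x y z
  proof -
    have o: "x \<ge> y" "y \<ge> z" "z \<ge> 0" "x + y + z = e + f + p" using m assms by (auto simp: T_def strip_def)
    have "kostka [p, e, f] x y z =
        (\<Sum>(u, v, w)\<in>strip x y z (e + f). if w = 0 \<and> v \<le> e \<and> v \<le> f then 1 else 0)"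
      unfolding kostka_pieri[OF o(1,2)]
      by (rule sum.cong) (use o in \<open>auto simp: strip_def kostka_two split: if_splits\<close>)
    also have "\<dots> = (\<Sum>(u, v, w)\<in>{(u, v, w)\<in>strip x y z (e + f). w = 0 \<and> v \<le> e \<and> v \<le> f}. 1)"
      by (rule sum.mono_neutral_cong_right) (auto simp: finite_strip split: if_splits)
    also have "\<dots> = (\<Sum>v\<in>{v\<in>{0..min e f}. (x, y, z) \<in> chains a b c (e + f - v) v (a + b + c - q)}. 1)"
      by (rule sum.reindex_bij_witness[of _ "\<lambda>v. (e + f - v, v, 0)" "\<lambda>(u, v, w). v"])
        (use m o in \<open>auto simp: chains_def strip_def T_def\<close>)
    also have "\<dots> = (\<Sum>v\<in>{0..min e f}. if (x, y, z) \<in> chains a b c (e + f - v) v (a + b + c - q) then 1 else 0)"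
      by (rule sum.mono_neutral_cong_left) auto
    finally show ?thesis .
  qed
  have "kostka [q, p, e, f] a b c = (\<Sum>(x, y, z)\<in>T.
      \<Sum>v\<in>{0..min e f}. if (x, y, z) \<in> chains a b c (e + f - v) v (a + b + c - q) then 1 else 0)"
    unfolding kostka_pieri[OF assms(1,2)] T_def[symmetric]
    by (rule sum.cong) (auto simp: inner)
  also have "\<dots> = (\<Sum>v\<in>{0..min e f}. \<Sum>m\<in>T.
      if m \<in> chains a b c (e + f - v) v (a + b + c - q) then 1 else 0)"
    by (subst sum.swap) (simp add: case_prod_unfold)
  also have "\<dots> = (\<Sum>v\<in>{0..min e f}. int (card (chains a b c (e + f - v) v (a + b + c - q))))"
  proof (rule sum.cong[OF refl])
    fix v
    have "T \<inter> chains a b c (e + f - v) v (a + b + c - q) = chains a b c (e + f - v) v (a + b + c - q)"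
      by (auto simp: T_def chains_def)
    then show "(\<Sum>m\<in>T. if m \<in> chains a b c (e + f - v) v (a + b + c - q) then 1 else 0) =
        int (card (chains a b c (e + f - v) v (a + b + c - q)))"
      by (simp add: sum.If_cases T_def finite_strip Int_def)
  qed
  finally show ?thesis .
qed

text \<open>Reflecting each coordinate in its range of values.\<close>

lemma card_chains_reflect:
  "card (chains a b c u v s) = card (chains a b c u v (a + b + c + u + v - s))"
proof -
  define R where "R = (\<lambda>(x, y, z).
    (max b u + a - x, max c v + min b u - y, min c v - z) :: int \<times> int \<times> int)"
  have "bij_betw R (chains a b c u v s) (chains a b c u v (a + b + c + u + v - s))"
    by (rule bij_betw_byWitness[of _ R]) (auto simp: R_def chains_def strip_def max_def min_def)
  then show ?thesis by (rule bij_betw_same_card)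
qed

section \<open>Cancellation of chains for a rectangle and a two-row shape\<close>

lemma sum_int_telescope:
  fixes f :: "int \<Rightarrow> int"
  assumes "l \<le> h + 1"
  shows "(\<Sum>e\<in>{l..h}. f e - f (e - 1)) = f h - f (l - 1)"
proof -
  have "(\<Sum>e\<in>{l..l + int n - 1}. f e - f (e - 1)) = f (l + int n - 1) - f (l - 1)" for n
  proof (induction n)
    case (Suc n)
    have "{l..l + int (Suc n) - 1} = insert (l + int n) {l..l + int n - 1}" by auto
    then show ?case using Suc by simp
  qed simp
  from this[of "nat (h + 1 - l)"] assms show ?thesis by simp
qed

text \<open>All two-row inner partitions (u, v) of w at once, with v = w - u left implicit; the
  middle partition has t + u boxes, the form in which both ends of the telescoping sum of
  \<open>rect_mult_eq\<close> appear. Since v is not part of the tuple, families with the same t and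
  different w can be compared as sets.\<close>

definition chain_family :: "int \<Rightarrow> int \<Rightarrow> int \<Rightarrow> int \<Rightarrow> int \<Rightarrow> (int \<times> int \<times> int \<times> int) set" where
  "chain_family a b c w t = {(x, y, z, u). (x, y, z) \<in> chains a b c u (w - u) (t + u)}"

lemma finite_chain_family: "finite (chain_family a b c w t)"
  by (rule finite_subset[of _ "{b..a} \<times> {c..b} \<times> {0..c} \<times> {c..a}"])
    (auto simp: chain_family_def chains_def strip_def)

lemma card_chain_family:
  assumes "w \<ge> 0" "c \<ge> 0"
  shows "int (card (chain_family a b c w t)) =
    (\<Sum>v\<in>{v\<in>{0..w}. 2 * v \<le> w}. int (card (chains a b c (w - v) v (t + w - v))))"
proof -
  have fin: "finite {v\<in>{0..w}. 2 * v \<le> w}" by (rule finite_subset[of _ "{0..w}"]) auto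
  have "card (chain_family a b c w t) =
      card (SIGMA v:{v\<in>{0..w}. 2 * v \<le> w}. chains a b c (w - v) v (t + w - v))"
    by (rule bij_betw_same_card, rule bij_betw_byWitness
      [of _ "\<lambda>(v, x, y, z). (x, y, z, w - v)" "\<lambda>(x, y, z, u). (w - u, x, y, z)"])
      (use assms in \<open>auto simp: chain_family_def chains_def strip_def\<close>)
  then show ?thesis using fin by (simp add: finite_chains)
qed

text \<open>
  The multiplicity of the irreducible \<open>(a, b, c)\<close> in the tensor product of the irreducible \<open>(m, m)\<close> with the
  permutation module of \<open>(m + k, m - k)\<close>. The two products of complete symmetric polynomials come
  from the two-by-two tables with row sums \<open>(m, m)\<close> and \<open>(m + 1, m - 1)\<close>.
\<close>

definition rect_mult :: "int \<Rightarrow> int \<Rightarrow> int \<Rightarrow> int \<Rightarrow> int \<Rightarrow> int" where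
  "rect_mult a b c m k = (\<Sum>e\<in>{0..m - k}.
     kostka [k + e, m - e, e, m - k - e] a b c
     - kostka [k + e - 1, m + 1 - e, e, m - k - e] a b c)"

text \<open>Both products end in e, m - k - e, so they run through the same inner partitions (u, v)
  of m - k, while their first strips differ by one box. Hence the second term at e is the first term
  at e - 1, and for fixed v the sum over e telescopes.\<close>

lemma rect_mult_eq:
  assumes "a \<ge> b" "b \<ge> c" "c \<ge> 0" "a + b + c = 2 * m" "0 \<le> k" "k \<le> m"
  shows "rect_mult a b c m k =
    int (card (chain_family a b c (m - k) m)) - int (card (chain_family a b c (m - k) (m + 1)))"
proof -
  define W where "W v s = int (card (chains a b c (m - k - v) v s))" for v s
  let ?V = "{v\<in>{0..m - k}. 2 * v \<le> m - k}"
  have "rect_mult a b c m k = (\<Sum>e\<in>{0..m - k}. \<Sum>v\<in>{0..min e (m - k - e)}.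
      W v (2 * m - k - e) - W v (2 * m - k - (e - 1)))"
    unfolding rect_mult_def W_def sum_subtractf
    by (intro arg_cong2[of _ _ _ _ "(-)"] sum.cong refl; subst kostka_four)
      (use assms in \<open>auto intro!: sum.cong simp: algebra_simps\<close>)
  also have "\<dots> = (\<Sum>(e, v)\<in>(SIGMA e:{0..m - k}. {0..min e (m - k - e)}).
      W v (2 * m - k - e) - W v (2 * m - k - (e - 1)))"
    by (rule sum.Sigma) auto
  also have "\<dots> = (\<Sum>(v, e)\<in>(SIGMA v:?V. {v..m - k - v}).
      W v (2 * m - k - e) - W v (2 * m - k - (e - 1)))"
    by (rule sum.reindex_bij_witness[of _ "\<lambda>(e, v). (v, e)" "\<lambda>(v, e). (e, v)"]) auto
  also have "\<dots> = (\<Sum>v\<in>?V. \<Sum>e\<in>{v..m - k - v}.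
      W v (2 * m - k - e) - W v (2 * m - k - (e - 1)))"
    by (rule sum.Sigma[symmetric]) (auto intro: finite_subset[of _ "{0..m - k}"])
  also have "\<dots> = (\<Sum>v\<in>?V. W v (m + v) - W v (2 * m - k - v + 1))"
  proof (rule sum.cong[OF refl])
    fix v assume "v \<in> ?V"
    then show "(\<Sum>e\<in>{v..m - k - v}. W v (2 * m - k - e) - W v (2 * m - k - (e - 1)))
        = W v (m + v) - W v (2 * m - k - v + 1)"
      by (subst sum_int_telescope[where f = "\<lambda>e. W v (2 * m - k - e)"]) (auto simp: algebra_simps)
  qed
  \<comment> \<open>Only the first end is reflected: size m + v becomes m + u with u = m - k - v.
    The other end already has size m + 1 + u.\<close>
  also have "\<dots> = (\<Sum>v\<in>?V. W v (m + (m - k) - v)) - (\<Sum>v\<in>?V. W v ((m + 1) + (m - k) - v))"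
    unfolding sum_subtractf W_def
    by (intro arg_cong2[of _ _ _ _ "(-)"] sum.cong refl, subst card_chains_reflect)
      (use assms in \<open>simp_all add: algebra_simps\<close>)
  finally show ?thesis
    using assms by (simp add: card_chain_family W_def algebra_simps)
qed

lemma card_Diff_swap:
  assumes "finite A" "finite B"
  shows "int (card A) - int (card B) = int (card (A - B)) - int (card (B - A))"
  using assms card_Diff_subset_Int[of A B] card_Diff_subset_Int[of B A]
    card_mono[of A "A \<inter> B"] card_mono[of B "A \<inter> B"]
  by (simp add: Int_commute)

text \<open>For a fixed tuple, w occurs only in z \<le> w - u \<le> y. So exactly the tuples with z
  = w - u belong to the first family alone, and those with y = w - 1 - u to the second alone. The
  prescribed size then determines the last coordinate from x and u.\<close>

lemma card_chain_family_diff: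
  assumes "b \<ge> c" "c \<ge> 0"
  shows "int (card (chain_family a b c w t)) - int (card (chain_family a b c (w - 1) t)) =
    int (card {(x, u). b \<le> x \<and> x \<le> a \<and> u \<le> x \<and> 0 \<le> w - u \<and> w - u \<le> c
      \<and> c \<le> t + 2 * u - w - x \<and> t + 2 * u - w - x \<le> min b u})
    - int (card {(x, u). b \<le> x \<and> x \<le> a \<and> u \<le> x \<and> c \<le> w - 1 - u \<and> w - 1 - u \<le> min b u
      \<and> 0 \<le> t + 2 * u - w + 1 - x \<and> t + 2 * u - w + 1 - x \<le> c})"
    (is "_ = int (card ?A) - int (card ?B)")
proof -
  let ?X = "chain_family a b c w t" and ?Y = "chain_family a b c (w - 1) t"
  have "bij_betw (\<lambda>(x, y, z, u). (x, u)) (?X - ?Y) ?A"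
    by (rule bij_betw_byWitness[of _ "\<lambda>(x, u). (x, t + 2 * u - w - x, w - u, u)"])
      (use assms in \<open>auto simp: chain_family_def chains_def strip_def\<close>)
  moreover have "bij_betw (\<lambda>(x, y, z, u). (x, u)) (?Y - ?X) ?B"
    by (rule bij_betw_byWitness[of _ "\<lambda>(x, u). (x, w - 1 - u, t + 2 * u - w + 1 - x, u)"])
      (use assms in \<open>auto simp: chain_family_def chains_def strip_def\<close>)
  ultimately show ?thesis
    by (simp add: card_Diff_swap[OF finite_chain_family finite_chain_family] bij_betw_same_card)
qed

text \<open>After \<open>card_chain_family_diff\<close> one coordinate depends on the pair (x, u),
  and raising t by 1 raises it by 1. Only pairs with this coordinate at an end of its range survive:
  y = min b u or y = c in \<open>A\<close>, and z = c or z = 0 in \<open>B\<close>. This determines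
  x and leaves the single integer u.\<close>

lemma rect_mult_diff:
  fixes a b c m k :: int
  assumes "a \<ge> b" "b \<ge> c" "c \<ge> 0" "a + b + c = 2 * m" "0 \<le> k" "k < m"
  shows "rect_mult a b c m k - rect_mult a b c m (k + 1) =
    int (card {u. m - k - c \<le> u \<and> u \<le> m - k \<and> c \<le> u
      \<and> b \<le> k + 2 * u - min b u \<and> k + 2 * u - min b u \<le> a})
    - int (card {u. m - k - c \<le> u \<and> u \<le> m - k \<and> c \<le> u
      \<and> b \<le> k + 1 + 2 * u - c \<and> k + 1 + 2 * u - c \<le> a})
    - int (card {u. c \<le> m - k - 1 - u \<and> m - k - 1 - u \<le> min b u
      \<and> b \<le> k + 1 + 2 * u - c \<and> k + 1 + 2 * u - c \<le> a})
    + int (card {u. c \<le> m - k - 1 - u \<and> m - k - 1 - u \<le> min b u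
      \<and> b \<le> k + 2 + 2 * u \<and> k + 2 + 2 * u \<le> a})"
    (is "_ = int (card ?a) - int (card ?c) - int (card ?b) + int (card ?d)")
proof -
  define A where "A t = {(x, u). b \<le> x \<and> x \<le> a \<and> u \<le> x \<and> 0 \<le> m - k - u \<and> m - k - u \<le> c
      \<and> c \<le> t + 2 * u - (m - k) - x \<and> t + 2 * u - (m - k) - x \<le> min b u}" for t
  define B where "B t = {(x, u). b \<le> x \<and> x \<le> a \<and> u \<le> x \<and> c \<le> m - k - 1 - u \<and> m - k - 1 - u \<le> min b u
      \<and> 0 \<le> t + 2 * u - (m - k) + 1 - x \<and> t + 2 * u - (m - k) + 1 - x \<le> c}" for t
  have finA: "finite (A t)" for t
    by (rule finite_subset[of _ "{b..a} \<times> {m - k - c..m - k}"]) (auto simp: A_def)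
  have finB: "finite (B t)" for t
    by (rule finite_subset[of _ "{b..a} \<times> {m - k - 1 - b..m - k}"]) (use assms in \<open>auto simp: B_def\<close>)
  have "bij_betw snd (A m - A (m + 1)) ?a"
    by (rule bij_betw_byWitness[of _ "\<lambda>u. (k + 2 * u - min b u, u)"])
      (use assms in \<open>auto simp: A_def\<close>)
  moreover have "bij_betw snd (A (m + 1) - A m) ?c"
    by (rule bij_betw_byWitness[of _ "\<lambda>u. (k + 1 + 2 * u - c, u)"])
      (use assms in \<open>auto simp: A_def\<close>)
  moreover have "bij_betw snd (B m - B (m + 1)) ?b"
    by (rule bij_betw_byWitness[of _ "\<lambda>u. (k + 1 + 2 * u - c, u)"])
      (use assms in \<open>auto simp: B_def\<close>)
  moreover have "bij_betw snd (B (m + 1) - B m) ?d"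
    by (rule bij_betw_byWitness[of _ "\<lambda>u. (k + 2 + 2 * u, u)"])
      (use assms in \<open>auto simp: B_def\<close>)
  moreover have "rect_mult a b c m k - rect_mult a b c m (k + 1) =
      (int (card (A m)) - int (card (A (m + 1)))) + (int (card (B (m + 1))) - int (card (B m)))"
    using card_chain_family_diff[of c b a "m - k" m] card_chain_family_diff[of c b a "m - k" "m + 1"] assms
    by (simp add: rect_mult_eq A_def B_def algebra_simps)
  ultimately show ?thesis
    by (simp add: card_Diff_swap[OF finA finA] card_Diff_swap[OF finB finB] bij_betw_same_card)
qed

text \<open>The arithmetic of \<open>rect_mult_diff_even_parts\<close>, freed of division: t and r
  are the quotient and remainder of n by 2, and h is the half of x + y + z - n, rounded down. The
  maxima with 0 account for empty intervals.\<close>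

lemma interval_lengths:
  fixes x y z n t h r :: int
  assumes "n \<ge> 1" "z \<ge> n" "y \<ge> z + n" "x \<ge> y + n"
    and "n = 2 * t + r" "0 \<le> r" "r \<le> 1"
    and "2 * h \<le> x + y + z - n" "x + y + z - n \<le> 2 * h + 1" 
  shows "2 * (max 0 (2 * y - max (2 * y - n) (x + y - z - n) + 1) + max 0 (x + y - t - r - max (2 * y + 1) (x + y - z - n) + 1)
   - max 0 (x + z - t - 1 - max (x + y - z - n) (y + z - t - r) + 1)
   - max 0 (min (x + y - z - n - 1) (x + z - t - 1) - max (max (x + z - y - n - 1) h) (y + z - t - r) + 1)
   + max 0 (x - t - 1 - r - max (max (x + z - y - n - 1) h) (y - t - 1) + 1))
    = n + (if r = 0 then 2 else - 1)"
proof (cases "r = 0")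
  case True
  then show ?thesis using assms by (smt (verit, best))
next
  case False
  then have "r = 1" using assms by auto
  then show ?thesis using assms by (smt (verit, best))
qed
text \<open>The parity of n enters here: bounds for n + 2 * u by even numbers round to bounds for u
  with t and r. The bound h comes from m - n - 1 - u \<le> u, where m = x + y + z.\<close>

lemma rect_mult_diff_even_parts:
  fixes x y z n :: int
  assumes n: "n \<ge> 1" and z: "z \<ge> n" and y: "y \<ge> z + n" and x: "x \<ge> y + n"
  shows "2 * (rect_mult (2 * x) (2 * y) (2 * z) (x + y + z) n - rect_mult (2 * x) (2 * y) (2 * z) (x + y + z) (n + 1))
    = n + (if even n then 2 else - 1)"
proof -
  define t where "t = n div 2"
  define r where "r = n mod 2"
  define h where "h = (x + y + z - n) div 2"
  have n_eq: "n = 2 * t + r" "0 \<le> r" "r \<le> 1" by (auto simp: t_def r_def)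
  have h: "2 * h \<le> x + y + z - n" "x + y + z - n \<le> 2 * h + 1" by (auto simp: h_def)
  \<comment> \<open>The value of min (2 * y) u splits this set at u = 2 * y; below, the middle
    expression is n + u, above it is n + 2 * u - 2 * y, and only the latter rounds.\<close>
  have a: "{u. x + y + z - n - 2 * z \<le> u \<and> u \<le> x + y + z - n \<and> 2 * z \<le> u
      \<and> 2 * y \<le> n + 2 * u - min (2 * y) u \<and> n + 2 * u - min (2 * y) u \<le> 2 * x}
      = {max (2 * y - n) (x + y - z - n)..2 * y} \<union> {max (2 * y + 1) (x + y - z - n)..x + y - t - r}"
    using assms n_eq by (auto simp: min_def max_def)
  have c: "{u. x + y + z - n - 2 * z \<le> u \<and> u \<le> x + y + z - n \<and> 2 * z \<le> u
      \<and> 2 * y \<le> n + 1 + 2 * u - 2 * z \<and> n + 1 + 2 * u - 2 * z \<le> 2 * x}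
      = {max (x + y - z - n) (y + z - t - r)..x + z - t - 1}"
    using assms n_eq by (auto simp: min_def max_def)
  have b: "{u. 2 * z \<le> x + y + z - n - 1 - u \<and> x + y + z - n - 1 - u \<le> min (2 * y) u
      \<and> 2 * y \<le> n + 1 + 2 * u - 2 * z \<and> n + 1 + 2 * u - 2 * z \<le> 2 * x}
      = {max (max (x + z - y - n - 1) h) (y + z - t - r)..min (x + y - z - n - 1) (x + z - t - 1)}"
    using assms n_eq h by (auto simp: min_def max_def)
  have d: "{u. 2 * z \<le> x + y + z - n - 1 - u \<and> x + y + z - n - 1 - u \<le> min (2 * y) u
      \<and> 2 * y \<le> n + 2 + 2 * u \<and> n + 2 + 2 * u \<le> 2 * x}
      = {max (max (x + z - y - n - 1) h) (y - t - 1)..x - t - 1 - r}"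
    using assms n_eq h by (auto simp: min_def max_def)
  have r: "even n \<longleftrightarrow> r = 0" unfolding r_def by presburger
  have disj: "{max (2 * y - n) (x + y - z - n)..2 * y} \<inter> {max (2 * y + 1) (x + y - z - n)..x + y - t - r} = {}"
    by auto
  have int_nat: "int (nat v) = max 0 v" for v by auto
  have "rect_mult (2 * x) (2 * y) (2 * z) (x + y + z) n - rect_mult (2 * x) (2 * y) (2 * z) (x + y + z) (n + 1) =
      max 0 (2 * y - max (2 * y - n) (x + y - z - n) + 1)
      + max 0 (x + y - t - r - max (2 * y + 1) (x + y - z - n) + 1)
      - max 0 (x + z - t - 1 - max (x + y - z - n) (y + z - t - r) + 1)
      - max 0 (min (x + y - z - n - 1) (x + z - t - 1) - max (max (x + z - y - n - 1) h) (y + z - t - r) + 1)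
      + max 0 (x - t - 1 - r - max (max (x + z - y - n - 1) h) (y - t - 1) + 1)"
    by (subst rect_mult_diff) (use assms in \<open>simp_all only: a b c d int_nat of_nat_add
      card_Un_disjoint[OF finite_atLeastAtMost_int finite_atLeastAtMost_int disj] card_atLeastAtMost_int\<close>, auto simp: algebra_simps)
  then show ?thesis
    using interval_lengths[OF n z y x n_eq h] by (simp only: r)
qed

section \<open>Permutation characters and contingency tables\<close>

definition words :: "nat \<Rightarrow> 'a set \<Rightarrow> ('a \<Rightarrow> int) \<Rightarrow> (nat \<Rightarrow> 'a) set" where
  "words n A c = {w \<in> {1..n} \<rightarrow>\<^sub>E A. \<forall>a\<in>A. int (card {i\<in>{1..n}. w i = a}) = c a}"

text \<open>
  The character of the permutation module on words. Contents are integers: a negative entry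
  leaves no words.
\<close>

definition perm_char :: "nat \<Rightarrow> 'a set \<Rightarrow> ('a \<Rightarrow> int) \<Rightarrow> perm \<Rightarrow> int" where
  "perm_char n A c g = int (card {w \<in> words n A c. \<forall>i\<in>{1..n}. w (g i) = w i})"

definition tables :: "'a set \<Rightarrow> 'b set \<Rightarrow> ('a \<Rightarrow> int) \<Rightarrow> ('b \<Rightarrow> int) \<Rightarrow> ('a \<times> 'b \<Rightarrow> int) set" where
  "tables A B c d = {X \<in> A \<times> B \<rightarrow>\<^sub>E {0..}.
     (\<forall>a\<in>A. (\<Sum>b\<in>B. X (a, b)) = c a) \<and> (\<forall>b\<in>B. (\<Sum>a\<in>A. X (a, b)) = d b)}"

lemma finite_words: "finite A \<Longrightarrow> finite (words n A c)"
  by (rule finite_subset[of _ "{1..n} \<rightarrow>\<^sub>E A"]) (auto simp: words_def intro: finite_PiE)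

lemma finite_tables:
  assumes "finite A" "finite B"
  shows "finite (tables A B c d)"
proof (rule finite_subset)
  show "tables A B c d \<subseteq> (\<Pi>\<^sub>E ab\<in>A \<times> B. {0..c (fst ab)})"
  proof
    fix X assume X: "X \<in> tables A B c d"
    have "X (a, b) \<le> c a" if "a \<in> A" "b \<in> B" for a b
    proof -
      have "X (a, b) \<le> (\<Sum>b\<in>B. X (a, b))"
        by (rule member_le_sum) (use X that assms in \<open>auto simp: tables_def\<close>)
      then show ?thesis using X that by (simp add: tables_def)
    qed
    then show "X \<in> (\<Pi>\<^sub>E ab\<in>A \<times> B. {0..c (fst ab)})"
      using X by (auto simp: tables_def PiE_iff)
  qed
  show "finite (\<Pi>\<^sub>E ab\<in>A \<times> B. {0..c (fst ab)})"
    using assms by (auto intro!: finite_PiE)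
qed

lemma card_fibres:
  assumes "finite B" "finite I" "\<And>i. i \<in> I \<Longrightarrow> v i \<in> B"
  shows "(\<Sum>b\<in>B. card {i\<in>I. P i \<and> v i = b}) = card {i\<in>I. P i}"
proof -
  have "card {i\<in>I. P i} = card (\<Union>b\<in>B. {i\<in>I. P i \<and> v i = b})"
    using assms(3) by (intro arg_cong[of _ _ card]) auto
  also have "\<dots> = (\<Sum>b\<in>B. card {i\<in>I. P i \<and> v i = b})"
    by (rule card_UN_disjoint) (use assms in auto)
  finally show ?thesis ..
qed

text \<open>Two words of length n are one word in pairs of letters, fixed by g exactly when both
  are. The content of the joint word is a table whose margins are the two given contents, and
  sorting the pairs of words by this table gives the sum.\<close>

lemma perm_char_mult:
  fixes A :: "'a set" and B :: "'b set"
  assumes fin: "finite A" "finite B" and g: "g \<in> symgrp n"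
  shows "perm_char n A c g * perm_char n B d g = (\<Sum>X\<in>tables A B c d. perm_char n (A \<times> B) X g)"
proof -
  let ?I = "{1..n}"
  have gI: "g i \<in> ?I" if "i \<in> ?I" for i
    using g that permutes_in_image[of g ?I i] by (auto simp: symgrp_def)
  define W1 where "W1 = {w \<in> words n A c. \<forall>i\<in>?I. w (g i) = w i}"
  define W2 where "W2 = {w \<in> words n B d. \<forall>i\<in>?I. w (g i) = w i}"
  define W where "W X = {w \<in> words n (A \<times> B) X. \<forall>i\<in>?I. w (g i) = w i}" for X
  define cont :: "(nat \<Rightarrow> 'a) \<Rightarrow> (nat \<Rightarrow> 'b) \<Rightarrow> 'a \<times> 'b \<Rightarrow> int" where
    "cont w v = (\<lambda>ab\<in>A \<times> B. int (card {i\<in>?I. w i = fst ab \<and> v i = snd ab}))" for w v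
  define pr where "pr = (\<lambda>(w, v). (cont w v, \<lambda>i\<in>?I. (w i, v i)))"
  define un :: "('a \<times> 'b \<Rightarrow> int) \<times> (nat \<Rightarrow> 'a \<times> 'b) \<Rightarrow> (nat \<Rightarrow> 'a) \<times> (nat \<Rightarrow> 'b)"
    where "un = (\<lambda>(X, u). (\<lambda>i\<in>?I. fst (u i), \<lambda>i\<in>?I. snd (u i)))"
  have "bij_betw pr (W1 \<times> W2) (SIGMA X:tables A B c d. W X)"
  proof (rule bij_betw_byWitness[of _ un])
    show "\<forall>a\<in>W1 \<times> W2. un (pr a) = a"
      by (auto simp: un_def pr_def W1_def W2_def words_def PiE_iff extensional_def fun_eq_iff)
    show "pr ` (W1 \<times> W2) \<subseteq> (SIGMA X:tables A B c d. W X)"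
    proof clarify
      fix w v X u assume w: "w \<in> W1" and v: "v \<in> W2" and p: "(X, u) = pr (w, v)"
      have wA: "w i \<in> A" and vB: "v i \<in> B" if "i \<in> ?I" for i
        using w v that by (auto simp: W1_def W2_def words_def)
      have X: "X = cont w v" and u: "u = (\<lambda>i\<in>?I. (w i, v i))" using p by (auto simp: pr_def)
      have "(\<Sum>b\<in>B. X (a, b)) = c a" if a: "a \<in> A" for a
      proof -
        have "(\<Sum>b\<in>B. X (a, b)) = int (\<Sum>b\<in>B. card {i\<in>?I. w i = a \<and> v i = b})"
          using a by (simp add: X cont_def)
        also have "\<dots> = int (card {i\<in>?I. w i = a})"
          by (subst card_fibres) (use fin vB in auto)
        also have "\<dots> = c a" using w a by (simp add: W1_def words_def)
        finally show ?thesis .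
      qed
      moreover have "(\<Sum>a\<in>A. X (a, b)) = d b" if b: "b \<in> B" for b
      proof -
        have "(\<Sum>a\<in>A. X (a, b)) = int (\<Sum>a\<in>A. card {i\<in>?I. v i = b \<and> w i = a})"
          using b by (simp add: X cont_def conj_commute)
        also have "\<dots> = int (card {i\<in>?I. v i = b})"
          by (subst card_fibres) (use fin wA in auto)
        also have "\<dots> = d b" using v b by (simp add: W2_def words_def)
        finally show ?thesis .
      qed
      ultimately have "X \<in> tables A B c d" by (auto simp: tables_def X cont_def)
      moreover have "{i\<in>?I. (if i \<in> ?I then (w i, v i) else undefined) = (a, b)} =
          {i\<in>?I. w i = a \<and> v i = b}" for a b
        by auto
      then have "u \<in> W X"
        using w v gI wA vB unfolding W_def words_def u X cont_def W1_def W2_def by auto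
      ultimately show "X \<in> tables A B c d \<and> u \<in> W X" ..
    qed
    show "\<forall>a'\<in>SIGMA X:tables A B c d. W X. pr (un a') = a'"
    proof clarify
      fix X u assume X: "X \<in> tables A B c d" and u: "u \<in> W X"
      have "{i\<in>?I. fst (u i) = a \<and> snd (u i) = b} = {i\<in>?I. u i = (a, b)}" for a b
        by (auto simp: prod_eq_iff)
      then have "cont (\<lambda>i\<in>?I. fst (u i)) (\<lambda>i\<in>?I. snd (u i)) = X"
        using X u by (auto simp: cont_def tables_def W_def words_def fun_eq_iff PiE_iff extensional_def
            cong: conj_cong)
      moreover have "(\<lambda>i\<in>?I. ((\<lambda>i\<in>?I. fst (u i)) i, (\<lambda>i\<in>?I. snd (u i)) i)) = u"
        using u by (auto simp: W_def words_def fun_eq_iff PiE_iff extensional_def)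
      ultimately show "pr (un (X, u)) = (X, u)" by (simp add: pr_def un_def)
    qed
    show "un ` (SIGMA X:tables A B c d. W X) \<subseteq> W1 \<times> W2"
    proof clarify
      fix X u w v assume X: "X \<in> tables A B c d" and u: "u \<in> W X" and p: "(w, v) = un (X, u)"
      have w: "w = (\<lambda>i\<in>?I. fst (u i))" and v: "v = (\<lambda>i\<in>?I. snd (u i))" using p by (auto simp: un_def)
      have uAB: "fst (u i) \<in> A" "snd (u i) \<in> B" if "i \<in> ?I" for i
        using u that by (auto simp: W_def words_def PiE_iff mem_Times_iff)
      have Xab: "X (a, b) = int (card {i\<in>?I. fst (u i) = a \<and> snd (u i) = b})" if "a \<in> A" "b \<in> B" for a b
      proof -
        have "{i\<in>?I. fst (u i) = a \<and> snd (u i) = b} = {i\<in>?I. u i = (a, b)}"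
          by (auto simp: prod_eq_iff)
        then show ?thesis using u that by (simp add: W_def words_def)
      qed
      have "int (card {i\<in>?I. w i = a}) = c a" if a: "a \<in> A" for a
      proof -
        have "int (card {i\<in>?I. w i = a}) = int (card {i\<in>?I. fst (u i) = a})"
          by (intro arg_cong[of _ _ int] arg_cong[of _ _ card]) (auto simp: w)
        also have "\<dots> = int (\<Sum>b\<in>B. card {i\<in>?I. fst (u i) = a \<and> snd (u i) = b})"
          by (subst card_fibres) (use fin uAB in auto)
        also have "\<dots> = (\<Sum>b\<in>B. X (a, b))" using a by (simp add: Xab)
        also have "\<dots> = c a" using X a by (simp add: tables_def)
        finally show ?thesis .
      qed
      moreover have "int (card {i\<in>?I. v i = b}) = d b" if b: "b \<in> B" for b
      proof -
        have "int (card {i\<in>?I. v i = b}) = int (card {i\<in>?I. snd (u i) = b})"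
          by (intro arg_cong[of _ _ int] arg_cong[of _ _ card]) (auto simp: v)
        also have "\<dots> = int (\<Sum>a\<in>A. card {i\<in>?I. snd (u i) = b \<and> fst (u i) = a})"
          by (subst card_fibres) (use fin uAB in auto)
        also have "\<dots> = (\<Sum>a\<in>A. X (a, b))" using b by (simp add: Xab conj_commute)
        also have "\<dots> = d b" using X b by (simp add: tables_def)
        finally show ?thesis .
      qed
      moreover have "w (g i) = w i" "v (g i) = v i" if "i \<in> ?I" for i
        using u gI that by (auto simp: w v W_def)
      moreover have "w \<in> ?I \<rightarrow>\<^sub>E A" "v \<in> ?I \<rightarrow>\<^sub>E B" using uAB by (auto simp: w v)
      ultimately show "w \<in> W1 \<and> v \<in> W2" by (auto simp: W1_def W2_def words_def)
    qed
  qed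
  then have "card W1 * card W2 = card (SIGMA X:tables A B c d. W X)"
    using bij_betw_same_card by (fastforce simp: card_cartesian_product)
  also have "\<dots> = (\<Sum>X\<in>tables A B c d. card (W X))"
    by (rule card_SigmaI) (auto simp: finite_tables fin W_def intro: finite_subset[OF _ finite_words])
  finally show ?thesis by (simp add: perm_char_def W1_def W2_def W_def flip: of_nat_mult of_nat_sum)
qed

section \<open>Transitivity on words and scalar products of permutation characters\<close>

lemma symgrp_group:
  shows "id \<in> symgrp n" "p \<in> symgrp n \<Longrightarrow> inv p \<in> symgrp n"
    "p \<in> symgrp n \<Longrightarrow> q \<in> symgrp n \<Longrightarrow> p \<circ> q \<in> symgrp n"
  by (auto simp: symgrp_def permutes_id intro: permutes_inv permutes_compose)

lemma symgrp_inverse: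
  assumes "p \<in> symgrp n"
  shows "inv p \<circ> p = id" "p \<circ> inv p = id" "inv (inv p) = p"
    "inv p (p i) = i" "p (inv p i) = i"
    "inv p \<circ> (p \<circ> f) = f" "p \<circ> (inv p \<circ> f) = f" "h \<circ> inv p \<circ> p = h" "h \<circ> p \<circ> inv p = h"
  using assms permutes_inverses[of p "{1..n}"] permutes_inv_inv[of p "{1..n}"]
  by (auto simp: symgrp_def fun_eq_iff)

lemma symgrp_inv_comp: "p \<in> symgrp n \<Longrightarrow> q \<in> symgrp n \<Longrightarrow> inv (p \<circ> q) = inv q \<circ> inv p"
  by (auto simp: symgrp_def intro!: o_inv_distrib permutes_bij)

lemma finite_symgrp: "finite (symgrp n)"
  by (simp add: symgrp_def finite_permutations)

lemma card_symgrp: "card (symgrp n) = fact n"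
  by (simp add: symgrp_def card_permutations)

lemma words_nonempty:
  assumes fin: "finite A" and c: "\<And>a. a \<in> A \<Longrightarrow> 0 \<le> c a" "(\<Sum>a\<in>A. c a) = int n"
  shows "words n A c \<noteq> {}"
proof -
  have "card (SIGMA a:A. {..<nat (c a)}) = (\<Sum>a\<in>A. nat (c a))" using fin by simp
  also have "int \<dots> = int n" using c by simp
  finally have "card {1..n} = card (SIGMA a:A. {..<nat (c a)})" by simp
  then obtain f where f: "bij_betw f {1..n} (SIGMA a:A. {..<nat (c a)})"
    using finite_same_card_bij[of "{1..n}" "SIGMA a:A. {..<nat (c a)}"] fin by auto
  define w where "w = (\<lambda>i\<in>{1..n}. fst (f i))"
  have "int (card {i\<in>{1..n}. w i = a}) = c a" if a: "a \<in> A" for a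
  proof -
    have "f ` {i\<in>{1..n}. w i = a} = {s \<in> f ` {1..n}. fst s = a}" by (auto simp: w_def)
    also have "\<dots> = {a} \<times> {..<nat (c a)}" unfolding bij_betw_imp_surj_on[OF f] using a by auto
    finally have "card (f ` {i\<in>{1..n}. w i = a}) = nat (c a)" by (simp add: card_cartesian_product)
    moreover have "inj_on f {i\<in>{1..n}. w i = a}"
      using bij_betw_imp_inj_on[OF f] by (rule inj_on_subset) auto
    ultimately show ?thesis using c(1)[OF a] by (simp add: card_image)
  qed
  moreover have "w \<in> {1..n} \<rightarrow>\<^sub>E A" using bij_betwE[OF f] by (auto simp: w_def)
  ultimately have "w \<in> words n A c" by (auto simp: words_def)
  then show ?thesis by auto
qed

lemma words_comp:
  assumes w: "w \<in> words n A c" and g: "g \<in> symgrp n"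
  shows "w \<circ> g \<in> words n A c"
proof -
  have g': "g permutes {1..n}" using g by (simp add: symgrp_def)
  have "card {i\<in>{1..n}. w (g i) = a} = card {i\<in>{1..n}. w i = a}" for a
    by (rule bij_betw_same_card[of g], rule bij_betw_byWitness[of _ "inv g"])
      (use g' permutes_in_image[OF g'] permutes_in_image[OF permutes_inv[OF g']]
        permutes_inverses[OF g'] in auto)
  then show ?thesis
    using w g' permutes_in_image[OF g'] permutes_not_in[OF g']
    by (auto simp: words_def PiE_iff extensional_def)
qed

lemma words_transitive:
  assumes w: "w \<in> words n A c" and v: "v \<in> words n A c" and fin: "finite A"
  shows "\<exists>g\<in>symgrp n. v = w \<circ> g"
proof -
  have "image_mset v (mset_set {1..n}) = image_mset w (mset_set {1..n})"
  proof (rule multiset_eqI)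
    fix a
    have "card {i\<in>{1..n}. v i = a} = card {i\<in>{1..n}. w i = a}"
    proof (cases "a \<in> A")
      case True
      then have "int (card {i\<in>{1..n}. v i = a}) = int (card {i\<in>{1..n}. w i = a})"
        using w v by (simp add: words_def)
      then show ?thesis by simp
    next
      case False
      then have "{i\<in>{1..n}. v i = a} = {}" "{i\<in>{1..n}. w i = a} = {}" using w v
        by (auto simp: words_def)
      then show ?thesis by (simp only:)
    qed
    moreover have "count (image_mset u (mset_set {1..n})) a = (\<Sum>i\<in>{i\<in>{1..n}. u i = a}. 1)" for u :: "nat \<Rightarrow> 'a"
      unfolding count_image_mset by (rule sum.cong) auto
    ultimately show "count (image_mset v (mset_set {1..n})) a = count (image_mset w (mset_set {1..n})) a"
      by simp
  qed
  from image_mset_eq_implies_permutes[OF _ this] obtain p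
    where p: "p permutes {1..n}" "\<forall>x\<in>{1..n}. v x = w (p x)" by auto
  have "v = w \<circ> p"
  proof
    fix i show "v i = (w \<circ> p) i"
      using p w v permutes_not_in[OF p(1)] by (cases "i \<in> {1..n}") (auto simp: words_def PiE_iff extensional_def)
  qed
  then show ?thesis using p(1) by (auto simp: symgrp_def)
qed

lemma fixed_word_iff:
  assumes "w \<in> words n A c" "g \<in> symgrp n"
  shows "(\<forall>i\<in>{1..n}. w (g i) = w i) \<longleftrightarrow> w \<circ> g = w"
  using assms permutes_not_in[of g "{1..n}"] by (auto simp: symgrp_def fun_eq_iff)

text \<open>Burnside's count for a transitive action. The permutations taking \<open>w0\<close> to w
  are a coset, equinumerous with the stabiliser of w; so fixed points may be replaced by
  transporters from \<open>w0\<close>, and each permutation transports \<open>w0\<close> to exactly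
  one word.\<close>

lemma sum_perm_char:
  assumes fin: "finite A" and ne: "words n A c \<noteq> {}"
  shows "(\<Sum>g\<in>symgrp n. perm_char n A c g) = fact n"
proof -
  let ?G = "symgrp n" and ?W = "words n A c"
  obtain w0 where w0: "w0 \<in> ?W" using ne by auto
  have stab: "card {g\<in>?G. w0 \<circ> g = w} = card {g\<in>?G. w \<circ> g = w}" if w: "w \<in> ?W" for w
  proof -
    obtain h where h: "h \<in> ?G" "w = w0 \<circ> h" using words_transitive[OF w0 w fin] by auto
    have 1: "w0 \<circ> (h \<circ> g) = w \<circ> g" and 2: "w \<circ> (inv h \<circ> g) = w0 \<circ> g" for g :: perm
      using h symgrp_inverse(7)[OF h(1), of g] by (simp_all add: comp_assoc)
    show ?thesis
      by (rule bij_betw_same_card[of "\<lambda>g. inv h \<circ> g"], rule bij_betw_byWitness[of _ "\<lambda>g. h \<circ> g"])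
        (simp_all add: image_subset_iff symgrp_group h(1) symgrp_inverse(6,7)[OF h(1)] 1 2)
  qed
  have "(\<Sum>g\<in>?G. perm_char n A c g) = (\<Sum>g\<in>?G. \<Sum>w\<in>?W. if w \<circ> g = w then 1 else 0)"
  proof (rule sum.cong[OF refl])
    fix g assume "g \<in> ?G"
    then have "{w \<in> ?W. \<forall>i\<in>{1..n}. w (g i) = w i} = {w\<in>?W. w \<circ> g = w}"
      by (intro Collect_cong conj_cong refl fixed_word_iff)
    then show "perm_char n A c g = (\<Sum>w\<in>?W. if w \<circ> g = w then 1 else 0)"
      by (simp add: perm_char_def sum.If_cases finite_words[OF fin] Int_def)
  qed
  also have "\<dots> = (\<Sum>w\<in>?W. \<Sum>g\<in>?G. if w \<circ> g = w then 1 else 0)" by (rule sum.swap)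
  also have "\<dots> = (\<Sum>w\<in>?W. \<Sum>g\<in>?G. if w0 \<circ> g = w then 1 else 0)"
    by (rule sum.cong[OF refl]) (use stab in \<open>simp add: sum.If_cases finite_symgrp Int_def\<close>)
  also have "\<dots> = (\<Sum>g\<in>?G. \<Sum>w\<in>?W. if w0 \<circ> g = w then 1 else 0)" by (rule sum.swap)
  also have "\<dots> = (\<Sum>g\<in>?G. 1)"
    by (rule sum.cong[OF refl]) (use words_comp[OF w0] in \<open>simp add: finite_words[OF fin]\<close>)
  also have "\<dots> = fact n" by (simp add: card_symgrp)
  finally show ?thesis .
qed

text \<open>Each table contributes one transitive permutation character, that is, one orbit. As its
  entries are nonnegative and sum to n, there are words with this content.\<close>

lemma sum_perm_char_mult:
  assumes fin: "finite A" "finite B" and c: "(\<Sum>a\<in>A. c a) = int n"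
  shows "(\<Sum>g\<in>symgrp n. perm_char n A c g * perm_char n B d g) = fact n * int (card (tables A B c d))"
proof -
  have "(\<Sum>g\<in>symgrp n. perm_char n A c g * perm_char n B d g) =
      (\<Sum>g\<in>symgrp n. \<Sum>X\<in>tables A B c d. perm_char n (A \<times> B) X g)"
    by (rule sum.cong[OF refl]) (simp add: perm_char_mult fin)
  also have "\<dots> = (\<Sum>X\<in>tables A B c d. \<Sum>g\<in>symgrp n. perm_char n (A \<times> B) X g)" by (rule sum.swap)
  also have "\<dots> = (\<Sum>X\<in>tables A B c d. fact n)"
  proof (rule sum.cong[OF refl])
    fix X assume X: "X \<in> tables A B c d"
    have "(\<Sum>ab\<in>A \<times> B. X ab) = (\<Sum>a\<in>A. \<Sum>b\<in>B. X (a, b))"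
      by (simp add: sum.cartesian_product)
    also have "\<dots> = int n" using X c by (simp add: tables_def)
    finally show "(\<Sum>g\<in>symgrp n. perm_char n (A \<times> B) X g) = fact n"
      by (intro sum_perm_char words_nonempty) (use X fin in \<open>auto simp: tables_def\<close>)
  qed
  finally show ?thesis by (simp add: mult.commute)
qed

text \<open>The recursion of \<open>alt_coeff\<close> with the alternant replaced by 1: a
  coefficient in a product of complete symmetric polynomials, which counts three-row tables with
  column sums from the list. Expanding the alternant expresses \<open>alt_coeff\<close> by six of
  these numbers.\<close>

fun table_count :: "int list \<Rightarrow> int \<Rightarrow> int \<Rightarrow> int \<Rightarrow> int" where
  "table_count [] a b c = of_bool (a = 0 \<and> b = 0 \<and> c = 0)"
| "table_count (r # rs) a b c = (\<Sum>(p, q, s)\<in>simplex r. table_count rs (a - p) (b - q) (c - s))"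

lemma alt_coeff_eq_table_count:
  "alt_coeff rs a b c = table_count rs (a - 2) (b - 1) c - table_count rs (a - 1) (b - 2) c - table_count rs (a - 2) b (c - 1)
    + table_count rs (a - 1) b (c - 2) + table_count rs a (b - 2) (c - 1) - table_count rs a (b - 1) (c - 2)"
proof (induction rs arbitrary: a b c)
  case Nil
  show ?case by (simp add: algebra_simps)
next
  case (Cons r rs)
  show ?case
    unfolding alt_coeff.simps table_count.simps Cons.IH
    by (simp add: sum.distrib sum_subtractf case_prod_unfold algebra_simps)
qed

definition vec3 :: "int \<Rightarrow> int \<Rightarrow> int \<Rightarrow> nat \<Rightarrow> int" where
  "vec3 a b c = (\<lambda>i. if i = 0 then a else if i = 1 then b else c)"

lemma tables_Nil: "tables A {} v X = (if \<forall>a\<in>A. v a = 0 then {\<lambda>_. undefined} else {})"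
  by (auto simp: tables_def)

text \<open>A table splits into its column b, whose three entries form a point of the simplex of
  size X b, and a table with the row sums lowered by these entries. The map \<open>ext\<close> glues
  the two together again.\<close>

lemma card_tables_insert:
  assumes b: "b \<notin> B" "finite B"
  shows "int (card (tables {0, 1, 2} (insert b B) (vec3 v0 v1 v2) X)) =
    (\<Sum>(p, q, s)\<in>simplex (X b). int (card (tables {0, 1, 2} B (vec3 (v0 - p) (v1 - q) (v2 - s)) X)))"
proof -
  let ?V = "{0, 1, 2} :: nat set"
  define T where "T = (\<lambda>(p, q, s). tables ?V B (vec3 (v0 - p) (v1 - q) (v2 - s)) X)"
  define col where "col Y = (Y (0, b), Y (1, b), Y (2, b))" for Y :: "nat \<times> 'a \<Rightarrow> int"
  define ext where "ext = (\<lambda>((p, q, s), Y). \<lambda>ab\<in>?V \<times> insert b B.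
     if snd ab = b then vec3 p q s (fst ab) else Y ab)"
  have "bij_betw (\<lambda>Y. (col Y, restrict Y (?V \<times> B))) (tables ?V (insert b B) (vec3 v0 v1 v2) X)
      (SIGMA pqs:simplex (X b). T pqs)"
  proof (rule bij_betw_byWitness[of _ ext])
    show "\<forall>Y\<in>tables ?V (insert b B) (vec3 v0 v1 v2) X. ext (col Y, restrict Y (?V \<times> B)) = Y"
      by (auto simp: ext_def col_def tables_def fun_eq_iff PiE_iff extensional_def vec3_def)
    show "(\<lambda>Y. (col Y, restrict Y (?V \<times> B))) ` tables ?V (insert b B) (vec3 v0 v1 v2) X
        \<subseteq> (SIGMA pqs:simplex (X b). T pqs)"
    proof (rule image_subsetI)
      fix Y assume Y: "Y \<in> tables ?V (insert b B) (vec3 v0 v1 v2) X"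
      then have nn: "0 \<le> Y (a, b')" if "a \<in> ?V" "b' \<in> insert b B" for a b'
        using that unfolding tables_def by blast
      have col: "\<forall>b'\<in>insert b B. Y (0, b') + Y (1, b') + Y (2, b') = X b'"
        and row: "\<forall>a\<in>?V. Y (a, b) + (\<Sum>b'\<in>B. Y (a, b')) = vec3 v0 v1 v2 a"
        using Y b by (simp_all add: tables_def add.assoc)
      have "restrict Y (?V \<times> B) \<in> ?V \<times> B \<rightarrow>\<^sub>E {0..}" using nn by auto
      then have "restrict Y (?V \<times> B) \<in> T (Y (0, b), Y (1, b), Y (2, b))"
        using row col unfolding T_def tables_def by (simp add: vec3_def add.assoc)
      moreover have "col Y \<in> simplex (X b)" using nn col by (simp add: simplex_def col_def)
      ultimately show "(col Y, restrict Y (?V \<times> B)) \<in> (SIGMA pqs:simplex (X b). T pqs)"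
        by (simp add: col_def)
    qed
    show "\<forall>a'\<in>SIGMA pqs:simplex (X b). T pqs. (col (ext a'), restrict (ext a') (?V \<times> B)) = a'"
      using b by (auto simp: ext_def col_def T_def tables_def fun_eq_iff PiE_iff extensional_def vec3_def)
    show "ext ` (SIGMA pqs:simplex (X b). T pqs) \<subseteq> tables ?V (insert b B) (vec3 v0 v1 v2) X"
    proof (rule image_subsetI)
      fix a' assume "a' \<in> (SIGMA pqs:simplex (X b). T pqs)"
      then obtain p q s Y where a': "a' = ((p, q, s), Y)" and s: "(p, q, s) \<in> simplex (X b)"
        and Y: "Y \<in> tables ?V B (vec3 (v0 - p) (v1 - q) (v2 - s)) X"
        by (auto simp: T_def)
      have YP: "Y \<in> ?V \<times> B \<rightarrow>\<^sub>E {0..}" using Y unfolding tables_def by blast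
      then have nn: "0 \<le> Y (a, b')" if "a \<in> ?V" "b' \<in> B" for a b'
        using that by blast
      have E: "ext a' (a, b) = vec3 p q s a" "b' \<in> B \<Longrightarrow> ext a' (a, b') = Y (a, b')"
        if "a \<in> ?V" for a b'
        using that b by (auto simp: ext_def a')
      have pos: "0 \<le> ext a' (a, b')" if a: "a \<in> ?V" and "b' \<in> insert b B" for a b'
        using that nn[OF a] s E[OF a] by (cases "b' = b") (auto simp: simplex_def vec3_def)
      have "ext a' \<in> ?V \<times> insert b B \<rightarrow>\<^sub>E {0..}"
      proof (rule PiE_I)
        fix ab assume "ab \<in> ?V \<times> insert b B"
        then show "ext a' ab \<in> {0..}" using pos by (metis SigmaE atLeast_iff)
      qed (simp add: ext_def a')
      moreover have "(\<Sum>b'\<in>insert b B. ext a' (a, b')) = vec3 v0 v1 v2 a" if a: "a \<in> ?V" for a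
      proof -
        have "(\<Sum>b'\<in>insert b B. ext a' (a, b')) = vec3 p q s a + (\<Sum>b'\<in>B. Y (a, b'))"
          using b a by (simp add: E del: insert_iff)
        also have "(\<Sum>b'\<in>B. Y (a, b')) = vec3 (v0 - p) (v1 - q) (v2 - s) a"
          using Y a unfolding tables_def by blast
        finally show ?thesis by (simp add: vec3_def)
      qed
      moreover have "(\<Sum>a\<in>?V. ext a' (a, b')) = X b'" if b': "b' \<in> insert b B" for b'
      proof (cases "b' = b")
        case True
        have "(\<Sum>a\<in>?V. ext a' (a, b)) = (\<Sum>a\<in>?V. vec3 p q s a)"
          by (rule sum.cong) (auto simp: E)
        also have "\<dots> = X b" using s by (simp add: vec3_def simplex_def)
        finally show ?thesis using True by simp
      next
        case False
        then have b'': "b' \<in> B" using b' by auto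
        have "(\<Sum>a\<in>?V. ext a' (a, b')) = (\<Sum>a\<in>?V. Y (a, b'))"
          by (rule sum.cong) (use b'' in \<open>auto simp: E\<close>)
        also have "\<dots> = X b'" using Y b'' unfolding tables_def by blast
        finally show ?thesis .
      qed
      ultimately show "ext a' \<in> tables ?V (insert b B) (vec3 v0 v1 v2) X"
        unfolding tables_def by blast
    qed
  qed
  then have "card (tables ?V (insert b B) (vec3 v0 v1 v2) X) = card (SIGMA pqs:simplex (X b). T pqs)"
    by (rule bij_betw_same_card)
  also have "\<dots> = (\<Sum>pqs\<in>simplex (X b). card (T pqs))"
    by (rule card_SigmaI) (use b in \<open>auto simp: finite_simplex T_def intro!: finite_tables\<close>)
  finally show ?thesis by (simp add: T_def case_prod_unfold)
qed

lemma card_tables_list: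
  assumes "distinct bs"
  shows "int (card (tables {0, 1, 2} (set bs) (vec3 v0 v1 v2) X)) = table_count (map X bs) v0 v1 v2"
  using assms
proof (induction bs arbitrary: v0 v1 v2)
  case Nil
  show ?case by (simp add: tables_Nil vec3_def)
next
  case (Cons b bs)
  then show ?case by (simp add: card_tables_insert del: One_nat_def)
qed

text \<open>The Jacobi-Trudi determinant for three rows.\<close>

definition det_char :: "nat \<Rightarrow> int \<Rightarrow> int \<Rightarrow> int \<Rightarrow> perm \<Rightarrow> int" where
  "det_char n a b c g =
     perm_char n {0, 1, 2} (vec3 a b c) g - perm_char n {0, 1, 2} (vec3 (a + 1) (b - 1) c) g
     - perm_char n {0, 1, 2} (vec3 a (b + 1) (c - 1)) g + perm_char n {0, 1, 2} (vec3 (a + 1) (b + 1) (c - 2)) g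
     + perm_char n {0, 1, 2} (vec3 (a + 2) (b - 1) (c - 1)) g - perm_char n {0, 1, 2} (vec3 (a + 2) b (c - 2)) g"

lemma sum_phi3:
  assumes "distinct bs" "p + q + s = int n"
  shows "(\<Sum>g\<in>symgrp n. perm_char n {0, 1, 2} (vec3 p q s) g * perm_char n (set bs) X g)
    = fact n * table_count (map X bs) p q s"
proof -
  have "(\<Sum>a\<in>{0, 1, 2}. vec3 p q s a) = int n" using assms(2) by (simp add: vec3_def)
  then have "(\<Sum>g\<in>symgrp n. perm_char n {0, 1, 2} (vec3 p q s) g * perm_char n (set bs) X g)
      = fact n * int (card (tables {0, 1, 2} (set bs) (vec3 p q s) X))"
    by (intro sum_perm_char_mult) simp_all
  then show ?thesis by (simp only: card_tables_list[OF assms(1)])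
qed

lemma kostka_eq_table_count:
  "kostka rs a b c = table_count rs a b c - table_count rs (a + 1) (b - 1) c - table_count rs a (b + 1) (c - 1)
    + table_count rs (a + 1) (b + 1) (c - 2) + table_count rs (a + 2) (b - 1) (c - 1) - table_count rs (a + 2) b (c - 2)"
proof -
  have "a + 2 - 2 = a" "b + 1 - 1 = b" "a + 2 - 1 = a + 1" "b + 1 - 2 = b - 1" by simp_all
  then show ?thesis by (simp only: kostka_def alt_coeff_eq_table_count)
qed

text \<open>The six terms of the determinant give six numbers of tables, and their signed sum is the
  expanded alternant. Thus the determinant behaves as the irreducible character should: its
  multiplicity in a permutation module is a Kostka number.\<close>

lemma sum_det_char_perm_char:
  assumes "distinct bs" "a + b + c = int n"
  shows "(\<Sum>g\<in>symgrp n. det_char n a b c g * perm_char n (set bs) X g) = fact n * kostka (map X bs) a b c"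
proof -
  have *: "(\<Sum>g\<in>symgrp n. perm_char n {0, 1, 2} (vec3 p q s) g * perm_char n (set bs) X g)
      = fact n * table_count (map X bs) p q s" if "p + q + s = a + b + c" for p q s
    using that assms by (intro sum_phi3) simp_all
  show ?thesis
    unfolding det_char_def left_diff_distrib distrib_right sum.distrib sum_subtractf
      kostka_eq_table_count distrib_left right_diff_distrib
    by (subst *, simp)+ simp
qed

lemma sum_det_char_det_char:
  assumes "a \<ge> b" "b \<ge> c" "c \<ge> 0" "a + b + c = int n"
  shows "(\<Sum>g\<in>symgrp n. det_char n a b c g * det_char n a b c g) = fact n"
proof -
  have *: "(\<Sum>g\<in>symgrp n. det_char n a b c g * perm_char n {0, 1, 2} (vec3 p q s) g) = fact n * kostka [p, q, s] a b c" for p q s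
    using sum_det_char_perm_char[of "[0, 1, 2]" a b c n "vec3 p q s"] assms(4) by (simp add: vec3_def)
  have "(\<Sum>g\<in>symgrp n. det_char n a b c g * det_char n a b c g) = fact n * (kostka [a, b, c] a b c - kostka [a + 1, b - 1, c] a b c
    - kostka [a, b + 1, c - 1] a b c + kostka [a + 1, b + 1, c - 2] a b c
    + kostka [a + 2, b - 1, c - 1] a b c - kostka [a + 2, b, c - 2] a b c)"
    unfolding det_char_def[of n a b c]
    unfolding distrib_left right_diff_distrib sum.distrib sum_subtractf
    unfolding det_char_def[symmetric] * by simp
  then show ?thesis using kostka_orthonormal[OF assms(1-3)] by simp
qed

lemma perm_char_negative: "a \<in> A \<Longrightarrow> c a < 0 \<Longrightarrow> perm_char n A c g = 0"
proof -
  assume "a \<in> A" "c a < 0"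
  then have "words n A c = {}" unfolding words_def by (smt (verit) Collect_empty_eq of_nat_0_le_iff)
  then show ?thesis by (simp add: perm_char_def)
qed

lemma perm_char_two_letters: "perm_char n {0, 1, 2} (vec3 a b 0) g = perm_char n {0, 1} (vec3 a b 0) g"
proof -
  have "w \<in> words n {0, 1, 2} (vec3 a b 0) \<longleftrightarrow> w \<in> words n {0, 1} (vec3 a b 0)" for w :: "nat \<Rightarrow> nat"
  proof
    assume w: "w \<in> words n {0, 1, 2} (vec3 a b 0)"
    then have "w i \<noteq> 2" if "i \<in> {1..n}" for i
      using that by (auto simp: words_def vec3_def)
    then show "w \<in> words n {0, 1} (vec3 a b 0)" using w by (auto simp: words_def PiE_iff)
  next
    assume w: "w \<in> words n {0, 1} (vec3 a b 0)"
    then have "{i\<in>{1..n}. w i = 2} = {}" by (auto simp: words_def PiE_iff) (metis One_nat_def atLeastAtMost_iff numeral_2_eq_2 n_not_Suc_n zero_neq_numeral)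
    then have "card {i\<in>{1..n}. w i = 2} = 0" by (simp only: card.empty)
    then show "w \<in> words n {0, 1, 2} (vec3 a b 0)" using w by (auto simp: words_def PiE_iff vec3_def)
  qed
  then show ?thesis by (simp add: perm_char_def)
qed

lemma det_char_two_rows:
  "det_char n a b 0 g = perm_char n {0, 1} (vec3 a b 0) g - perm_char n {0, 1} (vec3 (a + 1) (b - 1) 0) g"
proof -
  have "perm_char n {0, 1, 2} (vec3 p q s) g = 0" if "s < 0" for p q s
    by (rule perm_char_negative[of 2]) (use that in \<open>simp_all add: vec3_def\<close>)
  then show ?thesis by (simp add: det_char_def perm_char_two_letters del: One_nat_def)
qed

text \<open>The margins and the upper right entry e determine the table. The entries are listed with
  the lower left one first, in the order of \<open>kostka_four\<close> that the telescoping in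
  \<open>rect_mult_eq\<close> relies on.\<close>

lemma sum_tables_two_by_two:
  fixes F :: "int list \<Rightarrow> int"
  assumes "p + q = r + s" "p \<ge> s" "r \<ge> p - 1"
  shows "(\<Sum>X\<in>tables {0, 1} {0, 1} (vec3 p q 0) (vec3 r s 0). F [X (1, 0), X (0, 0), X (0, 1), X (1, 1)])
    = (\<Sum>e\<in>{e\<in>{0..s}. 0 \<le> r - p + e}. F [r - p + e, p - e, e, s - e])"
proof (rule sum.reindex_bij_witness[of _ "\<lambda>e. \<lambda>ab\<in>{0, 1} \<times> {0, 1}.
      if ab = (1, 0) then r - p + e else if ab = (0, 0) then p - e else if ab = (0, 1) then e else s - e"
      "\<lambda>X. X (0, 1)"])
  fix X assume X: "X \<in> tables {0, 1} {0, 1} (vec3 p q 0) (vec3 r s 0)"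
  have eq: "X (0, 0) + X (0, 1) = p" "X (1, 0) + X (1, 1) = q" "X (0, 0) + X (1, 0) = r" "X (0, 1) + X (1, 1) = s"
    using X by (auto simp: tables_def vec3_def)
  have nn: "X ab \<ge> 0" if "ab \<in> {0, 1} \<times> {0, 1}" for ab
    using X that unfolding tables_def by blast
  then have nn': "X (0, 0) \<ge> 0" "X (0, 1) \<ge> 0" "X (1, 0) \<ge> 0" "X (1, 1) \<ge> 0" by auto
  show "X (0, 1) \<in> {e\<in>{0..s}. 0 \<le> r - p + e}" using eq nn' by auto
  have "X (1, 0) = r - p + X (0, 1)" "X (0, 0) = p - X (0, 1)" "X (1, 1) = s - X (0, 1)" using eq by auto
  then show "F [r - p + X (0, 1), p - X (0, 1), X (0, 1), s - X (0, 1)] = F [X (1, 0), X (0, 0), X (0, 1), X (1, 1)]"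
    by simp
  have "X \<in> extensional ({0, 1} \<times> {0, 1})" using X by (auto simp: tables_def PiE_iff)
  then show "(\<lambda>ab\<in>{0, 1} \<times> {0, 1}. if ab = (1, 0) then r - p + X (0, 1) else if ab = (0, 0) then p - X (0, 1)
      else if ab = (0, 1) then X (0, 1) else s - X (0, 1)) = X"
    using eq by (auto simp: fun_eq_iff extensional_def)
next
  fix e assume e: "e \<in> {e\<in>{0..s}. 0 \<le> r - p + e}"
  let ?X = "\<lambda>ab\<in>({0, 1} :: nat set) \<times> ({0, 1} :: nat set). if ab = (1, 0) then r - p + e else if ab = (0, 0) then p - e
      else if ab = (0, 1) then e else s - e"
  show "?X (0, 1) = e" by simp
  have "?X ab \<in> {0..}" if "ab \<in> {0, 1} \<times> {0, 1}" for ab :: "nat \<times> nat"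
    using that e assms by auto
  then have "?X \<in> {0, 1} \<times> {0, 1} \<rightarrow>\<^sub>E {0..}" by (intro restrict_PiE_iff[THEN iffD2]) auto
  moreover have "(\<Sum>b\<in>{0, 1}. ?X (a, b)) = vec3 p q 0 a" if "a \<in> {0, 1}" for a :: nat
    using that assms(1) by (auto simp: vec3_def)
  moreover have "(\<Sum>a\<in>{0, 1}. ?X (a, b)) = vec3 r s 0 b" if "b \<in> {0, 1}" for b :: nat
    using that assms(1) by (auto simp: vec3_def)
  ultimately show "?X \<in> tables {0, 1} {0, 1} (vec3 p q 0) (vec3 r s 0)"
    unfolding tables_def by blast
qed

lemma sum_det_char_perm_char_perm_char:
  assumes "a + b + c = int n" "p + q = r + s" "p \<ge> s" "r \<ge> p - 1"
  shows "(\<Sum>g\<in>symgrp n. det_char n a b c g * (perm_char n {0, 1} (vec3 p q 0) g * perm_char n {0, 1} (vec3 r s 0) g))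
    = fact n * (\<Sum>e\<in>{e\<in>{0..s}. 0 \<le> r - p + e}. kostka [r - p + e, p - e, e, s - e] a b c)"
proof -
  let ?B = "{0, 1} :: nat set"
  let ?T = "tables ?B ?B (vec3 p q 0) (vec3 r s 0)"
  have BB: "?B \<times> ?B = set [(1, 0), (0, 0), (0, 1), (1, 1)]" by auto
  have "(\<Sum>g\<in>symgrp n. det_char n a b c g * (perm_char n ?B (vec3 p q 0) g * perm_char n ?B (vec3 r s 0) g))
      = (\<Sum>g\<in>symgrp n. \<Sum>X\<in>?T. det_char n a b c g * perm_char n (?B \<times> ?B) X g)"
    by (rule sum.cong[OF refl], subst perm_char_mult) (simp_all add: sum_distrib_left)
  also have "\<dots> = (\<Sum>X\<in>?T. \<Sum>g\<in>symgrp n. det_char n a b c g * perm_char n (?B \<times> ?B) X g)" by (rule sum.swap)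
  also have "\<dots> = (\<Sum>X\<in>?T. fact n * kostka [X (1, 0), X (0, 0), X (0, 1), X (1, 1)] a b c)"
    unfolding BB by (rule sum.cong[OF refl], subst sum_det_char_perm_char) (use assms in auto)
  also have "\<dots> = fact n * (\<Sum>X\<in>?T. kostka [X (1, 0), X (0, 0), X (0, 1), X (1, 1)] a b c)"
    by (simp add: sum_distrib_left)
  also have "(\<Sum>X\<in>?T. kostka [X (1, 0), X (0, 0), X (0, 1), X (1, 1)] a b c)
      = (\<Sum>e\<in>{e\<in>{0..s}. 0 \<le> r - p + e}. kostka [r - p + e, p - e, e, s - e] a b c)"
    using sum_tables_two_by_two[where F = "\<lambda>l. kostka l a b c"] assms by simp
  finally show ?thesis .
qed

lemma sum_det_char_two_row:
  assumes "a + b + c = int n" "int n = 2 * m" "1 \<le> k" "k \<le> m"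
  shows "(\<Sum>g\<in>symgrp n. det_char n a b c g * (det_char n m m 0 g * perm_char n {0, 1} (vec3 (m + k) (m - k) 0) g))
    = fact n * rect_mult a b c m k"
proof -
  \<comment> \<open>For row sums (m + 1, m - 1) the lower left entry is k - 1 + e; by 1 \<le> k it
    is nonnegative for all e, so both sums run over the same range.\<close>
  have s: "{e\<in>{0..m - k}. 0 \<le> (m + k) - m + e} = {0..m - k}" "{e\<in>{0..m - k}. 0 \<le> (m + k) - (m + 1) + e} = {0..m - k}"
    using assms by auto
  show ?thesis
    unfolding det_char_two_rows left_diff_distrib right_diff_distrib sum_subtractf
    using sum_det_char_perm_char_perm_char[of a b c n m m "m + k" "m - k"]
      sum_det_char_perm_char_perm_char[of a b c n "m + 1" "m - 1" "m + k" "m - k"] assms s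
    by (simp add: rect_mult_def sum_subtractf algebra_simps)
qed

theorem sum_det_char_triple:
  assumes "a + b + c = int n" "int n = 2 * m" "1 \<le> k" "k < m"
  shows "(\<Sum>g\<in>symgrp n. det_char n a b c g * (det_char n m m 0 g * det_char n (m + k) (m - k) 0 g))
    = fact n * (rect_mult a b c m k - rect_mult a b c m (k + 1))"
  unfolding det_char_two_rows[of n "m + k"]
  unfolding left_diff_distrib right_diff_distrib sum_subtractf
  using sum_det_char_two_row[OF assms(1,2), of k] sum_det_char_two_row[OF assms(1,2), of "k + 1"] assms
  by (simp add: algebra_simps)

section \<open>Representations of the symmetric group\<close>

lemma sum_symgrp_comp_left: "p \<in> symgrp n \<Longrightarrow> (\<Sum>q\<in>symgrp n. f (p \<circ> q)) = (\<Sum>q\<in>symgrp n. f q)"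
  by (rule sum.reindex_bij_witness[of _ "\<lambda>q. inv p \<circ> q" "\<lambda>q. p \<circ> q"])
    (simp_all add: symgrp_group symgrp_inverse)

lemma sum_symgrp_comp_right: "p \<in> symgrp n \<Longrightarrow> (\<Sum>q\<in>symgrp n. f (q \<circ> p)) = (\<Sum>q\<in>symgrp n. f q)"
  by (rule sum.reindex_bij_witness[of _ "\<lambda>q. q \<circ> inv p" "\<lambda>q. q \<circ> p"])
    (simp_all add: symgrp_group symgrp_inverse)

lemma sum_symgrp_inv: "(\<Sum>q\<in>symgrp n. f (inv q)) = (\<Sum>q\<in>symgrp n. f q)"
  by (rule sum.reindex_bij_witness[of _ inv inv]) (simp_all add: symgrp_group symgrp_inverse)

lemma symgrp_comp_iff: "q \<in> symgrp n \<Longrightarrow> q \<circ> h \<in> symgrp n \<longleftrightarrow> h \<in> symgrp n"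
  by (metis symgrp_group(2,3) symgrp_inverse(6))

definition delta :: "'x \<Rightarrow> 'x \<Rightarrow> complex" where
  "delta p = (\<lambda>h. of_bool (h = p))"

lemma grpalg_mult_assoc:
  "grpalg_mult n (grpalg_mult n x y) z = grpalg_mult n x (grpalg_mult n y z)"
proof
  fix h
  have "grpalg_mult n (grpalg_mult n x y) z h
      = (\<Sum>p\<in>symgrp n. \<Sum>q\<in>symgrp n. x q * (y (inv q \<circ> p) * z (inv p \<circ> h)))"
    by (simp add: grpalg_mult_def sum_distrib_right mult.assoc)
  also have "\<dots> = (\<Sum>q\<in>symgrp n. \<Sum>p\<in>symgrp n. x q * (y (inv q \<circ> p) * z (inv p \<circ> h)))"
    by (rule sum.swap)
  also have "\<dots> = (\<Sum>q\<in>symgrp n. \<Sum>p\<in>symgrp n. x q * (y p * z (inv p \<circ> (inv q \<circ> h))))"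
  proof (rule sum.cong[OF refl])
    fix q assume q: "q \<in> symgrp n"
    have "(\<Sum>p\<in>symgrp n. x q * (y (inv q \<circ> p) * z (inv p \<circ> h)))
        = (\<Sum>p\<in>symgrp n. x q * (y (inv q \<circ> (q \<circ> p)) * z (inv (q \<circ> p) \<circ> h)))"
      by (rule sum_symgrp_comp_left[OF q, symmetric])
    also have "\<dots> = (\<Sum>p\<in>symgrp n. x q * (y p * z (inv p \<circ> (inv q \<circ> h))))"
      by (rule sum.cong[OF refl]) (simp add: symgrp_inverse(6)[OF q] symgrp_inv_comp[OF q] comp_assoc)
    finally show "(\<Sum>p\<in>symgrp n. x q * (y (inv q \<circ> p) * z (inv p \<circ> h)))
        = (\<Sum>p\<in>symgrp n. x q * (y p * z (inv p \<circ> (inv q \<circ> h))))" .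
  qed
  also have "\<dots> = grpalg_mult n x (grpalg_mult n y z) h"
    by (simp add: grpalg_mult_def sum_distrib_left)
  finally show "grpalg_mult n (grpalg_mult n x y) z h = grpalg_mult n x (grpalg_mult n y z) h" .
qed

lemma grpalg_mult_left:
  "grpalg_mult n (x + x') y = grpalg_mult n x y + grpalg_mult n x' y"
  "grpalg_mult n (cscale c x) y = cscale c (grpalg_mult n x y)"
  "grpalg_mult n 0 y = 0"
  by (simp_all add: grpalg_mult_def cscale_def fun_eq_iff algebra_simps sum.distrib sum_distrib_left)

lemma grpalg_mult_right:
  "grpalg_mult n y (x + x') = grpalg_mult n y x + grpalg_mult n y x'"
  "grpalg_mult n y (cscale c x) = cscale c (grpalg_mult n y x)"
  "grpalg_mult n y 0 = 0"
  by (simp_all add: grpalg_mult_def cscale_def fun_eq_iff algebra_simps sum.distrib sum_distrib_left)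

lemma grpalg_mult_delta_left: "p \<in> symgrp n \<Longrightarrow> grpalg_mult n (delta p) x = left_act p x"
proof
  fix h
  assume p: "p \<in> symgrp n"
  have "grpalg_mult n (delta p) x h = (\<Sum>q\<in>symgrp n. if q = p then x (inv q \<circ> h) else 0)"
    unfolding grpalg_mult_def delta_def by (rule sum.cong) auto
  then show "grpalg_mult n (delta p) x h = left_act p x h"
    using p by (simp add: finite_symgrp left_act_def)
qed

lemma grpalg_mult_one_right:
  assumes "x \<in> grpalg n"
  shows "grpalg_mult n x (delta id) = x"
proof
  fix h
  have "grpalg_mult n x (delta id) h = (\<Sum>q\<in>symgrp n. if q = h then x q else 0)"
    unfolding grpalg_mult_def delta_def
  proof (rule sum.cong[OF refl])
    fix q assume q: "q \<in> symgrp n"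
    have "inv q \<circ> h = id \<longleftrightarrow> q = h"
      using symgrp_inverse(1,7)[OF q] by (metis comp_id)
    then show "x q * of_bool (inv q \<circ> h = id) = (if q = h then x q else 0)" by simp
  qed
  also have "\<dots> = x h" using assms by (auto simp: finite_symgrp grpalg_def)
  finally show "grpalg_mult n x (delta id) h = x h" .
qed

lemma grpalg_mult_in_grpalg:
  assumes "y \<in> grpalg n"
  shows "grpalg_mult n x y \<in> grpalg n"
  unfolding grpalg_def mem_Collect_eq grpalg_mult_def
proof (intro allI impI sum.neutral ballI)
  fix p q assume "p \<notin> symgrp n" "q \<in> symgrp n"
  then have "inv q \<circ> p \<notin> symgrp n" by (simp add: symgrp_comp_iff symgrp_group)
  then show "x q * y (inv q \<circ> p) = 0" using assms by (simp add: grpalg_def)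
qed

section \<open>Functions supported on a finite set and traces\<close>

definition supported :: "'x set \<Rightarrow> ('x \<Rightarrow> complex) set" where
  "supported X = {F. \<forall>x. x \<notin> X \<longrightarrow> F x = 0}"

lemma grpalg_eq_supported: "grpalg n = supported (symgrp n)"
  by (simp add: grpalg_def supported_def)

lemma subspace_supported: "cfun.subspace (supported X)"
  by (rule cfun.subspaceI) (auto simp: supported_def cscale_def)

lemma delta_supported: "x \<in> X \<Longrightarrow> delta x \<in> supported X"
  by (auto simp: delta_def supported_def)

lemma sum_fun_apply: "(\<Sum>i\<in>I. f i) x = (\<Sum>i\<in>I. f i x)"
  by (induction I rule: infinite_finite_induct) auto

lemma supported_expand:
  assumes "finite X" "F \<in> supported X"
  shows "F = (\<Sum>x\<in>X. cscale (F x) (delta x))"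
proof
  fix y
  have "(\<Sum>x\<in>X. cscale (F x) (delta x)) y = (\<Sum>x\<in>X. if x = y then F x else 0)"
    unfolding sum_fun_apply by (rule sum.cong) (auto simp: cscale_def delta_def)
  then show "F y = (\<Sum>x\<in>X. cscale (F x) (delta x)) y"
    using assms by (auto simp: supported_def)
qed

text \<open>The space of all functions may be infinite-dimensional; finiteness of bases comes from
  the finitely many point functions that span the functions supported on X.\<close>

lemma finite_independent_supported:
  assumes "finite X" "B \<subseteq> supported X" "cfun.independent B"
  shows "finite B"
proof -
  have "supported X \<subseteq> cfun.span (delta ` X)"
  proof
    fix F assume "F \<in> supported X"
    from supported_expand[OF assms(1) this] show "F \<in> cfun.span (delta ` X)"
      by (metis (no_types, lifting) cfun.span_base cfun.span_scale cfun.span_sum image_eqI)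
  qed
  then show ?thesis
    using cfun.independent_span_bound[of "delta ` X" B] assms by auto
qed

lemma linear_cscaleI:
  assumes "\<And>u v. f (u + v) = f u + f v" "\<And>c v. f (cscale c v) = cscale c (f v)"
  shows "Vector_Spaces.linear cscale cscale f"
  unfolding Vector_Spaces.linear_iff by (auto intro: cfun.vector_space_axioms simp: assms)

text \<open>
  With respect to a basis of its image, an operator with \<open>P \<circ> P = k P\<close> has diagonal
  coefficients \<open>k\<close>.
\<close>

lemma trace_quasi_idempotent:
  fixes P :: "('x \<Rightarrow> complex) \<Rightarrow> 'x \<Rightarrow> complex"
  assumes fin: "finite X" and lin: "Vector_Spaces.linear cscale cscale P"
    and maps: "\<And>v. v \<in> supported X \<Longrightarrow> P v \<in> supported X"
    and idem: "\<And>v. v \<in> supported X \<Longrightarrow> P (P v) = cscale k (P v)"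
  shows "(\<Sum>x\<in>X. P (delta x) x) = k * of_nat (cfun.dim (P ` supported X))"
proof -
  interpret P: Vector_Spaces.linear cscale cscale P by (rule lin)
  obtain B where B: "B \<subseteq> P ` supported X" "cfun.independent B" "P ` supported X \<subseteq> cfun.span B"
      "card B = cfun.dim (P ` supported X)"
    using cfun.basis_exists by blast
  have BX: "B \<subseteq> supported X" using B(1) maps by auto
  have finB: "finite B" by (rule finite_independent_supported[OF fin BX B(2)])
  let ?r = "cfun.representation B"
  have expand: "P v = (\<Sum>b\<in>B. cscale (?r (P v) b) b)" if "v \<in> supported X" for v
    using cfun.sum_representation_eq[OF B(2) _ finB subset_refl, of "P v"] B(3) that by auto
  have Pb: "P b = cscale k b" if b: "b \<in> B" for b
    using B(1) idem b by auto
  have spanP: "P (delta x) \<in> cfun.span B" if "x \<in> X" for x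
    using B(3) delta_supported[OF that] by blast
  \<comment> \<open>Expanding the basis vector b in point functions is what allows the diagonal
    entries with respect to point functions to be exchanged for diagonal coefficients with respect
    to B.\<close>
  have rep_sum: "?r (P b) c = (\<Sum>x\<in>X. b x * ?r (P (delta x)) c)" if b: "b \<in> B" for b c
  proof -
    have "P b = P (\<Sum>x\<in>X. cscale (b x) (delta x))"
      using supported_expand[OF fin, of b] BX b by auto
    also have "\<dots> = (\<Sum>x\<in>X. cscale (b x) (P (delta x)))" by (simp add: P.sum P.scale)
    finally have "?r (P b) c = ?r (\<Sum>x\<in>X. cscale (b x) (P (delta x))) c" by simp
    also have "\<dots> = (\<Sum>x\<in>X. ?r (cscale (b x) (P (delta x))) c)"
      using spanP by (subst cfun.representation_sum[OF B(2)]) (auto intro!: cfun.span_scale)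
    also have "\<dots> = (\<Sum>x\<in>X. b x * ?r (P (delta x)) c)"
      using spanP by (intro sum.cong refl, subst cfun.representation_scale[OF B(2)]) auto
    finally show ?thesis .
  qed
  have "(\<Sum>x\<in>X. P (delta x) x) = (\<Sum>x\<in>X. \<Sum>b\<in>B. ?r (P (delta x)) b * b x)"
  proof (rule sum.cong[OF refl])
    fix x assume "x \<in> X"
    from arg_cong[OF expand[OF delta_supported[OF this]], of "\<lambda>F. F x"]
    show "P (delta x) x = (\<Sum>b\<in>B. ?r (P (delta x)) b * b x)"
      by (simp add: sum_fun_apply cscale_def)
  qed
  also have "\<dots> = (\<Sum>b\<in>B. \<Sum>x\<in>X. b x * ?r (P (delta x)) b)"
    by (subst sum.swap) (simp add: mult.commute)
  also have "\<dots> = (\<Sum>b\<in>B. ?r (P b) b)"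
    by (rule sum.cong[OF refl]) (simp add: rep_sum)
  also have "\<dots> = (\<Sum>b\<in>B. k)"
    by (rule sum.cong[OF refl])
      (simp add: Pb cfun.representation_scale[OF B(2) cfun.span_base] cfun.representation_basis[OF B(2)])
  finally show ?thesis using B(4) by (simp add: mult.commute)
qed

section \<open>Modules over the group algebra\<close>

locale symrep =
  fixes n :: nat and \<rho> :: "perm \<Rightarrow> ('x \<Rightarrow> complex) \<Rightarrow> 'x \<Rightarrow> complex"
  assumes rep_add: "g \<in> symgrp n \<Longrightarrow> \<rho> g (u + v) = \<rho> g u + \<rho> g v"
    and rep_scale: "g \<in> symgrp n \<Longrightarrow> \<rho> g (cscale c u) = cscale c (\<rho> g u)"
    and rep_id: "\<rho> id u = u"
    and rep_comp: "g \<in> symgrp n \<Longrightarrow> h \<in> symgrp n \<Longrightarrow> \<rho> (g \<circ> h) u = \<rho> g (\<rho> h u)"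
begin

definition act :: "(perm \<Rightarrow> complex) \<Rightarrow> ('x \<Rightarrow> complex) \<Rightarrow> 'x \<Rightarrow> complex" where
  "act x F = (\<Sum>q\<in>symgrp n. cscale (x q) (\<rho> q F))"

lemma rep_linear: "g \<in> symgrp n \<Longrightarrow> Vector_Spaces.linear cscale cscale (\<rho> g)"
  by (rule linear_cscaleI) (simp_all add: rep_add rep_scale)

lemma rep_sum: "g \<in> symgrp n \<Longrightarrow> \<rho> g (\<Sum>i\<in>I. f i) = (\<Sum>i\<in>I. \<rho> g (f i))"
proof -
  assume "g \<in> symgrp n"
  then interpret g: Vector_Spaces.linear cscale cscale "\<rho> g" by (rule rep_linear)
  show ?thesis by (rule g.sum)
qed

lemma act_linear: "Vector_Spaces.linear cscale cscale (act x)"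
  by (rule linear_cscaleI)
    (simp_all add: act_def rep_add rep_scale cfun.scale_right_distrib sum.distrib cfun.scale_sum_right mult.commute)

lemma act_left:
  "act (x + y) F = act x F + act y F" "act (cscale c x) F = cscale c (act x F)" "act 0 F = 0"
  by (simp_all add: act_def cfun.scale_left_distrib sum.distrib cfun.scale_sum_right cscale_def[of _ x])

lemma act_left_act:
  assumes p: "p \<in> symgrp n"
  shows "act (left_act p x) F = \<rho> p (act x F)"
proof -
  have "act (left_act p x) F = (\<Sum>q\<in>symgrp n. cscale (left_act p x (p \<circ> q)) (\<rho> (p \<circ> q) F))"
    unfolding act_def by (rule sum_symgrp_comp_left[OF p, symmetric])
  also have "\<dots> = \<rho> p (act x F)"
    unfolding act_def rep_sum[OF p]
    by (rule sum.cong[OF refl]) (simp add: left_act_def symgrp_inverse(6)[OF p] rep_comp rep_scale p)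
  finally show ?thesis .
qed

lemma act_mult: "act (grpalg_mult n x y) F = act x (act y F)"
proof -
  have 1: "grpalg_mult n x y = (\<Sum>q\<in>symgrp n. cscale (x q) (left_act q y))"
    by (simp add: fun_eq_iff grpalg_mult_def sum_fun_apply cscale_def left_act_def)
  have "act (\<Sum>q\<in>I. f q) F = (\<Sum>q\<in>I. act (f q) F)" for I and f :: "perm \<Rightarrow> perm \<Rightarrow> complex"
    by (induction I rule: infinite_finite_induct) (simp_all only: sum.infinite sum.empty sum.insert act_left if_False not_False_eq_True)
  then have "act (grpalg_mult n x y) F = (\<Sum>q\<in>symgrp n. act (cscale (x q) (left_act q y)) F)"
    unfolding 1 .
  also have "\<dots> = (\<Sum>q\<in>symgrp n. cscale (x q) (\<rho> q (act y F)))"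
    by (rule sum.cong[OF refl]) (simp add: act_left act_left_act)
  finally show ?thesis by (simp only: act_def[of x])
qed

lemma act_in_submodule:
  assumes "submodule (symgrp n) \<rho> W" "F \<in> W"
  shows "act x F \<in> W"
  unfolding act_def using assms by (auto simp: submodule_def intro!: cfun.subspace_sum cfun.subspace_scale)

end

lemma symrep_left_act: "symrep n left_act"
  by standard (auto simp: left_act_def fun_eq_iff cscale_def symgrp_inv_comp[of _ n] comp_assoc)

lemma symrep_diag_act: "symrep n diag_act"
  by standard (auto simp: diag_act_def fun_eq_iff cscale_def symgrp_inv_comp[of _ n] comp_assoc)

lemma act_left_act_eq: "symrep.act n left_act x y = grpalg_mult n x y"
  by (simp add: symrep.act_def[OF symrep_left_act] fun_eq_iff grpalg_mult_def sum_fun_apply cscale_def left_act_def)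

lemma submodule_mult:
  assumes V: "submodule (symgrp n) left_act V" and y: "y \<in> V"
  shows "grpalg_mult n x y \<in> V"
  using symrep.act_in_submodule[OF symrep_left_act V y, of x] by (simp add: act_left_act_eq)

text \<open>
  For \<open>x\<close> in such a left ideal, \<open>y = x\<^sup>* x\<close> is self-adjoint with square zero, hence zero.
\<close>

lemma left_ideal_square_zero:
  assumes V: "submodule (symgrp n) left_act V" "V \<subseteq> grpalg n"
    and nil: "\<And>u v. u \<in> V \<Longrightarrow> v \<in> V \<Longrightarrow> grpalg_mult n u v = 0"
  shows "V \<subseteq> {0}"
proof
  fix x assume x: "x \<in> V"
  define y where "y = grpalg_mult n (\<lambda>g. cnj (x (inv g))) x"
  have y_alt: "y h = (\<Sum>q\<in>symgrp n. cnj (x q) * x (q \<circ> h))" for h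
  proof -
    have "y h = (\<Sum>q\<in>symgrp n. cnj (x (inv (inv q))) * x (inv (inv q) \<circ> h))"
      unfolding y_def grpalg_mult_def by (rule sum_symgrp_inv[symmetric])
    then show ?thesis by (simp add: symgrp_inverse cong: sum.cong)
  qed
  have y_inv: "y (inv h) = cnj (y h)" if h: "h \<in> symgrp n" for h
  proof -
    have "y (inv h) = (\<Sum>q\<in>symgrp n. cnj (x (q \<circ> h)) * x (q \<circ> h \<circ> inv h))"
      unfolding y_alt by (rule sum_symgrp_comp_right[OF h, symmetric])
    then show ?thesis by (simp add: y_alt symgrp_inverse(9)[OF h] mult.commute)
  qed
  have zero: "z q = 0" if "(\<Sum>q\<in>symgrp n. cnj (z q) * z q) = 0" "q \<in> symgrp n" for z :: "perm \<Rightarrow> complex" and q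
  proof -
    have "(\<Sum>q\<in>symgrp n. cnj (z q) * z q) = complex_of_real (\<Sum>q\<in>symgrp n. (cmod (z q))\<^sup>2)"
      unfolding of_real_sum by (intro sum.cong refl) (simp only: complex_norm_square mult.commute)
    then have "(\<Sum>q\<in>symgrp n. (cmod (z q))\<^sup>2) = 0" using that(1) by (metis of_real_eq_0_iff)
    then show ?thesis using that(2) finite_symgrp by (subst (asm) sum_nonneg_eq_0_iff) auto
  qed
  have "y \<in> V" unfolding y_def by (rule submodule_mult[OF V(1) x])
  then have "grpalg_mult n y y id = 0" using nil by simp
  \<comment> \<open>Since y is self-adjoint, the value of its square at the identity is the squared
    norm of y; likewise the value of y at the identity is the squared norm of x.\<close>
  then have "(\<Sum>q\<in>symgrp n. cnj (y q) * y q) = 0"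
    by (simp add: grpalg_mult_def y_inv mult.commute)
  then have "y id = 0" using zero symgrp_group(1) by blast
  then have "(\<Sum>q\<in>symgrp n. cnj (x q) * x q) = 0" by (simp add: y_alt)
  then have "x q = 0" if "q \<in> symgrp n" for q using zero that by blast
  then show "x \<in> {0}" using x V(2) by (auto simp: grpalg_def fun_eq_iff)
qed

section \<open>Primitive idempotents and their left ideals\<close>

definition left_ideal :: "nat \<Rightarrow> (perm \<Rightarrow> complex) \<Rightarrow> (perm \<Rightarrow> complex) set" where
  "left_ideal n e = {grpalg_mult n x e | x. x \<in> grpalg n}"

locale primitive_idempotent =
  fixes n :: nat and e :: "perm \<Rightarrow> complex"
  assumes e_in: "e \<in> grpalg n" and e_nonzero: "e \<noteq> 0" and e_idem: "grpalg_mult n e e = e"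
    and e_primitive: "x \<in> grpalg n \<Longrightarrow> \<exists>t. grpalg_mult n (grpalg_mult n e x) e = cscale t e"
begin

lemma left_ideal_iff: "y \<in> left_ideal n e \<longleftrightarrow> y \<in> grpalg n \<and> grpalg_mult n y e = y"
proof
  assume "y \<in> left_ideal n e"
  then obtain x where "y = grpalg_mult n x e" by (auto simp: left_ideal_def)
  then show "y \<in> grpalg n \<and> grpalg_mult n y e = y"
    by (simp add: grpalg_mult_assoc e_idem grpalg_mult_in_grpalg e_in)
next
  assume y: "y \<in> grpalg n \<and> grpalg_mult n y e = y"
  then have "y = grpalg_mult n y e" by simp
  then show "y \<in> left_ideal n e" using y unfolding left_ideal_def by blast
qed

lemma submodule_left_ideal: "submodule (symgrp n) left_act (left_ideal n e)"
  unfolding submodule_def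
proof (intro conjI ballI)
  show "cfun.subspace (left_ideal n e)"
    by (rule cfun.subspaceI)
      (simp_all add: left_ideal_iff grpalg_mult_left grpalg_eq_supported subspace_supported
        cfun.subspace_0 cfun.subspace_add cfun.subspace_scale)
  show "left_act g y \<in> left_ideal n e" if "g \<in> symgrp n" "y \<in> left_ideal n e" for g y
    using that by (simp add: left_ideal_iff left_act_grpalg left_act_grpalg_mult[symmetric])
qed

text \<open>For a submodule V there are two cases. If eV = 0, then VV = (Ve)V = 0 and V vanishes by
  \<open>left_ideal_square_zero\<close>. Otherwise some ev = eve is a nonzero multiple of e, so V
  contains e and hence the whole ideal.\<close>

lemma irreducible_left_ideal: "irreducible_rep (symgrp n) left_act (left_ideal n e)"
  unfolding irreducible_rep_def
proof (intro conjI allI impI)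
  show "submodule (symgrp n) left_act (left_ideal n e)" by (rule submodule_left_ideal)
  have e: "e \<in> left_ideal n e" by (simp add: left_ideal_iff e_in e_idem)
  then show "left_ideal n e \<noteq> {0}" using e_nonzero by auto
  fix V assume V: "submodule (symgrp n) left_act V \<and> V \<subseteq> left_ideal n e"
  have V0: "0 \<in> V" using V by (auto simp: submodule_def cfun.subspace_0)
  have Vg: "V \<subseteq> grpalg n" using V by (auto simp: left_ideal_iff)
  show "V = {0} \<or> V = left_ideal n e"
  proof (cases "\<forall>v\<in>V. grpalg_mult n e v = 0")
    case True
    have "grpalg_mult n u v = 0" if "u \<in> V" "v \<in> V" for u v
    proof -
      have "grpalg_mult n u v = grpalg_mult n (grpalg_mult n u e) v"
        using V that(1) by (auto simp: left_ideal_iff)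
      then show ?thesis using True that(2) by (simp add: grpalg_mult_assoc grpalg_mult_right)
    qed
    then have "V \<subseteq> {0}" using left_ideal_square_zero V Vg by blast
    then show ?thesis using V0 by auto
  next
    case False
    then obtain v where v: "v \<in> V" "grpalg_mult n e v \<noteq> 0" by auto
    have ev: "grpalg_mult n e v \<in> V" using V v(1) by (auto intro: submodule_mult)
    have "v = grpalg_mult n v e" using V v(1) by (auto simp: left_ideal_iff)
    then obtain t where t: "grpalg_mult n e v = cscale t e"
      using e_primitive[of v] Vg v(1) by (metis grpalg_mult_assoc subsetD)
    then have "t \<noteq> 0" using v(2) by auto
    then have "e = cscale (1 / t) (grpalg_mult n e v)" by (simp add: t)
    then have "e \<in> V" using ev V by (metis submodule_def cfun.subspace_scale)
    then have "left_ideal n e \<subseteq> V"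
      using V submodule_mult by (auto simp: left_ideal_def)
    then show ?thesis using V by auto
  qed
qed

end

locale symrep_idempotent = symrep n \<rho> + primitive_idempotent n e
  for n :: nat and \<rho> :: "perm \<Rightarrow> ('x \<Rightarrow> complex) \<Rightarrow> 'x \<Rightarrow> complex" and e
begin

text \<open>Schur's lemma for the homomorphism that sends x to x(eu): it is nonzero because it takes
  e to eeu = eu, so its kernel is zero and its image is all of U.\<close>

lemma isomorphic_if_act_nonzero:
  assumes U: "irreducible_rep (symgrp n) \<rho> U" and u: "u \<in> U" "act e u \<noteq> 0"
  shows "isomorphic_rep (symgrp n) left_act (left_ideal n e) \<rho> U"
proof -
  define T where "T x = act x (act e u)" for x
  have subU: "submodule (symgrp n) \<rho> U" using U by (simp add: irreducible_rep_def)
  have e: "e \<in> left_ideal n e" by (simp add: left_ideal_iff e_in e_idem)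
  have subV: "cfun.subspace (left_ideal n e)"
    using submodule_left_ideal by (simp add: submodule_def)
  have T_add: "T (x + y) = T x + T y" and T_scale: "T (cscale c x) = cscale c (T x)" and T_0: "T 0 = 0" for x y c
    by (simp_all add: T_def act_left)
  have T_act: "T (left_act g x) = \<rho> g (T x)" if "g \<in> symgrp n" for g x
    using that by (simp add: T_def act_left_act)
  have TU: "T x \<in> U" for x
    unfolding T_def using subU u(1) by (intro act_in_submodule)
  have Te: "T e \<noteq> 0" using u(2) by (simp add: T_def e_idem flip: act_mult)
  have "submodule (symgrp n) left_act {x \<in> left_ideal n e. T x = 0}"
    using submodule_left_ideal subV
    by (auto simp: submodule_def T_add T_scale T_0 T_act module_hom.zero[OF module_hom_linearI[OF rep_linear]]
        intro!: cfun.subspaceI dest: cfun.subspace_0 cfun.subspace_add cfun.subspace_scale)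
  moreover have "{x \<in> left_ideal n e. T x = 0} \<noteq> left_ideal n e" using Te e by auto
  ultimately have ker: "{x \<in> left_ideal n e. T x = 0} = {0}"
    using irreducible_left_ideal unfolding irreducible_rep_def by blast
  have inj: "inj_on T (left_ideal n e)"
  proof (rule inj_onI)
    fix x y assume xy: "x \<in> left_ideal n e" "y \<in> left_ideal n e" "T x = T y"
    have "T (x - y) = 0" using T_add[of "x - y" y] xy(3) by simp
    then have "x - y \<in> {x \<in> left_ideal n e. T x = 0}"
      using xy subV by (simp add: cfun.subspace_diff)
    then show "x = y" unfolding ker by simp
  qed
  have "Vector_Spaces.linear cscale cscale T" by (rule linear_cscaleI) (simp_all add: T_add T_scale)
  then have "cfun.subspace (T ` left_ideal n e)"
    using subV by (metis module_hom.subspace_image module_hom_linearI)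
  then have "submodule (symgrp n) \<rho> (T ` left_ideal n e)"
    using submodule_left_ideal by (auto simp: submodule_def T_act[symmetric])
  moreover have "T ` left_ideal n e \<subseteq> U" using TU by auto
  moreover have "T ` left_ideal n e \<noteq> {0}" using Te e by auto
  ultimately have "T ` left_ideal n e = U" using U unfolding irreducible_rep_def by blast
  then have "bij_betw T (left_ideal n e) U" using inj by (simp add: bij_betw_def)
  then show ?thesis unfolding isomorphic_rep_def using T_add T_scale T_act by auto
qed

text \<open>The vector b is the image of e under the isomorphism. For x in the left ideal, ex = exe
  is a multiple of e, so e maps U onto the line spanned by b.\<close>

lemma act_isomorphic:
  assumes iso: "isomorphic_rep (symgrp n) left_act (left_ideal n e) \<rho> U"
  obtains b where "b \<in> U" "b \<noteq> 0" "act e b = b" "\<And>u. u \<in> U \<Longrightarrow> \<exists>t. act e u = cscale t b"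
proof -
  have subV: "cfun.subspace (left_ideal n e)"
    using submodule_left_ideal by (simp add: submodule_def)
  obtain T where T: "bij_betw T (left_ideal n e) U"
    "\<And>u v. u \<in> left_ideal n e \<Longrightarrow> v \<in> left_ideal n e \<Longrightarrow> T (u + v) = T u + T v"
    "\<And>c v. v \<in> left_ideal n e \<Longrightarrow> T (cscale c v) = cscale c (T v)"
    "\<And>g v. g \<in> symgrp n \<Longrightarrow> v \<in> left_ideal n e \<Longrightarrow> T (left_act g v) = \<rho> g (T v)"
    using iso unfolding isomorphic_rep_def by blast
  have V0: "0 \<in> left_ideal n e" using subV by (rule cfun.subspace_0)
  have T0: "T 0 = 0" using T(2)[OF V0 V0] by simp
  have T_sum: "T (\<Sum>i\<in>I. f i) = (\<Sum>i\<in>I. T (f i))" if "\<And>i. i \<in> I \<Longrightarrow> f i \<in> left_ideal n e" for I :: "perm set" and f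
    using that
  proof (induction I rule: infinite_finite_induct)
    case (insert i I)
    have "T (\<Sum>i\<in>insert i I. f i) = T (f i + (\<Sum>i\<in>I. f i))" by (simp only: sum.insert[OF insert(1,2)])
    also have "\<dots> = T (f i) + T (\<Sum>i\<in>I. f i)"
      using insert.prems by (intro T(2) cfun.subspace_sum[OF subV]) auto
    also have "T (\<Sum>i\<in>I. f i) = (\<Sum>i\<in>I. T (f i))" using insert.prems by (intro insert.IH) auto
    also have "T (f i) + \<dots> = (\<Sum>i\<in>insert i I. T (f i))" by (simp only: sum.insert[OF insert(1,2)])
    finally show ?case .
  qed (simp_all only: sum.infinite sum.empty T0 not_False_eq_True)
  have T_mult: "T (grpalg_mult n x v) = act x (T v)" if v: "v \<in> left_ideal n e" for x v
  proof -
    have gv: "left_act q v \<in> left_ideal n e" if "q \<in> symgrp n" for q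
      using submodule_left_ideal v that by (simp add: submodule_def)
    have "grpalg_mult n x v = (\<Sum>q\<in>symgrp n. cscale (x q) (left_act q v))"
      by (simp add: fun_eq_iff grpalg_mult_def sum_fun_apply cscale_def left_act_def)
    then have "T (grpalg_mult n x v) = (\<Sum>q\<in>symgrp n. T (cscale (x q) (left_act q v)))"
      using gv subV by (simp only:) (intro T_sum, auto intro: cfun.subspace_scale)
    also have "\<dots> = act x (T v)"
      unfolding act_def by (rule sum.cong) (use gv v T(3,4) in auto)
    finally show ?thesis .
  qed
  have e: "e \<in> left_ideal n e" by (simp add: left_ideal_iff e_in e_idem)
  show thesis
  proof (rule that)
    show "T e \<in> U" using T(1) e by (auto simp: bij_betw_def)
    show "T e \<noteq> 0" using T(1) e V0 T0 e_nonzero by (metis bij_betw_def inj_on_eq_iff)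
    show "act e (T e) = T e" using T_mult[OF e, of e] by (simp add: e_idem)
    fix u assume "u \<in> U"
    then obtain x where x: "x \<in> left_ideal n e" "u = T x" using T(1) by (auto simp: bij_betw_def)
    obtain t where t: "grpalg_mult n (grpalg_mult n e x) e = cscale t e"
      using e_primitive x(1) by (auto simp: left_ideal_iff)
    have "grpalg_mult n e x = cscale t e"
      using t x(1) by (simp add: grpalg_mult_assoc left_ideal_iff)
    then have "act e u = cscale t (T e)" using T_mult[OF x(1), of e] T(3)[OF e] x(2) by simp
    then show "\<exists>t. act e u = cscale t (T e)" ..
  qed
qed

end

context symrep_idempotent begin

text \<open>By the two preceding lemmas, e maps each isomorphic summand onto a line and kills all
  others. The chosen vectors b span eW; they are independent because a linear relation, extended by
  0 to the remaining summands, is a vanishing sum in a direct sum.\<close>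

lemma card_isomorphic_summands:
  assumes W: "submodule (symgrp n) \<rho> W" and D: "direct_sum_decomposition \<U> W"
    and irr: "\<And>U. U \<in> \<U> \<Longrightarrow> irreducible_rep (symgrp n) \<rho> U"
  shows "card {U\<in>\<U>. isomorphic_rep (symgrp n) left_act (left_ideal n e) \<rho> U} = cfun.dim (act e ` W)"
proof -
  define I where "I = {U\<in>\<U>. isomorphic_rep (symgrp n) left_act (left_ideal n e) \<rho> U}"
  interpret A: Vector_Spaces.linear cscale cscale "act e" by (rule act_linear)
  note D' = D[unfolded direct_sum_decomposition_def]
  note finU = D'[THEN conjunct1] and subU = D'[THEN conjunct2, THEN conjunct1]
    and WU = D'[THEN conjunct2, THEN conjunct2, THEN conjunct1]
    and indep_all = D'[THEN conjunct2, THEN conjunct2, THEN conjunct2]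
  have fin: "finite \<U>" "finite I" using finU by (simp_all add: I_def)
  have sub: "cfun.subspace U" if "U \<in> \<U>" for U using subU that by (rule bspec)
  have indep: "\<forall>U\<in>\<U>. f U = 0" if "\<forall>U\<in>\<U>. f U \<in> U" "(\<Sum>U\<in>\<U>. f U) = 0" for f
    using indep_all[THEN spec, of f] that by (rule mp[OF _ conjI])
  have "\<exists>b. b \<in> U \<and> b \<noteq> 0 \<and> act e b = b \<and> (\<forall>u\<in>U. \<exists>t. act e u = cscale t b)" if "U \<in> I" for U
  proof -
    have iso: "isomorphic_rep (symgrp n) left_act (left_ideal n e) \<rho> U" using that by (simp add: I_def)
    show ?thesis
    proof (rule act_isomorphic[OF iso])
      fix b assume "b \<in> U" "b \<noteq> 0" "act e b = b" "\<And>u. u \<in> U \<Longrightarrow> \<exists>t. act e u = cscale t b"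
      then show ?thesis by (intro exI[of _ b] conjI ballI) simp_all
    qed
  qed
  then obtain b where b: "\<And>U. U \<in> I \<Longrightarrow> b U \<in> U" "\<And>U. U \<in> I \<Longrightarrow> b U \<noteq> 0"
      "\<And>U. U \<in> I \<Longrightarrow> act e (b U) = b U" "\<And>U u. U \<in> I \<Longrightarrow> u \<in> U \<Longrightarrow> \<exists>t. act e u = cscale t (b U)"
    by metis
  have lin_indep: "c U = 0" if c: "(\<Sum>U\<in>I. cscale (c U) (b U)) = 0" and U: "U \<in> I" for c U
  proof -
    define f where "f U = (if U \<in> I then cscale (c U) (b U) else 0)" for U
    have "(\<Sum>U\<in>\<U>. f U) = (\<Sum>U\<in>I. cscale (c U) (b U))"
      unfolding f_def using fin(1) by (intro sum.mono_neutral_cong_right) (auto simp: I_def)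
    then have sum0: "(\<Sum>U\<in>\<U>. f U) = 0" by (simp only: c)
    have mem: "\<forall>U\<in>\<U>. f U \<in> U"
      using b(1) sub by (auto simp: f_def cfun.subspace_0 intro: cfun.subspace_scale)
    have "f U = 0" using indep[OF mem sum0] U unfolding I_def by blast
    then show ?thesis using b(2)[OF U] U by (simp add: f_def)
  qed
  have inj: "inj_on b I"
  proof (rule inj_onI, rule ccontr)
    fix U U' assume U: "U \<in> I" "U' \<in> I" "b U = b U'" "U \<noteq> U'"
    define c where "c X = (if X = U then 1 else if X = U' then - 1 else 0 :: complex)" for X
    have "(\<Sum>X\<in>I. cscale (c X) (b X)) = (\<Sum>X\<in>{U, U'}. cscale (c X) (b X))"
      using fin U by (intro sum.mono_neutral_right) (auto simp: c_def)
    also have "\<dots> = 0" using U by (simp add: c_def cfun.scale_minus_left)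
    finally show False using lin_indep[of c U] U by (simp add: c_def)
  qed
  have ind: "cfun.independent (b ` I)"
    unfolding cfun.dependent_finite[OF finite_imageI[OF fin(2)]]
  proof safe
    fix c v U assume "(\<Sum>v\<in>b ` I. cscale (c v) v) = 0" "c (b U) \<noteq> 0" "U \<in> I"
    then show False using lin_indep[of "\<lambda>U. c (b U)" U] inj by (simp add: sum.reindex)
  qed
  have "cfun.span (b ` I) = act e ` W"
  proof (rule cfun.span_subspace)
    show "b ` I \<subseteq> act e ` W"
    proof
      fix v assume "v \<in> b ` I"
      then obtain U where U: "U \<in> I" "v = b U" by auto
      define f where "f X = (if X = U then b U else 0)" for X
      have "(\<Sum>X\<in>\<U>. f X) = b U" using fin(1) U(1) by (simp add: f_def I_def)
      moreover have "\<forall>X\<in>\<U>. f X \<in> X" using b(1)[OF U(1)] sub by (auto simp: f_def cfun.subspace_0)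
      ultimately have "b U \<in> W" unfolding WU mem_Collect_eq by (intro exI[of _ f]) simp
      then show "v \<in> act e ` W" using b(3)[OF U(1)] U(2) by (metis imageI)
    qed
    show "act e ` W \<subseteq> cfun.span (b ` I)"
    proof
      fix v assume "v \<in> act e ` W"
      then obtain f where f: "\<forall>U\<in>\<U>. f U \<in> U" "v = act e (\<Sum>U\<in>\<U>. f U)" unfolding WU by auto
      have "act e (f U) \<in> cfun.span (b ` I)" if U: "U \<in> \<U>" for U
      proof (cases "U \<in> I")
        case True
        then obtain t where "act e (f U) = cscale t (b U)" using b(4) f(1) U by blast
        then show ?thesis using True by (simp add: cfun.span_base cfun.span_scale)
      next
        case False
        then have "act e (f U) = 0"
          using isomorphic_if_act_nonzero[OF irr[OF U], of "f U"] f(1) U by (auto simp: I_def)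
        then show ?thesis by (simp add: cfun.span_zero)
      qed
      then show "v \<in> cfun.span (b ` I)" unfolding f(2) A.sum by (rule cfun.span_sum)
    qed
    show "cfun.subspace (act e ` W)"
      using W by (auto simp: submodule_def intro: A.subspace_image)
  qed
  then have "cfun.dim (act e ` W) = card (b ` I)"
    using ind by (metis cfun.dim_span_eq_card_independent)
  then show ?thesis using inj by (simp add: card_image I_def)
qed

end

section \<open>Maschke's theorem and the uniqueness of multiplicities\<close>

lemma linear_projection_exists:
  assumes "cfun.subspace U"
  obtains p where "Vector_Spaces.linear cscale cscale p" "\<And>v. p v \<in> U" "\<And>u. u \<in> U \<Longrightarrow> p u = u"
proof -
  interpret vp: vector_space_pair cscale cscale by unfold_locales
  have "\<exists>g. g ` UNIV \<subseteq> U \<and> Vector_Spaces.linear cscale cscale g \<and> (\<forall>v\<in>U. g (id v) = v)"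
    by (rule vp.linear_exists_left_inverse_on) (auto intro: linear_cscaleI assms)
  then show ?thesis using that by auto
qed

lemma dim_strict_mono:
  assumes "finite X" "W \<subseteq> supported X" "cfun.subspace U" "U \<subset> W"
  shows "cfun.dim U < cfun.dim W"
proof -
  obtain B where B: "B \<subseteq> U" "cfun.independent B" "U \<subseteq> cfun.span B" "card B = cfun.dim U"
    using cfun.basis_exists by blast
  obtain D where D: "D \<subseteq> W" "cfun.independent D" "W \<subseteq> cfun.span D" "card D = cfun.dim W"
    using cfun.basis_exists by blast
  obtain w where w: "w \<in> W" "w \<notin> U" using assms(4) by auto
  have "cfun.span B \<subseteq> U" using B(1) assms(3) by (rule cfun.span_minimal)
  then have ind: "cfun.independent (insert w B)"
    using w B(2) by (intro cfun.independent_insertI) auto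
  have fin: "finite D" by (rule finite_independent_supported[OF assms(1) _ D(2)]) (use D(1) assms(2) in auto)
  have "finite B"
    by (rule finite_independent_supported[OF assms(1) _ B(2)]) (use B(1) assms(2,4) in auto)
  have "insert w B \<subseteq> cfun.span D" using w B(1) D(3) assms(4) by auto
  then have "card (insert w B) \<le> card D" using cfun.independent_span_bound[OF fin ind] by simp
  moreover have "w \<notin> B" using B(1) w(2) by auto
  ultimately show ?thesis using B(4) D(4) \<open>finite B\<close> by simp
qed

context symrep begin

text \<open>Maschke's averaging: the mean of the conjugates of a linear projection onto U commutes
  with the group and is still the identity on U, and its kernel in W is the complement.\<close>

lemma complement_exists:
  assumes W: "submodule (symgrp n) \<rho> W" and U: "submodule (symgrp n) \<rho> U" and UW: "U \<subseteq> W"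
  obtains C where "submodule (symgrp n) \<rho> C" "C \<subseteq> W" "U \<inter> C = {0}"
    "\<And>w. w \<in> W \<Longrightarrow> \<exists>u\<in>U. \<exists>c\<in>C. w = u + c"
proof -
  have subU: "cfun.subspace U" and subW: "cfun.subspace W" using U W by (simp_all add: submodule_def)
  obtain p where p: "Vector_Spaces.linear cscale cscale p" "\<And>v. p v \<in> U" "\<And>u. u \<in> U \<Longrightarrow> p u = u"
    using linear_projection_exists[OF subU] by blast
  interpret p: Vector_Spaces.linear cscale cscale p by (rule p(1))
  define P where "P v = cscale (1 / fact n) (\<Sum>g\<in>symgrp n. \<rho> g (p (\<rho> (inv g) v)))" for v
  have P_add: "P (u + v) = P u + P v" for u v
    by (simp add: P_def rep_add symgrp_group p.add sum.distrib cfun.scale_right_distrib)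
  have P_scale: "P (cscale c v) = cscale c (P v)" for c v
    by (simp add: P_def rep_scale symgrp_group p.scale mult.commute flip: cfun.scale_sum_right)
  have PU: "P v \<in> U" for v
    unfolding P_def using subU U p(2)
    by (intro cfun.subspace_scale cfun.subspace_sum) (auto simp: submodule_def)
  have P_id: "P u = u" if u: "u \<in> U" for u
  proof -
    have "(\<Sum>g\<in>symgrp n. \<rho> g (p (\<rho> (inv g) u))) = (\<Sum>g\<in>symgrp n. u)"
    proof (rule sum.cong[OF refl])
      fix g assume g: "g \<in> symgrp n"
      have "p (\<rho> (inv g) u) = \<rho> (inv g) u"
        using U u g by (intro p(3)) (auto simp: submodule_def symgrp_group)
      then show "\<rho> g (p (\<rho> (inv g) u)) = u"
        using rep_comp[OF g symgrp_group(2)[OF g], of u] by (simp add: symgrp_inverse(2)[OF g] rep_id)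
    qed
    then show ?thesis
      by (simp only: P_def fun_eq_iff cscale_def sum_fun_apply) (simp add: card_symgrp)
  qed
  have P_rep: "P (\<rho> h v) = \<rho> h (P v)" if h: "h \<in> symgrp n" for h v
  proof -
    have "(\<Sum>g\<in>symgrp n. \<rho> g (p (\<rho> (inv g) (\<rho> h v))))
        = (\<Sum>g\<in>symgrp n. \<rho> (h \<circ> g) (p (\<rho> (inv (h \<circ> g)) (\<rho> h v))))"
      by (rule sum_symgrp_comp_left[OF h, symmetric])
    also have "\<dots> = (\<Sum>g\<in>symgrp n. \<rho> h (\<rho> g (p (\<rho> (inv g) v))))"
    proof (rule sum.cong[OF refl])
      fix g assume g: "g \<in> symgrp n"
      have "\<rho> (inv (h \<circ> g)) (\<rho> h v) = \<rho> (inv g \<circ> inv h \<circ> h) v"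
        using g h by (simp add: symgrp_inv_comp[OF h g] rep_comp symgrp_group)
      also have "\<dots> = \<rho> (inv g) v" by (simp add: symgrp_inverse(8)[OF h])
      finally show "\<rho> (h \<circ> g) (p (\<rho> (inv (h \<circ> g)) (\<rho> h v))) = \<rho> h (\<rho> g (p (\<rho> (inv g) v)))"
        using g h by (simp add: rep_comp)
    qed
    finally show ?thesis by (simp add: P_def rep_scale[OF h] rep_sum[OF h])
  qed
  have rep0: "\<rho> g 0 = 0" if "g \<in> symgrp n" for g
    using rep_scale[OF that, of 0 0] by simp
  define C where "C = {w \<in> W. P w = 0}"
  show thesis
  proof (rule that[of C])
    show "submodule (symgrp n) \<rho> C"
      unfolding submodule_def C_def
    proof (intro conjI ballI)
      have "P 0 = 0" using P_scale[of 0 0] by simp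
      then show "cfun.subspace {w \<in> W. P w = 0}"
        using subW by (intro cfun.subspaceI)
          (simp_all add: P_add P_scale cfun.subspace_0 cfun.subspace_add cfun.subspace_scale)
      show "\<rho> g u \<in> {w \<in> W. P w = 0}" if "g \<in> symgrp n" "u \<in> {w \<in> W. P w = 0}" for g u
        using that W by (simp add: submodule_def P_rep rep0)
    qed
    show "C \<subseteq> W" by (auto simp: C_def)
    show "U \<inter> C = {0}"
    proof -
      have "P 0 = 0" using P_scale[of 0 0] by simp
      then show ?thesis using P_id subU subW by (auto simp: C_def cfun.subspace_0)
    qed
    fix w assume w: "w \<in> W"
    have "P (w - P w) = 0" using P_add[of "w - P w" "P w"] P_id[OF PU] by simp
    then have "w - P w \<in> C" using w PU UW subW by (auto simp: C_def intro: cfun.subspace_diff)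
    then show "\<exists>u\<in>U. \<exists>c\<in>C. w = u + c" using PU by (intro bexI[of _ "P w"] bexI[of _ "w - P w"]) auto
  qed
qed

text \<open>A nonzero submodule of least dimension is irreducible, and its complement has smaller
  dimension than W.\<close>

lemma complete_reducibility:
  assumes X: "finite X" and W: "submodule (symgrp n) \<rho> W" "W \<subseteq> supported X"
  shows "\<exists>\<U>. direct_sum_decomposition \<U> W \<and> (\<forall>U\<in>\<U>. irreducible_rep (symgrp n) \<rho> U)"
  using W
proof (induction "cfun.dim W" arbitrary: W rule: less_induct)
  case less
  note W = less.prems
  have subW: "cfun.subspace W" using W(1) by (simp add: submodule_def)
  show ?case
  proof (cases "W = {0}")
    case True
    have "direct_sum_decomposition {} W" by (simp add: direct_sum_decomposition_def True)
    then show ?thesis by (intro exI[of _ "{}"]) simp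
  next
    case False
    define M where "M U \<longleftrightarrow> submodule (symgrp n) \<rho> U \<and> U \<noteq> {0} \<and> U \<subseteq> W" for U
    have "M W" using W(1) False by (simp add: M_def)
    then obtain U where U: "M U" and min: "\<And>U'. M U' \<Longrightarrow> cfun.dim U \<le> cfun.dim U'"
      using ex_has_least_nat[of M W cfun.dim] by blast
    have subU: "cfun.subspace U" using U by (simp add: M_def submodule_def)
    have irrU: "irreducible_rep (symgrp n) \<rho> U"
      unfolding irreducible_rep_def
    proof (intro conjI allI impI)
      show "submodule (symgrp n) \<rho> U" "U \<noteq> {0}" using U by (simp_all add: M_def)
      fix U' assume U': "submodule (symgrp n) \<rho> U' \<and> U' \<subseteq> U"
      show "U' = {0} \<or> U' = U"
      proof (rule ccontr)
        assume n: "\<not> (U' = {0} \<or> U' = U)"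
        then have "M U'" using U U' by (auto simp: M_def)
        moreover have "cfun.dim U' < cfun.dim U"
          using n U U' W(2) by (intro dim_strict_mono[OF X]) (auto simp: M_def submodule_def)
        ultimately show False using min by fastforce
      qed
    qed
    obtain C where C: "submodule (symgrp n) \<rho> C" "C \<subseteq> W" "U \<inter> C = {0}"
        "\<And>w. w \<in> W \<Longrightarrow> \<exists>u\<in>U. \<exists>c\<in>C. w = u + c"
      using complement_exists[OF W(1), of U] U unfolding M_def by metis
    have subC: "cfun.subspace C" using C(1) by (simp add: submodule_def)
    have "C \<noteq> W" using C(3) U cfun.subspace_0[OF subU] by (auto simp: M_def)
    then have "cfun.dim C < cfun.dim W"
      using C(2) W(2) subC by (intro dim_strict_mono[OF X]) auto
    then obtain \<U> where D: "direct_sum_decomposition \<U> C" and irr: "\<forall>U\<in>\<U>. irreducible_rep (symgrp n) \<rho> U"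
      using less.hyps[of C] C(1,2) W(2) by blast
    note D' = D[unfolded direct_sum_decomposition_def]
    note finU = D'[THEN conjunct1] and subs = D'[THEN conjunct2, THEN conjunct1]
      and CU = D'[THEN conjunct2, THEN conjunct2, THEN conjunct1]
      and indep = D'[THEN conjunct2, THEN conjunct2, THEN conjunct2]
    have inC: "(\<Sum>X\<in>\<U>. f X) \<in> C" if "\<forall>X\<in>\<U>. f X \<in> X" for f using that unfolding CU by blast
    \<comment> \<open>Decompositions are sets, so the new summand must not be in the old one: its
      nonzero vectors would then lie in C as well.\<close>
    have notin: "U \<notin> \<U>"
    proof
      assume UU: "U \<in> \<U>"
      obtain u where u: "u \<in> U" "u \<noteq> 0" using U cfun.subspace_0[OF subU] by (auto simp: M_def)
      have "(\<Sum>X\<in>\<U>. if X = U then u else 0) \<in> C"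
        using u subs by (intro inC) (auto simp: cfun.subspace_0)
      then have "u \<in> C" using UU finU by simp
      then show False using u C(3) by auto
    qed
    have "direct_sum_decomposition (insert U \<U>) W"
      unfolding direct_sum_decomposition_def
    proof (intro conjI allI impI)
      show "finite (insert U \<U>)" using finU by simp
      show "\<forall>U\<in>insert U \<U>. cfun.subspace U" using subs subU by simp
      show "W = {\<Sum>X\<in>insert U \<U>. f X | f. \<forall>X\<in>insert U \<U>. f X \<in> X}"
      proof (intro equalityI subsetI)
        fix w assume "w \<in> W"
        then obtain u c where uc: "u \<in> U" "c \<in> C" "w = u + c" using C(4) by blast
        then obtain f where f: "c = (\<Sum>X\<in>\<U>. f X)" "\<forall>X\<in>\<U>. f X \<in> X" unfolding CU by blast
        have "(\<Sum>X\<in>\<U>. (f(U := u)) X) = (\<Sum>X\<in>\<U>. f X)"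
          using notin by (intro sum.cong) auto
        then have "w = (\<Sum>X\<in>insert U \<U>. (f(U := u)) X)"
          using notin finU uc(3) f(1) by (simp add: sum.insert del: fun_upd_apply) (simp add: fun_upd_same)
        moreover have "\<forall>X\<in>insert U \<U>. (f(U := u)) X \<in> X" using f(2) uc(1) by auto
        ultimately show "w \<in> {\<Sum>X\<in>insert U \<U>. f X | f. \<forall>X\<in>insert U \<U>. f X \<in> X}" by blast
      next
        fix w assume "w \<in> {\<Sum>X\<in>insert U \<U>. f X | f. \<forall>X\<in>insert U \<U>. f X \<in> X}"
        then obtain f where f: "w = (\<Sum>X\<in>insert U \<U>. f X)" "\<forall>X\<in>insert U \<U>. f X \<in> X" by blast
        have "w = f U + (\<Sum>X\<in>\<U>. f X)" unfolding f(1) by (rule sum.insert[OF finU notin])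
        moreover have "f U \<in> W" using f(2) U by (auto simp: M_def)
        moreover have "(\<Sum>X\<in>\<U>. f X) \<in> W" using inC[of f] f(2) C(2) by auto
        ultimately show "w \<in> W" using subW by (simp only: cfun.subspace_add)
      qed
      fix f assume f: "(\<forall>X\<in>insert U \<U>. f X \<in> X) \<and> (\<Sum>X\<in>insert U \<U>. f X) = 0"
      have 0: "f U + (\<Sum>X\<in>\<U>. f X) = 0" using f by (simp only: sum.insert[OF finU notin])
      have c: "(\<Sum>X\<in>\<U>. f X) \<in> C" using inC[of f] f by auto
      have "f U = - (\<Sum>X\<in>\<U>. f X)" using 0 by (rule eq_neg_iff_add_eq_0[THEN iffD2])
      then have "f U \<in> C" using c subC by (simp only: cfun.subspace_neg)
      then have fU: "f U = 0" using f C(3) by auto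
      then have "(\<Sum>X\<in>\<U>. f X) = 0" using 0 by simp
      then have "\<forall>X\<in>\<U>. f X = 0" using f by (intro mp[OF spec[OF indep]]) blast
      then show "\<forall>X\<in>insert U \<U>. f X = 0" using fU by simp
    qed
    then show ?thesis using irr irrU by (intro exI[of _ "insert U \<U>"]) simp
  qed
qed

end

context symrep_idempotent begin

theorem multiplicity_rep_eq_dim:
  assumes "finite X" "submodule (symgrp n) \<rho> W" "W \<subseteq> supported X"
  shows "multiplicity_rep (symgrp n) left_act (left_ideal n e) \<rho> W = cfun.dim (act e ` W)"
  unfolding multiplicity_rep_def
proof (rule the_equality)
  obtain \<U> where "direct_sum_decomposition \<U> W" "\<forall>U\<in>\<U>. irreducible_rep (symgrp n) \<rho> U"
    using complete_reducibility[OF assms] by blast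
  then show "\<exists>\<U>. direct_sum_decomposition \<U> W \<and> (\<forall>U\<in>\<U>. irreducible_rep (symgrp n) \<rho> U) \<and>
      cfun.dim (act e ` W) = card {U \<in> \<U>. isomorphic_rep (symgrp n) left_act (left_ideal n e) \<rho> U}"
    using card_isomorphic_summands[OF assms(2)] by metis
qed (use card_isomorphic_summands[OF assms(2)] in blast)

end

section \<open>Young symmetrizers\<close>

lemma symgrp_mem: "p \<in> symgrp n \<Longrightarrow> v \<in> {1..n} \<Longrightarrow> p v \<in> {1..n}"
  using permutes_in_image[of p "{1..n}" v] by (simp add: symgrp_def del: One_nat_def atLeastAtMost_iff)

lemma symgrp_permutation: "p \<in> symgrp n \<Longrightarrow> permutation p"
  by (rule permutes_imp_permutation[of "{1..n}"]) (simp_all only: symgrp_def mem_Collect_eq finite_atLeastAtMost)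

text \<open>A Young diagram with row lengths \<open>part\<close>, filled with 1 to n in any way.
  Recording the box of each number by two functions makes \<open>row\<close> itself a word whose
  content is the shape, so that permutations can be studied through words.\<close>

locale diagram =
  fixes n :: nat and row col :: "nat \<Rightarrow> nat" and part :: "nat \<Rightarrow> nat"
  assumes boxes: "bij_betw (\<lambda>v. (row v, col v)) {1..n} {(r, c). c < part r}"
    and part_anti: "r \<le> s \<Longrightarrow> part s \<le> part r"
begin

definition rowgrp :: "perm set" where
  "rowgrp = {p \<in> symgrp n. \<forall>v\<in>{1..n}. row (p v) = row v}"

definition colgrp :: "perm set" where
  "colgrp = {p \<in> symgrp n. \<forall>v\<in>{1..n}. col (p v) = col v}"

definition col_repeats :: "(nat \<Rightarrow> 'a) \<Rightarrow> bool" where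
  "col_repeats w \<longleftrightarrow> (\<exists>u\<in>{1..n}. \<exists>v\<in>{1..n}. u \<noteq> v \<and> col u = col v \<and> w u = w v)"

lemma col_less: "v \<in> {1..n} \<Longrightarrow> col v < part (row v)"
  using bij_betwE[OF boxes] by simp

lemma box_eq: "u \<in> {1..n} \<Longrightarrow> v \<in> {1..n} \<Longrightarrow> row u = row v \<Longrightarrow> col u = col v \<Longrightarrow> u = v"
  using inj_onD[OF bij_betw_imp_inj_on[OF boxes], of u v] by simp

lemma box_exists: "c < part r \<Longrightarrow> \<exists>v\<in>{1..n}. row v = r \<and> col v = c"
proof -
  assume "c < part r"
  then have "(r, c) \<in> (\<lambda>v. (row v, col v)) ` {1..n}" using boxes by (simp add: bij_betw_def)
  then show ?thesis by auto
qed

text \<open>The letters in a column are distinct, so at most r of them are below r. If the column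
  has a box in each of the rows below r, it has r boxes there; otherwise all of its boxes lie there.
  Summed over the columns this gives \<open>dominance\<close>.\<close>

lemma card_col_less:
  fixes w :: "nat \<Rightarrow> nat"
  assumes w: "\<not> col_repeats w"
  shows "card {v\<in>{1..n}. w v < r \<and> col v = c} \<le> card {v\<in>{1..n}. row v < r \<and> col v = c}"
proof (cases "\<forall>s<r. c < part s")
  case True
  have "inj_on w {v\<in>{1..n}. w v < r \<and> col v = c}"
  proof (rule inj_onI, rule ccontr)
    fix u v assume "u \<in> {v\<in>{1..n}. w v < r \<and> col v = c}" "v \<in> {v\<in>{1..n}. w v < r \<and> col v = c}"
      and uv: "w u = w v" "u \<noteq> v"
    then have "u \<in> {1..n}" "v \<in> {1..n}" "col u = col v" by simp_all
    then show False using w uv unfolding col_repeats_def by blast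
  qed
  then have "card {v\<in>{1..n}. w v < r \<and> col v = c} \<le> card {..<r}"
    by (rule card_inj_on_le) auto
  also have "{..<r} \<subseteq> row ` {v\<in>{1..n}. row v < r \<and> col v = c}"
    using True box_exists by force
  then have "card {..<r} \<le> card {v\<in>{1..n}. row v < r \<and> col v = c}"
    by (rule surj_card_le[rotated]) simp
  finally show ?thesis .
next
  case False
  then obtain s where s: "s < r" "part s \<le> c" by (auto simp: not_less)
  have "row v < r" if "v \<in> {1..n}" "col v = c" for v
  proof (rule ccontr)
    assume "\<not> row v < r"
    then have "part (row v) \<le> part s" using s(1) by (intro part_anti) simp
    then show False using col_less[OF that(1)] s(2) that(2) by simp
  qed
  then show ?thesis by (intro card_mono) auto
qed

lemma card_fibres_col:
  "card {v\<in>{1..n}. P v} = (\<Sum>c\<in>col ` {1..n}. card {v\<in>{1..n}. P v \<and> col v = c})"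
  by (rule card_fibres[symmetric]) auto

lemma dominance:
  fixes w :: "nat \<Rightarrow> nat"
  assumes "\<not> col_repeats w"
  shows "card {v\<in>{1..n}. w v < r} \<le> card {v\<in>{1..n}. row v < r}"
proof -
  have "(\<Sum>c\<in>col ` {1..n}. card {v\<in>{1..n}. w v < r \<and> col v = c})
      \<le> (\<Sum>c\<in>col ` {1..n}. card {v\<in>{1..n}. row v < r \<and> col v = c})"
    by (rule sum_mono) (rule card_col_less[OF assms])
  then show ?thesis by (simp only: card_fibres_col[symmetric])
qed

lemma card_less_sum:
  fixes w :: "nat \<Rightarrow> nat"
  shows "card {v\<in>{1..n}. w v < r} = (\<Sum>s<r. card {v\<in>{1..n}. w v = s})"
proof -
  have "card {v\<in>{1..n}. w v < r} = card (\<Union>s\<in>{..<r}. {v\<in>{1..n}. w v = s})"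
    by (intro arg_cong[of _ _ card]) auto
  also have "\<dots> = (\<Sum>s<r. card {v\<in>{1..n}. w v = s})" by (rule card_UN_disjoint) auto
  finally show ?thesis .
qed

lemma card_row: "card {v\<in>{1..n}. row v = r} = part r"
proof -
  have "bij_betw col {v\<in>{1..n}. row v = r} {..<part r}"
    unfolding bij_betw_def
  proof
    show "inj_on col {v\<in>{1..n}. row v = r}" using box_eq by (auto simp: inj_on_def)
    show "col ` {v\<in>{1..n}. row v = r} = {..<part r}" using col_less box_exists by force
  qed
  then show ?thesis by (auto dest: bij_betw_same_card)
qed

text \<open>When the content equals the shape, the inequality of \<open>card_col_less\<close> is an
  equality in total, hence in every column. If the column of v did not reach row w v, all of its
  letters would be below w v, contrary to the letter at v itself.\<close>

lemma col_less_letter: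
  fixes w :: "nat \<Rightarrow> nat"
  assumes w: "\<not> col_repeats w" and content: "\<And>r. card {v\<in>{1..n}. w v = r} = part r"
    and v: "v \<in> {1..n}"
  shows "col v < part (w v)"
proof (rule ccontr)
  assume "\<not> col v < part (w v)"
  then have le: "part (w v) \<le> col v" by simp
  have row_less: "row u < w v" if "u \<in> {1..n}" "col u = col v" for u
  proof (rule ccontr)
    assume "\<not> row u < w v"
    then have "part (row u) \<le> part (w v)" by (intro part_anti) simp
    then show False using col_less[OF that(1)] le that(2) by simp
  qed
  have "(\<Sum>c\<in>col ` {1..n}. card {u\<in>{1..n}. w u < w v \<and> col u = c})
      = (\<Sum>c\<in>col ` {1..n}. card {u\<in>{1..n}. row u < w v \<and> col u = c})"
    unfolding card_fibres_col[symmetric] card_less_sum content card_row ..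
  then have "card {u\<in>{1..n}. w u < w v \<and> col u = col v} = card {u\<in>{1..n}. row u < w v \<and> col u = col v}"
    using sum_mono_inv[of "\<lambda>c. card {u\<in>{1..n}. w u < w v \<and> col u = c}" "col ` {1..n}"
        "\<lambda>c. card {u\<in>{1..n}. row u < w v \<and> col u = c}" "col v"] card_col_less[OF w] v by auto
  also have "{u\<in>{1..n}. row u < w v \<and> col u = col v} = {u\<in>{1..n}. col u = col v}"
    using row_less by auto
  finally have "{u\<in>{1..n}. w u < w v \<and> col u = col v} = {u\<in>{1..n}. col u = col v}"
    by (intro card_subset_eq) auto
  then show False using v by auto
qed

text \<open>Each v moves within its column to row w v, which exists by
  \<open>col_less_letter\<close>; since no letter repeats in a column, this is a
  permutation.\<close>

lemma straighten:
  fixes w :: "nat \<Rightarrow> nat"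
  assumes w: "\<not> col_repeats w" and content: "\<And>r. card {v\<in>{1..n}. w v = r} = part r"
  shows "\<exists>p\<in>colgrp. \<forall>v\<in>{1..n}. w v = row (p v)"
proof -
  have "\<forall>v\<in>{1..n}. \<exists>u\<in>{1..n}. row u = w v \<and> col u = col v"
    using box_exists[OF col_less_letter[OF w content]] by blast
  then obtain f where f: "\<And>v. v \<in> {1..n} \<Longrightarrow> f v \<in> {1..n} \<and> row (f v) = w v \<and> col (f v) = col v"
    by metis
  define p where "p v = (if v \<in> {1..n} then f v else v)" for v
  have "inj_on f {1..n}"
  proof (rule inj_onI, rule ccontr)
    fix u v assume uv: "u \<in> {1..n}" "v \<in> {1..n}" "f u = f v" "u \<noteq> v"
    then have "w u = w v" "col u = col v" using f[OF uv(1)] f[OF uv(2)] by simp_all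
    then show False using w uv(1,2,4) unfolding col_repeats_def by blast
  qed
  then have "inj_on p {1..n}" by (rule inj_on_cong[THEN iffD1, rotated]) (auto simp: p_def)
  moreover have "p ` {1..n} \<subseteq> {1..n}" using f by (auto simp: p_def)
  ultimately have "bij_betw p {1..n} {1..n}"
    by (simp add: bij_betw_def endo_inj_surj)
  then have "p permutes {1..n}" by (rule bij_imp_permutes) (auto simp: p_def)
  then have "p \<in> colgrp" using f by (auto simp: colgrp_def symgrp_def p_def)
  moreover have "\<forall>v\<in>{1..n}. w v = row (p v)" using f by (auto simp: p_def)
  ultimately show ?thesis by blast
qed

lemma grp_closed:
  "id \<in> rowgrp" "p \<in> rowgrp \<Longrightarrow> q \<in> rowgrp \<Longrightarrow> p \<circ> q \<in> rowgrp"
  "id \<in> colgrp" "p \<in> colgrp \<Longrightarrow> q \<in> colgrp \<Longrightarrow> p \<circ> q \<in> colgrp"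
proof -
  show "p \<circ> q \<in> rowgrp" if "p \<in> rowgrp" "q \<in> rowgrp"
    unfolding rowgrp_def mem_Collect_eq
  proof (intro conjI ballI)
    show "p \<circ> q \<in> symgrp n" using that by (simp add: rowgrp_def symgrp_group)
    fix v assume v: "v \<in> {1..n}"
    have "q v \<in> {1..n}" by (rule symgrp_mem[OF _ v]) (use that(2) in \<open>simp add: rowgrp_def\<close>)
    then show "row ((p \<circ> q) v) = row v" using that v by (simp add: rowgrp_def)
  qed
  show "p \<circ> q \<in> colgrp" if "p \<in> colgrp" "q \<in> colgrp"
    unfolding colgrp_def mem_Collect_eq
  proof (intro conjI ballI)
    show "p \<circ> q \<in> symgrp n" using that by (simp add: colgrp_def symgrp_group)
    fix v assume v: "v \<in> {1..n}"
    have "q v \<in> {1..n}" by (rule symgrp_mem[OF _ v]) (use that(2) in \<open>simp add: colgrp_def\<close>)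
    then show "col ((p \<circ> q) v) = col v" using that v by (simp add: colgrp_def)
  qed
qed (simp_all add: rowgrp_def colgrp_def symgrp_group)

lemma grp_symgrp: "p \<in> rowgrp \<Longrightarrow> p \<in> symgrp n" "p \<in> colgrp \<Longrightarrow> p \<in> symgrp n"
  by (simp_all add: rowgrp_def colgrp_def)

lemma grp_inv: "p \<in> rowgrp \<Longrightarrow> inv p \<in> rowgrp" "p \<in> colgrp \<Longrightarrow> inv p \<in> colgrp"
proof -
  show "inv p \<in> rowgrp" if p: "p \<in> rowgrp"
  proof -
    have pG: "p \<in> symgrp n" using p by (rule grp_symgrp)
    have "row (inv p v) = row v" if "v \<in> {1..n}" for v
    proof -
      have "row (p (inv p v)) = row (inv p v)"
        using p symgrp_mem[OF symgrp_group(2)[OF pG] that] by (simp add: rowgrp_def)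
      then show ?thesis by (simp add: symgrp_inverse(5)[OF pG])
    qed
    then show ?thesis by (simp add: rowgrp_def symgrp_group pG)
  qed
  show "inv p \<in> colgrp" if p: "p \<in> colgrp"
  proof -
    have pG: "p \<in> symgrp n" using p by (rule grp_symgrp)
    have "col (inv p v) = col v" if "v \<in> {1..n}" for v
    proof -
      have "col (p (inv p v)) = col (inv p v)"
        using p symgrp_mem[OF symgrp_group(2)[OF pG] that] by (simp add: colgrp_def)
      then show ?thesis by (simp add: symgrp_inverse(5)[OF pG])
    qed
    then show ?thesis by (simp add: colgrp_def symgrp_group pG)
  qed
qed

lemma grp_comp_iff:
  "q \<in> rowgrp \<Longrightarrow> q \<circ> p \<in> rowgrp \<longleftrightarrow> p \<in> rowgrp"
  "q \<in> colgrp \<Longrightarrow> p \<circ> q \<in> colgrp \<longleftrightarrow> p \<in> colgrp"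
proof -
  show "q \<circ> p \<in> rowgrp \<longleftrightarrow> p \<in> rowgrp" if q: "q \<in> rowgrp"
    using grp_closed(2)[OF q, of p] grp_closed(2)[OF grp_inv(1)[OF q], of "q \<circ> p"]
    by (auto simp: symgrp_inverse(6)[OF grp_symgrp(1)[OF q]])
  show "p \<circ> q \<in> colgrp \<longleftrightarrow> p \<in> colgrp" if q: "q \<in> colgrp"
    using grp_closed(4)[OF _ q, of p] grp_closed(4)[OF _ grp_inv(2)[OF q], of "p \<circ> q"]
    by (auto simp: symgrp_inverse(9)[OF grp_symgrp(2)[OF q]])
qed

lemma row_col_trivial:
  assumes "p \<in> rowgrp" "p \<in> colgrp"
  shows "p = id"
proof
  fix v show "p v = id v"
  proof (cases "v \<in> {1..n}")
    case True
    then show ?thesis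
      using assms box_eq[OF symgrp_mem[OF grp_symgrp(1)[OF assms(1)] True] True]
      by (simp add: rowgrp_def colgrp_def)
  next
    case False
    then show ?thesis using assms(1) by (auto simp: rowgrp_def symgrp_def permutes_not_in)
  qed
qed

section \<open>The Young symmetrizer and its idempotent\<close>

definition csgn :: "perm \<Rightarrow> complex" where "csgn p = of_int (sign p)"

lemma csgn_comp: "p \<in> symgrp n \<Longrightarrow> q \<in> symgrp n \<Longrightarrow> csgn (p \<circ> q) = csgn p * csgn q"
  unfolding csgn_def by (simp only: sign_compose[OF symgrp_permutation symgrp_permutation] of_int_mult)

lemma csgn_inv: "p \<in> symgrp n \<Longrightarrow> csgn (inv p) = csgn p"
  unfolding csgn_def by (simp only: sign_inverse[OF symgrp_permutation])

lemma csgn_id: "csgn id = 1"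
  by (simp add: csgn_def sign_id)

definition rsym :: "perm \<Rightarrow> complex" where
  "rsym = (\<lambda>p. if p \<in> rowgrp then 1 else 0)"

definition casym :: "perm \<Rightarrow> complex" where
  "casym = (\<lambda>p. if p \<in> colgrp then csgn p else 0)"

definition ysym :: "perm \<Rightarrow> complex" where
  "ysym = grpalg_mult n rsym casym"

lemma repeats_transposition:
  assumes "col_repeats w"
  obtains t where "t \<in> colgrp" "csgn t = - 1" "w \<circ> t = w"
proof -
  obtain u v where uv: "u \<in> {1..n}" "v \<in> {1..n}" "u \<noteq> v" "col u = col v" "w u = w v"
    using assms by (auto simp: col_repeats_def)
  show thesis
  proof (rule that[of "Transposition.transpose u v"])
    have "Transposition.transpose u v permutes {1..n}" using uv by (simp add: permutes_swap_id)
    then show "Transposition.transpose u v \<in> colgrp"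
      using uv by (auto simp: colgrp_def symgrp_def Transposition.transpose_def)
    show "csgn (Transposition.transpose u v) = - 1"
      using uv by (simp add: csgn_def sign_swap_id)
    show "w \<circ> Transposition.transpose u v = w"
      using uv by (auto simp: fun_eq_iff Transposition.transpose_def)
  qed
qed

text \<open>The symmetry of the Young symmetrizer: invariant under the row group on the left,
  alternating under the column group on the right. By \<open>bisym_eq\<close> the functions of this
  kind form a line.\<close>

definition bisym :: "(perm \<Rightarrow> complex) \<Rightarrow> bool" where
  "bisym z \<longleftrightarrow> z \<in> grpalg n \<and> (\<forall>r\<in>rowgrp. \<forall>g. z (r \<circ> g) = z g)
     \<and> (\<forall>p\<in>colgrp. \<forall>g. z (g \<circ> p) = csgn p * z g)"

text \<open>Read v \<mapsto> row (g v) as a word. If a letter repeats in a column, the transposition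
  t of the two places is a row permutation after conjugation by g, whence z g = - z g. Otherwise
  \<open>straighten\<close> factors g into a row and a column permutation. The factor k depends on g
  alone, which makes any two such functions proportional.\<close>

lemma bisym_factor:
  assumes g: "g \<in> symgrp n"
  shows "\<exists>k. \<forall>z. bisym z \<longrightarrow> z g = k * z id"
proof (cases "col_repeats (\<lambda>v. row (g v))")
  case True
  then obtain t where t: "t \<in> colgrp" "csgn t = - 1" "(\<lambda>v. row (g v)) \<circ> t = (\<lambda>v. row (g v))"
    by (rule repeats_transposition)
  have tG: "t \<in> symgrp n" by (rule grp_symgrp(2)[OF t(1)])
  have r: "g \<circ> t \<circ> inv g \<in> rowgrp"
    using fun_cong[OF t(3)] g tG symgrp_inverse(5)[OF g]
    by (simp add: rowgrp_def symgrp_group)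
  have "z g = 0" if z: "bisym z" for z
  proof -
    have "z (g \<circ> t) = z ((g \<circ> t \<circ> inv g) \<circ> g)" by (simp add: symgrp_inverse(8)[OF g])
    also have "\<dots> = z g" using z r unfolding bisym_def by blast
    finally have "csgn t * z g = z g" using z t(1) by (simp add: bisym_def)
    then show ?thesis by (simp add: t(2))
  qed
  then show ?thesis by (intro exI[of _ 0]) simp
next
  case False
  have "card {v\<in>{1..n}. row (g v) = r} = part r" for r
  proof -
    have "bij_betw g {v\<in>{1..n}. row (g v) = r} {v\<in>{1..n}. row v = r}"
      by (rule bij_betw_byWitness[of _ "inv g"])
        (use symgrp_mem[OF g] symgrp_mem[OF symgrp_group(2)[OF g]] symgrp_inverse(4,5)[OF g] in auto)
    then show ?thesis by (simp only: card_row bij_betw_same_card[of g])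
  qed
  from straighten[OF False this] obtain p where p: "p \<in> colgrp" "\<forall>v\<in>{1..n}. row (g v) = row (p v)"
    by blast
  have pG: "p \<in> symgrp n" by (rule grp_symgrp(2)[OF p(1)])
  have "g \<circ> inv p \<in> rowgrp"
    using p(2) symgrp_mem[OF symgrp_group(2)[OF pG]] symgrp_inverse(5)[OF pG] g pG
    by (simp add: rowgrp_def symgrp_group)
  then have "z (g \<circ> inv p \<circ> p) = csgn p * z id" if "bisym z" for z
  proof -
    assume r: "g \<circ> inv p \<in> rowgrp"
    have "z (g \<circ> inv p \<circ> p) = csgn p * z (g \<circ> inv p)" using that p(1) by (simp add: bisym_def)
    also have "z (g \<circ> inv p) = z ((g \<circ> inv p) \<circ> id)" by simp
    also have "\<dots> = z id" using that r unfolding bisym_def by blast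
    finally show ?thesis .
  qed
  then show ?thesis unfolding symgrp_inverse(8)[OF pG] by blast
qed

lemma rsym_invariant: "r \<in> rowgrp \<Longrightarrow> grpalg_mult n rsym y (r \<circ> g) = grpalg_mult n rsym y g"
proof -
  assume r: "r \<in> rowgrp"
  have rG: "r \<in> symgrp n" by (rule grp_symgrp(1)[OF r])
  have "grpalg_mult n rsym y (r \<circ> g) = (\<Sum>q\<in>symgrp n. rsym (r \<circ> q) * y (inv (r \<circ> q) \<circ> (r \<circ> g)))"
    unfolding grpalg_mult_def by (rule sum_symgrp_comp_left[OF rG, symmetric])
  also have "\<dots> = (\<Sum>q\<in>symgrp n. rsym q * y (inv q \<circ> g))"
  proof (rule sum.cong[OF refl])
    fix q assume q: "q \<in> symgrp n"
    have "inv (r \<circ> q) \<circ> (r \<circ> g) = inv q \<circ> g"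
      by (simp add: symgrp_inv_comp[OF rG q] comp_assoc symgrp_inverse(6)[OF rG])
    then show "rsym (r \<circ> q) * y (inv (r \<circ> q) \<circ> (r \<circ> g)) = rsym q * y (inv q \<circ> g)"
      by (simp add: rsym_def grp_comp_iff(1)[OF r])
  qed
  finally show ?thesis by (simp add: grpalg_mult_def)
qed

lemma casym_invariant: "p \<in> colgrp \<Longrightarrow> casym (g \<circ> p) = csgn p * casym g"
proof -
  assume p: "p \<in> colgrp"
  show ?thesis
  proof (cases "g \<in> colgrp")
    case True
    then show ?thesis
      using csgn_comp[OF grp_symgrp(2)[OF True] grp_symgrp(2)[OF p]] grp_comp_iff(2)[OF p, of g]
      by (simp add: casym_def)
  next
    case False
    then show ?thesis using grp_comp_iff(2)[OF p, of g] by (simp add: casym_def)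
  qed
qed

lemma mult_casym_invariant:
  "p \<in> colgrp \<Longrightarrow> grpalg_mult n y casym (g \<circ> p) = csgn p * grpalg_mult n y casym g"
proof -
  assume p: "p \<in> colgrp"
  have "y q * casym (inv q \<circ> (g \<circ> p)) = csgn p * (y q * casym (inv q \<circ> g))" for q
    using casym_invariant[OF p, of "inv q \<circ> g"] by (simp add: comp_assoc)
  then show ?thesis by (simp only: grpalg_mult_def sum_distrib_left)
qed

lemma rsym_in: "rsym \<in> grpalg n" and casym_in: "casym \<in> grpalg n"
  by (auto simp: grpalg_def rsym_def casym_def grp_symgrp)

lemma ysym_in: "ysym \<in> grpalg n"
  unfolding ysym_def by (rule grpalg_mult_in_grpalg[OF casym_in])

lemma bisym_mult: "bisym (grpalg_mult n (grpalg_mult n rsym y) casym)"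
  unfolding bisym_def
proof (intro conjI ballI allI)
  show "grpalg_mult n (grpalg_mult n rsym y) casym \<in> grpalg n"
    by (rule grpalg_mult_in_grpalg[OF casym_in])
  show "grpalg_mult n (grpalg_mult n rsym y) casym (g \<circ> p)
      = csgn p * grpalg_mult n (grpalg_mult n rsym y) casym g" if "p \<in> colgrp" for p g
    by (rule mult_casym_invariant[OF that])
  show "grpalg_mult n (grpalg_mult n rsym y) casym (r \<circ> g)
      = grpalg_mult n (grpalg_mult n rsym y) casym g" if "r \<in> rowgrp" for r g
    unfolding grpalg_mult_assoc by (rule rsym_invariant[OF that])
qed

lemma bisym_ysym: "bisym ysym"
  using bisym_mult[of "delta id"] by (simp add: ysym_def grpalg_mult_one_right rsym_in)

lemma ysym_id: "ysym id = 1"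
proof -
  have "ysym id = (\<Sum>q\<in>symgrp n. if q = id then 1 else 0)"
    unfolding ysym_def grpalg_mult_def
  proof (rule sum.cong[OF refl])
    fix q assume q: "q \<in> symgrp n"
    have "inv q \<in> colgrp \<longleftrightarrow> q \<in> colgrp"
      using grp_inv(2)[of q] grp_inv(2)[of "inv q"] symgrp_inverse(3)[OF q] by auto
    then show "rsym q * casym (inv q \<circ> id) = (if q = id then 1 else 0)"
      using row_col_trivial[of q] by (auto simp: rsym_def casym_def grp_closed csgn_id)
  qed
  then show ?thesis by (simp add: finite_symgrp symgrp_group)
qed

lemma bisym_eq: "bisym z \<Longrightarrow> z = cscale (z id) ysym"
proof
  fix g assume z: "bisym z"
  show "z g = cscale (z id) ysym g"
  proof (cases "g \<in> symgrp n")
    case True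
    then obtain k where "\<forall>z. bisym z \<longrightarrow> z g = k * z id" using bisym_factor by blast
    then have "z g = k * z id" "ysym g = k * ysym id" using z bisym_ysym by blast+
    then show ?thesis by (simp add: cscale_def ysym_id)
  next
    case False
    then show ?thesis using z ysym_in by (simp add: bisym_def grpalg_def cscale_def)
  qed
qed

text \<open>With R and C for \<open>rsym\<close> and \<open>casym\<close>, the product regroups as R
  (C x R) C, which has the symmetry of \<open>bisym\<close>. This is the source of
  primitivity.\<close>

lemma ysym_mult_ysym: "\<exists>t. grpalg_mult n (grpalg_mult n ysym x) ysym = cscale t ysym"
proof -
  have "grpalg_mult n (grpalg_mult n ysym x) ysym
      = grpalg_mult n (grpalg_mult n rsym (grpalg_mult n casym (grpalg_mult n x rsym))) casym"
    by (simp add: ysym_def grpalg_mult_assoc)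
  then show ?thesis using bisym_eq[OF bisym_mult] by metis
qed

text \<open>The scalar by which \<open>ysym\<close> differs from its square, classically n! divided
  by the dimension of the irreducible representation, that is, the product of the hook
  lengths.\<close>

definition hook :: complex where "hook = grpalg_mult n ysym ysym id"

lemma ysym_square: "grpalg_mult n ysym ysym = cscale hook ysym"
proof -
  obtain t where t: "grpalg_mult n (grpalg_mult n ysym (delta id)) ysym = cscale t ysym"
    using ysym_mult_ysym by blast
  then have "grpalg_mult n ysym ysym = cscale t ysym"
    by (simp add: grpalg_mult_one_right ysym_in)
  moreover from this have "hook = t" by (simp add: hook_def cscale_def ysym_id)
  ultimately show ?thesis by simp
qed

text \<open>Right multiplication by \<open>ysym\<close> has trace \<open>n!\<close>, so it is not nilpotent.\<close>

lemma hook_nonzero: "hook \<noteq> 0"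
proof
  assume h: "hook = 0"
  have "(\<Sum>x\<in>symgrp n. grpalg_mult n (delta x) ysym x)
      = hook * of_nat (cfun.dim ((\<lambda>x. grpalg_mult n x ysym) ` supported (symgrp n)))"
  proof (rule trace_quasi_idempotent[OF finite_symgrp])
    show "Vector_Spaces.linear cscale cscale (\<lambda>x. grpalg_mult n x ysym)"
      by (rule linear_cscaleI) (simp_all add: grpalg_mult_left)
    show "grpalg_mult n v ysym \<in> supported (symgrp n)" for v
      unfolding grpalg_eq_supported[symmetric] by (rule grpalg_mult_in_grpalg[OF ysym_in])
    show "grpalg_mult n (grpalg_mult n v ysym) ysym = cscale hook (grpalg_mult n v ysym)" for v
      by (simp add: grpalg_mult_assoc ysym_square grpalg_mult_right)
  qed
  moreover have "(\<Sum>x\<in>symgrp n. grpalg_mult n (delta x) ysym x) = (\<Sum>x\<in>symgrp n. 1)"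
    by (rule sum.cong[OF refl]) (simp add: grpalg_mult_delta_left left_act_def symgrp_inverse(1) ysym_id)
  ultimately show False by (simp add: h card_symgrp)
qed

definition idem :: "perm \<Rightarrow> complex" where "idem = cscale (1 / hook) ysym"

lemma primitive_idem: "primitive_idempotent n idem"
proof
  show "idem \<in> grpalg n"
    unfolding idem_def grpalg_eq_supported
    by (intro cfun.subspace_scale subspace_supported ysym_in[unfolded grpalg_eq_supported])
  show "idem \<noteq> 0"
  proof
    assume "idem = 0"
    then have "idem id = 0" by simp
    then show False using hook_nonzero by (simp add: idem_def cscale_def ysym_id)
  qed
  show "grpalg_mult n idem idem = idem"
    using hook_nonzero by (simp add: idem_def grpalg_mult_left grpalg_mult_right ysym_square)
  fix x assume "x \<in> grpalg n"
  obtain t where t: "grpalg_mult n (grpalg_mult n ysym x) ysym = cscale t ysym"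
    using ysym_mult_ysym by blast
  have "grpalg_mult n (grpalg_mult n idem x) idem = cscale (t / hook) idem"
    by (simp add: idem_def grpalg_mult_left grpalg_mult_right t mult.commute)
  then show "\<exists>t. grpalg_mult n (grpalg_mult n idem x) idem = cscale t idem" by (rule exI[of _ "t / hook"])
qed

lemma left_ideal_idem: "left_ideal n idem = {grpalg_mult n x ysym | x. x \<in> grpalg n}"
proof -
  have sc: "cscale k x \<in> grpalg n" if "x \<in> grpalg n" for k x
    using that unfolding grpalg_eq_supported by (intro cfun.subspace_scale subspace_supported)
  have "grpalg_mult n x idem = grpalg_mult n (cscale (1 / hook) x) ysym"
    "grpalg_mult n x ysym = grpalg_mult n (cscale hook x) idem" for x
    using hook_nonzero by (simp_all add: idem_def grpalg_mult_left grpalg_mult_right)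
  then show ?thesis unfolding left_ideal_def using sc by blast
qed

end

section \<open>The character of a Young idempotent\<close>

lemma sum_symgrp_conj:
  assumes x: "x \<in> symgrp n"
  shows "(\<Sum>g\<in>symgrp n. f (inv x \<circ> g \<circ> x)) = (\<Sum>g\<in>symgrp n. f g)"
proof -
  have "(\<Sum>g\<in>symgrp n. f (inv x \<circ> g \<circ> x)) = (\<Sum>g\<in>symgrp n. f (g \<circ> x))"
    by (rule sum_symgrp_comp_left[OF symgrp_group(2)[OF x], of "\<lambda>g. f (g \<circ> x)"])
  also have "\<dots> = (\<Sum>g\<in>symgrp n. f g)" by (rule sum_symgrp_comp_right[OF x])
  finally show ?thesis .
qed

context diagram begin

interpretation primitive_idempotent n idem by (rule primitive_idem)

text \<open>Right multiplication by \<open>idem\<close> projects the group algebra onto the left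
  ideal; following it by left multiplication by \<open>inv g\<close> and taking the trace over point
  functions gives this sum. It is therefore the character of the left ideal at \<open>inv g\<close>,
  and by \<open>char_inv\<close> also at g.\<close>

definition char :: "perm \<Rightarrow> complex" where
  "char g = (\<Sum>x\<in>symgrp n. idem (inv x \<circ> g \<circ> x))"

lemma sum_char_class:
  assumes f: "\<And>x g. x \<in> symgrp n \<Longrightarrow> g \<in> symgrp n \<Longrightarrow> f (inv x \<circ> g \<circ> x) = f g"
  shows "(\<Sum>g\<in>symgrp n. char g * f g) = fact n * (\<Sum>g\<in>symgrp n. idem g * f g)"
proof -
  have "(\<Sum>g\<in>symgrp n. char g * f g) = (\<Sum>x\<in>symgrp n. \<Sum>g\<in>symgrp n. idem (inv x \<circ> g \<circ> x) * f g)"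
    unfolding char_def sum_distrib_right by (rule sum.swap)
  also have "\<dots> = (\<Sum>x\<in>symgrp n. \<Sum>g\<in>symgrp n. idem g * f g)"
  proof (rule sum.cong[OF refl])
    fix x assume x: "x \<in> symgrp n"
    have "(\<Sum>g\<in>symgrp n. idem (inv x \<circ> g \<circ> x) * f g)
        = (\<Sum>g\<in>symgrp n. idem (inv x \<circ> g \<circ> x) * f (inv x \<circ> g \<circ> x))"
      by (rule sum.cong[OF refl]) (simp only: f[OF x])
    also have "\<dots> = (\<Sum>g\<in>symgrp n. idem g * f g)"
      by (rule sum_symgrp_conj[OF x, of "\<lambda>g. idem g * f g"])
    finally show "(\<Sum>g\<in>symgrp n. idem (inv x \<circ> g \<circ> x) * f g) = (\<Sum>g\<in>symgrp n. idem g * f g)" .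
  qed
  finally show ?thesis by (simp add: card_symgrp)
qed

lemma char_conj:
  assumes y: "y \<in> symgrp n"
  shows "char (inv y \<circ> g \<circ> y) = char g"
proof -
  have "char (inv y \<circ> g \<circ> y) = (\<Sum>x\<in>symgrp n. idem (inv (y \<circ> x) \<circ> g \<circ> (y \<circ> x)))"
    unfolding char_def by (rule sum.cong[OF refl]) (simp add: symgrp_inv_comp[OF y] comp_assoc)
  also have "\<dots> = char g"
    unfolding char_def by (rule sum_symgrp_comp_left[OF y, of "\<lambda>x. idem (inv x \<circ> g \<circ> x)"])
  finally show ?thesis .
qed

lemma casym_inv: "h \<in> symgrp n \<Longrightarrow> casym (inv h) = casym h"
  using grp_inv(2)[of h] grp_inv(2)[of "inv h"] symgrp_inverse(3)[of h n] csgn_inv[of h]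
  by (auto simp: casym_def)

lemma rsym_inv: "h \<in> symgrp n \<Longrightarrow> rsym (inv h) = rsym h"
  using grp_inv(1)[of h] grp_inv(1)[of "inv h"] symgrp_inverse(3)[of h n]
  by (auto simp: rsym_def)

text \<open>Inversion turns the coefficients of the product RC of the row and column sums into those
  of CR. Averaging over conjugates cannot tell RC from CR, just as a trace cannot.\<close>

lemma char_inv:
  assumes g: "g \<in> symgrp n"
  shows "char (inv g) = char g"
proof -
  have "ysym (inv h) = (\<Sum>q\<in>symgrp n. rsym q * casym (h \<circ> inv q))" if h: "h \<in> symgrp n" for h
  proof -
    have "ysym (inv h) = (\<Sum>q\<in>symgrp n. rsym (inv q) * casym (inv (inv q) \<circ> inv h))"
      unfolding ysym_def grpalg_mult_def by (rule sum_symgrp_inv[symmetric])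
    also have "\<dots> = (\<Sum>q\<in>symgrp n. rsym q * casym (h \<circ> inv q))"
    proof (rule sum.cong[OF refl])
      fix q assume q: "q \<in> symgrp n"
      have "inv (inv q) \<circ> inv h = inv (h \<circ> inv q)"
        using q h by (simp add: symgrp_inv_comp[OF h symgrp_group(2)[OF q]])
      then show "rsym (inv q) * casym (inv (inv q) \<circ> inv h) = rsym q * casym (h \<circ> inv q)"
        using q h by (simp only: rsym_inv casym_inv symgrp_group)
    qed
    finally show ?thesis .
  qed
  note ysym_inv = this
  have conj_in: "inv x \<circ> g \<circ> x \<in> symgrp n" if "x \<in> symgrp n" for x
    using that g by (simp add: symgrp_group)
  have "(\<Sum>x\<in>symgrp n. ysym (inv x \<circ> inv g \<circ> x)) = (\<Sum>x\<in>symgrp n. ysym (inv (inv x \<circ> g \<circ> x)))"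
  proof (rule sum.cong[OF refl])
    fix x assume x: "x \<in> symgrp n"
    have "inv (inv x \<circ> g \<circ> x) = inv x \<circ> inv g \<circ> x"
      using x g by (simp add: symgrp_inv_comp[of _ n] symgrp_group symgrp_inverse(3) comp_assoc)
    then show "ysym (inv x \<circ> inv g \<circ> x) = ysym (inv (inv x \<circ> g \<circ> x))" by simp
  qed
  also have "\<dots> = (\<Sum>x\<in>symgrp n. \<Sum>q\<in>symgrp n. rsym q * casym (inv x \<circ> g \<circ> x \<circ> inv q))"
    by (rule sum.cong[OF refl], rule ysym_inv, rule conj_in)
  also have "\<dots> = (\<Sum>q\<in>symgrp n. \<Sum>x\<in>symgrp n. rsym q * casym (inv x \<circ> g \<circ> x \<circ> inv q))"
    by (rule sum.swap)
  also have "\<dots> = (\<Sum>q\<in>symgrp n. \<Sum>x\<in>symgrp n. rsym q * casym (inv q \<circ> (inv x \<circ> g \<circ> x)))"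
  proof (rule sum.cong[OF refl])
    fix q assume q: "q \<in> symgrp n"
    have "(\<Sum>x\<in>symgrp n. rsym q * casym (inv x \<circ> g \<circ> x \<circ> inv q))
        = (\<Sum>x\<in>symgrp n. rsym q * casym (inv (x \<circ> q) \<circ> g \<circ> (x \<circ> q) \<circ> inv q))"
      by (rule sum_symgrp_comp_right[OF q, symmetric])
    also have "\<dots> = (\<Sum>x\<in>symgrp n. rsym q * casym (inv q \<circ> (inv x \<circ> g \<circ> x)))"
      by (rule sum.cong[OF refl])
        (simp add: symgrp_inv_comp[OF _ q] comp_assoc symgrp_inverse(2)[OF q])
    finally show "(\<Sum>x\<in>symgrp n. rsym q * casym (inv x \<circ> g \<circ> x \<circ> inv q))
        = (\<Sum>x\<in>symgrp n. rsym q * casym (inv q \<circ> (inv x \<circ> g \<circ> x)))" .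
  qed
  also have "\<dots> = (\<Sum>x\<in>symgrp n. \<Sum>q\<in>symgrp n. rsym q * casym (inv q \<circ> (inv x \<circ> g \<circ> x)))"
    by (rule sum.swap)
  also have "\<dots> = (\<Sum>x\<in>symgrp n. ysym (inv x \<circ> g \<circ> x))" by (simp add: ysym_def grpalg_mult_def)
  finally show ?thesis by (simp add: char_def idem_def cscale_def flip: sum_divide_distrib)
qed

text \<open>Write e for \<open>idem\<close> and eye = t(y)e. Comparing coefficients at y and summing
  over y turns the left side into the sum of t(y)e(y). Expanding the middle factor of eee = e in
  permutations shows that this sum is 1.\<close>

lemma sum_idem_char: "(\<Sum>g\<in>symgrp n. idem g * char (inv g)) = 1"
proof -
  have "\<exists>t. grpalg_mult n (grpalg_mult n idem (delta y)) idem = cscale t idem" if "y \<in> symgrp n" for y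
    using that delta_supported by (intro e_primitive) (auto simp: grpalg_eq_supported)
  then obtain t where t: "\<And>y. y \<in> symgrp n \<Longrightarrow> grpalg_mult n (grpalg_mult n idem (delta y)) idem = cscale (t y) idem"
    by metis
  have val: "(\<Sum>g\<in>symgrp n. idem g * idem (inv y \<circ> inv g \<circ> y)) = t y * idem y" if y: "y \<in> symgrp n" for y
  proof -
    have "t y * idem y = grpalg_mult n idem (grpalg_mult n (delta y) idem) y"
      using t[OF y] by (simp add: cscale_def grpalg_mult_assoc fun_eq_iff)
    then show ?thesis
      unfolding grpalg_mult_delta_left[OF y] by (simp add: grpalg_mult_def left_act_def comp_assoc)
  qed
  have "(\<Sum>g\<in>symgrp n. idem g * char (inv g))
      = (\<Sum>y\<in>symgrp n. \<Sum>g\<in>symgrp n. idem g * idem (inv y \<circ> inv g \<circ> y))"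
    unfolding char_def sum_distrib_left by (rule sum.swap)
  also have "\<dots> = (\<Sum>y\<in>symgrp n. t y * idem y)" by (rule sum.cong[OF refl]) (rule val)
  finally have S: "(\<Sum>g\<in>symgrp n. idem g * char (inv g)) = (\<Sum>y\<in>symgrp n. t y * idem y)" .
  define L where "L x = grpalg_mult n (grpalg_mult n idem x) idem" for x
  have "Vector_Spaces.linear cscale cscale L"
    by (rule linear_cscaleI) (simp_all add: L_def grpalg_mult_left grpalg_mult_right)
  then interpret L: Vector_Spaces.linear cscale cscale L .
  have "idem = L idem" by (simp add: L_def e_idem)
  also have "\<dots> = L (\<Sum>y\<in>symgrp n. cscale (idem y) (delta y))"
    using supported_expand[OF finite_symgrp, of idem n] e_in by (simp add: grpalg_eq_supported)
  also have "\<dots> = (\<Sum>y\<in>symgrp n. cscale (idem y) (cscale (t y) idem))"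
    unfolding L.sum L.scale by (rule sum.cong[OF refl]) (simp add: L_def t)
  finally have "idem id = (\<Sum>y\<in>symgrp n. cscale (idem y) (cscale (t y) idem)) id" by (rule fun_cong)
  also have "\<dots> = (\<Sum>y\<in>symgrp n. t y * idem y) * idem id"
    by (simp add: sum_fun_apply cscale_def sum_distrib_left sum_distrib_right mult_ac)
  finally have "(\<Sum>y\<in>symgrp n. t y * idem y) = 1"
    using hook_nonzero by (simp add: idem_def cscale_def ysym_id)
  then show ?thesis using S by simp
qed

lemma sum_char_square: "(\<Sum>g\<in>symgrp n. char g * char g) = fact n"
proof -
  have "(\<Sum>g\<in>symgrp n. idem g * char g) = (\<Sum>g\<in>symgrp n. idem g * char (inv g))"
    by (rule sum.cong[OF refl]) (simp add: char_inv)
  then show ?thesis by (simp add: sum_char_class char_conj sum_idem_char)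
qed

text \<open>The scalar products here carry no complex conjugation; realness lets the one of
  \<open>char\<close> minus \<open>det_char\<close> with itself be read as a squared norm.\<close>

lemma char_real: "char g \<in> \<real>"
proof -
  have y: "ysym h \<in> \<real>" for h
    unfolding ysym_def grpalg_mult_def rsym_def casym_def csgn_def by (intro sum_in_Reals) auto
  have "hook \<in> \<real>" unfolding hook_def grpalg_mult_def by (intro sum_in_Reals Reals_mult y)
  then show ?thesis unfolding char_def idem_def cscale_def
    by (intro sum_in_Reals Reals_mult Reals_divide y) auto
qed

text \<open>The share of a single word in the scalar product of \<open>idem\<close> with a
  permutation character.\<close>

definition stab_sum :: "(nat \<Rightarrow> 'a) \<Rightarrow> complex" where
  "stab_sum w = (\<Sum>g\<in>symgrp n. if w \<circ> g = w then idem g else 0)"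

lemma idem_comp: "p \<in> colgrp \<Longrightarrow> idem (g \<circ> p) = csgn p * idem g"
  using bisym_ysym by (simp add: bisym_def idem_def cscale_def)

text \<open>The transposition of two equal letters in a column fixes w. Multiplying by it on the
  right permutes the stabiliser and changes the sign of \<open>idem\<close>, so the sum is its own
  negative.\<close>

lemma stab_sum_zero:
  assumes "col_repeats w"
  shows "stab_sum w = 0"
proof -
  obtain t where t: "t \<in> colgrp" "csgn t = - 1" "w \<circ> t = w"
    using assms by (rule repeats_transposition)
  have tG: "t \<in> symgrp n" by (rule grp_symgrp(2)[OF t(1)])
  have "w \<circ> (g \<circ> t) = w \<longleftrightarrow> w \<circ> g = w" for g
  proof
    assume "w \<circ> (g \<circ> t) = w"
    then have "w \<circ> g \<circ> t \<circ> inv t = w \<circ> t \<circ> inv t" by (simp add: comp_assoc t(3))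
    then show "w \<circ> g = w" by (simp add: comp_assoc symgrp_inverse(2)[OF tG])
  next
    assume "w \<circ> g = w"
    then have "w \<circ> g \<circ> t = w \<circ> t" by simp
    then show "w \<circ> (g \<circ> t) = w" by (simp add: comp_assoc t(3))
  qed
  then have "stab_sum w = (\<Sum>g\<in>symgrp n. if w \<circ> (g \<circ> t) = w then - idem (g \<circ> t) else 0)"
    unfolding stab_sum_def by (intro sum.cong refl) (simp add: idem_comp[OF t(1)] t(2))
  also have "\<dots> = (\<Sum>g\<in>symgrp n. if w \<circ> g = w then - idem g else 0)"
    by (rule sum_symgrp_comp_right[OF tG, of "\<lambda>g. if w \<circ> g = w then - idem g else 0"])
  also have "\<dots> = - stab_sum w"
    unfolding stab_sum_def sum_negf[symmetric] by (intro sum.cong) auto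
  finally show ?thesis by simp
qed

lemma sum_idem_perm_char:
  assumes "finite A"
  shows "(\<Sum>g\<in>symgrp n. idem g * of_int (perm_char n A c g)) = (\<Sum>w\<in>words n A c. stab_sum w)"
proof -
  have "idem g * of_int (perm_char n A c g) = (\<Sum>w\<in>words n A c. if w \<circ> g = w then idem g else 0)"
    if g: "g \<in> symgrp n" for g
  proof -
    have "{w \<in> words n A c. \<forall>i\<in>{1..n}. w (g i) = w i} = {w\<in>words n A c. w \<circ> g = w}"
      by (intro Collect_cong conj_cong refl fixed_word_iff g)
    then show ?thesis
      by (simp add: perm_char_def sum.If_cases finite_words[OF assms] Int_def mult.commute)
  qed
  then have "(\<Sum>g\<in>symgrp n. idem g * of_int (perm_char n A c g))
      = (\<Sum>g\<in>symgrp n. \<Sum>w\<in>words n A c. if w \<circ> g = w then idem g else 0)"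
    by (intro sum.cong refl)
  also have "\<dots> = (\<Sum>w\<in>words n A c. stab_sum w)" unfolding stab_sum_def by (rule sum.swap)
  finally show ?thesis .
qed

text \<open>The stabiliser of row \<circ> p is the row group conjugated by p, and the p on the right
  leaves \<open>idem\<close> as a sign. With \<open>rsym\<close> and \<open>casym\<close> as
  weights, the sum over all p becomes a convolution in \<open>sum_stab_sum\<close>.\<close>

lemma stab_sum_row:
  assumes p: "p \<in> colgrp" and w: "w = restrict (row \<circ> p) {1..n}"
  shows "stab_sum w = (\<Sum>r\<in>symgrp n. rsym r * (casym p * idem (inv p \<circ> r)))"
proof -
  have pG: "p \<in> symgrp n" by (rule grp_symgrp(2)[OF p])
  have "w \<circ> (inv p \<circ> r \<circ> p) = w \<longleftrightarrow> r \<in> rowgrp" if r: "r \<in> symgrp n" for r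
  proof -
    have in_n: "inv p (r (p v)) \<in> {1..n} \<longleftrightarrow> v \<in> {1..n}" for v
      using symgrp_group(3)[OF symgrp_group(3)[OF symgrp_group(2)[OF pG] r] pG]
        permutes_in_image[of "inv p \<circ> r \<circ> p" "{1..n}" v] by (simp add: symgrp_def)
    have "w \<circ> (inv p \<circ> r \<circ> p) = w \<longleftrightarrow> (\<forall>v\<in>{1..n}. row (r (p v)) = row (p v))"
      using in_n by (auto simp: w fun_eq_iff symgrp_inverse(5)[OF pG] simp del: One_nat_def atLeastAtMost_iff)
    also have "\<dots> \<longleftrightarrow> (\<forall>v\<in>{1..n}. row (r v) = row v)"
    proof
      assume a: "\<forall>v\<in>{1..n}. row (r (p v)) = row (p v)"
      show "\<forall>v\<in>{1..n}. row (r v) = row v"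
      proof
        fix v assume "v \<in> {1..n}"
        then have "inv p v \<in> {1..n}" by (rule symgrp_mem[OF symgrp_group(2)[OF pG]])
        from a[rule_format, OF this] show "row (r v) = row v" by (simp add: symgrp_inverse(5)[OF pG])
      qed
    next
      assume a: "\<forall>v\<in>{1..n}. row (r v) = row v"
      show "\<forall>v\<in>{1..n}. row (r (p v)) = row (p v)"
        using a symgrp_mem[OF pG] by blast
    qed
    finally show ?thesis using r by (simp add: rowgrp_def)
  qed
  note stab = this
  have "stab_sum w = (\<Sum>r\<in>symgrp n. if w \<circ> (inv p \<circ> r \<circ> p) = w then idem (inv p \<circ> r \<circ> p) else 0)"
    unfolding stab_sum_def by (rule sum_symgrp_conj[OF pG, symmetric])
  also have "\<dots> = (\<Sum>r\<in>symgrp n. rsym r * (casym p * idem (inv p \<circ> r)))"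
    by (rule sum.cong[OF refl]) (simp add: stab idem_comp[OF p] rsym_def casym_def p)
  finally show ?thesis .
qed

text \<open>The words without column repeats are the row \<circ> p for p in the column group, each
  arising once. Their sums from \<open>stab_sum_row\<close> add up to the coefficient of the
  identity in R C \<open>idem\<close> = \<open>ysym\<close> \<open>idem\<close> =
  \<open>ysym\<close>, which is 1.\<close>

lemma sum_stab_sum:
  assumes A: "finite A" "\<And>r. part r > 0 \<Longrightarrow> r \<in> A" and c: "\<And>r. r \<in> A \<Longrightarrow> c r = int (part r)"
  shows "(\<Sum>w\<in>words n A c. stab_sum w) = 1"
proof -
  let ?w = "\<lambda>p. restrict (row \<circ> p) {1..n}"
  have "(\<Sum>w\<in>words n A c. stab_sum w) = (\<Sum>w\<in>{w\<in>words n A c. \<not> col_repeats w}. stab_sum w)"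
    by (rule sum.mono_neutral_right) (auto simp: finite_words A stab_sum_zero)
  also have "\<dots> = (\<Sum>p\<in>colgrp. stab_sum (?w p))"
  proof (rule sum.reindex_bij_betw[symmetric])
    show "bij_betw ?w colgrp {w\<in>words n A c. \<not> col_repeats w}"
      unfolding bij_betw_def
    proof
      show "inj_on ?w colgrp"
      proof (rule inj_onI, rule ext)
        fix p q v assume pq: "p \<in> colgrp" "q \<in> colgrp" "?w p = ?w q"
        show "p v = q v"
        proof (cases "v \<in> {1..n}")
          case True
          have "row (p v) = row (q v)" using fun_cong[OF pq(3), of v] True by simp
          moreover have "col (p v) = col (q v)" using pq(1,2) True by (simp add: colgrp_def)
          ultimately show ?thesis
            by (rule box_eq[OF symgrp_mem[OF grp_symgrp(2)[OF pq(1)] True]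
                symgrp_mem[OF grp_symgrp(2)[OF pq(2)] True]])
        next
          case False
          then show ?thesis using pq(1,2) by (auto simp: colgrp_def symgrp_def permutes_not_in)
        qed
      qed
      show "?w ` colgrp = {w\<in>words n A c. \<not> col_repeats w}"
      proof (intro equalityI image_subsetI subsetI)
        fix p assume p: "p \<in> colgrp"
        have pG: "p \<in> symgrp n" by (rule grp_symgrp(2)[OF p])
        have row0: "restrict row {1..n} \<in> words n A c"
        proof -
          have content: "int (card {i\<in>{1..n}. restrict row {1..n} i = a}) = c a" if "a \<in> A" for a
          proof -
            have "{i\<in>{1..n}. restrict row {1..n} i = a} = {v\<in>{1..n}. row v = a}" by auto
            then show ?thesis by (simp only: card_row c[OF that])
          qed
          have "row v \<in> A" if "v \<in> {1..n}" for v
            using A(2)[of "row v"] col_less[OF that] by simp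
          then have "restrict row {1..n} \<in> {1..n} \<rightarrow>\<^sub>E A" by auto
          then show ?thesis unfolding words_def mem_Collect_eq using content by blast
        qed
        have "restrict row {1..n} \<circ> p = ?w p"
          using permutes_in_image[of p "{1..n}"] pG by (auto simp: fun_eq_iff symgrp_def)
        then have "?w p \<in> words n A c" using words_comp[OF row0 pG] by simp
        moreover have "\<not> col_repeats (?w p)"
        proof
          assume "col_repeats (?w p)"
          then obtain u v where uv: "u \<in> {1..n}" "v \<in> {1..n}" "u \<noteq> v" "col u = col v" "row (p u) = row (p v)"
            unfolding col_repeats_def by auto
          have "col (p u) = col (p v)" using p uv(1,2,4) by (simp add: colgrp_def)
          then have "p u = p v"
            by (rule box_eq[OF symgrp_mem[OF pG uv(1)] symgrp_mem[OF pG uv(2)] uv(5)])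
          then show False using uv(3) symgrp_inverse(4)[OF pG] by metis
        qed
        ultimately show "?w p \<in> {w\<in>words n A c. \<not> col_repeats w}" by simp
      next
        fix w assume w: "w \<in> {w\<in>words n A c. \<not> col_repeats w}"
        have "card {v\<in>{1..n}. w v = r} = part r" for r
        proof (cases "r \<in> A")
          case True
          then have "int (card {v\<in>{1..n}. w v = r}) = c r" using w by (simp add: words_def)
          then show ?thesis using c[OF True] by simp
        next
          case False
          then have "{v\<in>{1..n}. w v = r} = {}" using w by (auto simp: words_def)
          then show ?thesis using A(2)[of r] False by (simp only: card.empty) auto
        qed
        moreover have "\<not> col_repeats w" using w by simp
        ultimately obtain p where p: "p \<in> colgrp" "\<forall>v\<in>{1..n}. w v = row (p v)"
          using straighten by blast
        have "w = ?w p" using p(2) w by (auto simp: words_def fun_eq_iff PiE_iff extensional_def)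
        then show "w \<in> ?w ` colgrp" using p(1) by blast
      qed
    qed
  qed
  also have "\<dots> = (\<Sum>p\<in>colgrp. \<Sum>r\<in>symgrp n. rsym r * (casym p * idem (inv p \<circ> r)))"
    by (rule sum.cong[OF refl], rule stab_sum_row) auto
  also have "\<dots> = (\<Sum>p\<in>symgrp n. \<Sum>r\<in>symgrp n. rsym r * (casym p * idem (inv p \<circ> r)))"
    by (rule sum.mono_neutral_left) (auto simp: finite_symgrp grp_symgrp casym_def)
  also have "\<dots> = (\<Sum>r\<in>symgrp n. \<Sum>p\<in>symgrp n. rsym r * (casym p * idem (inv p \<circ> r)))"
    by (rule sum.swap)
  also have "\<dots> = (\<Sum>r\<in>symgrp n. rsym r * grpalg_mult n casym idem r)"
    by (simp add: grpalg_mult_def sum_distrib_left)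
  also have "\<dots> = (\<Sum>r\<in>symgrp n. rsym (inv r) * grpalg_mult n casym idem (inv r))"
    by (rule sum_symgrp_inv[symmetric])
  also have "\<dots> = (\<Sum>r\<in>symgrp n. rsym r * grpalg_mult n casym idem (inv r \<circ> id))"
    by (rule sum.cong[OF refl]) (simp add: rsym_inv)
  also have "\<dots> = grpalg_mult n ysym idem id"
    unfolding ysym_def grpalg_mult_assoc by (simp only: grpalg_mult_def[of n rsym])
  also have "\<dots> = 1"
    using hook_nonzero by (simp add: idem_def grpalg_mult_right ysym_square ysym_id)
  finally show ?thesis .
qed

text \<open>A content that exceeds the shape in the first s parts violates \<open>dominance\<close>,
  so every word has a repeated letter in some column and all stabiliser sums vanish.\<close>

lemma sum_idem_perm_char_dominant:
  assumes A: "finite A" and s: "{..<s} \<subseteq> A" "(\<Sum>r<s. c r) > (\<Sum>r<s. int (part r))"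
  shows "(\<Sum>g\<in>symgrp n. idem g * of_int (perm_char n A c g)) = 0"
  unfolding sum_idem_perm_char[OF A]
proof (rule sum.neutral, rule ballI, rule stab_sum_zero, rule ccontr)
  fix w assume w: "w \<in> words n A c" "\<not> col_repeats w"
  have "(\<Sum>r<s. c r) = (\<Sum>r<s. int (card {v\<in>{1..n}. w v = r}))"
    using w(1) s(1) by (intro sum.cong) (auto simp: words_def)
  also have "\<dots> = int (card {v\<in>{1..n}. w v < s})" by (simp only: card_less_sum of_nat_sum)
  also have "\<dots> \<le> int (card {v\<in>{1..n}. row v < s})" using dominance[OF w(2)] by simp
  also have "\<dots> = (\<Sum>r<s. int (part r))" by (simp only: card_less_sum card_row of_nat_sum)
  finally show False using s(2) by simp
qed

end

lemma perm_char_conj: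
  assumes A: "finite A" and x: "x \<in> symgrp n" and g: "g \<in> symgrp n"
  shows "perm_char n A c (inv x \<circ> g \<circ> x) = perm_char n A c g"
proof -
  have conj_in: "inv x \<circ> g \<circ> x \<in> symgrp n" using x g by (simp add: symgrp_group)
  have alt: "perm_char n A c h = int (card {w \<in> words n A c. w \<circ> h = w})" if "h \<in> symgrp n" for h
    unfolding perm_char_def by (intro arg_cong[of _ _ int] arg_cong[of _ _ card] Collect_cong conj_cong refl fixed_word_iff that)
  have 1: "w \<circ> inv x \<circ> g = w \<circ> inv x" if "w \<circ> (inv x \<circ> g \<circ> x) = w" for w :: "nat \<Rightarrow> 'a"
  proof -
    have "w \<circ> (inv x \<circ> g \<circ> x) \<circ> inv x = w \<circ> inv x \<circ> g"
      by (simp add: comp_assoc symgrp_inverse(2)[OF x])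
    then show ?thesis using that by simp
  qed
  have 2: "w \<circ> x \<circ> (inv x \<circ> g \<circ> x) = w \<circ> x" if "w \<circ> g = w" for w :: "nat \<Rightarrow> 'a"
  proof -
    have "w \<circ> x \<circ> (inv x \<circ> g \<circ> x) = w \<circ> g \<circ> x"
      by (simp add: comp_assoc symgrp_inverse(7)[OF x])
    then show ?thesis using that by simp
  qed
  have "bij_betw (\<lambda>w. w \<circ> inv x) {w \<in> words n A c. w \<circ> (inv x \<circ> g \<circ> x) = w} {w \<in> words n A c. w \<circ> g = w}"
  proof (rule bij_betw_byWitness[of _ "\<lambda>w. w \<circ> x"])
    show "\<forall>w\<in>{w \<in> words n A c. w \<circ> (inv x \<circ> g \<circ> x) = w}. w \<circ> inv x \<circ> x = w"
      "\<forall>w\<in>{w \<in> words n A c. w \<circ> g = w}. w \<circ> x \<circ> inv x = w"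
      by (simp_all add: comp_assoc symgrp_inverse(1,2)[OF x])
    show "(\<lambda>w. w \<circ> inv x) ` {w \<in> words n A c. w \<circ> (inv x \<circ> g \<circ> x) = w} \<subseteq> {w \<in> words n A c. w \<circ> g = w}"
      using 1 words_comp[OF _ symgrp_group(2)[OF x]] by blast
    show "(\<lambda>w. w \<circ> x) ` {w \<in> words n A c. w \<circ> g = w} \<subseteq> {w \<in> words n A c. w \<circ> (inv x \<circ> g \<circ> x) = w}"
      using 2 words_comp[OF _ x] by blast
  qed
  then show ?thesis by (simp only: alt[OF g] alt[OF conj_in] bij_betw_same_card)
qed

lemma det_char_conj:
  "x \<in> symgrp n \<Longrightarrow> g \<in> symgrp n \<Longrightarrow> det_char n a b c (inv x \<circ> g \<circ> x) = det_char n a b c g"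
  by (simp only: det_char_def perm_char_conj finite.intros)

context diagram begin

theorem char_eq_det_char:
  assumes part: "\<And>r. r \<ge> 3 \<Longrightarrow> part r = 0" and g: "g \<in> symgrp n"
  shows "char g = of_int (det_char n (int (part 0)) (int (part 1)) (int (part 2)) g)"
proof -
  let ?a = "int (part 0)" and ?b = "int (part 1)" and ?c = "int (part 2)"
  let ?det_char = "det_char n ?a ?b ?c"
  have le: "?a \<ge> ?b" "?b \<ge> ?c" using part_anti[of 0 1] part_anti[of 1 2] by simp_all
  have lt3: "(\<Sum>r<3. f r) = f 0 + f 1 + f 2" "(\<Sum>r<1. f r) = f 0" "(\<Sum>r<2. f r) = f 0 + f 1" for f :: "nat \<Rightarrow> int"
    by (simp_all add: eval_nat_numeral)
  have row3: "row v < 3" if "v \<in> {1..n}" for v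
    using part[of "row v"] col_less[OF that] by (cases "row v < 3") auto
  have "{v\<in>{1..n}. row v < 3} = {1..n}" using row3 by auto
  then have "int n = int (card {v\<in>{1..n}. row v < 3})" by (simp only: card_atLeastAtMost diff_Suc_1)
  also have "\<dots> = (\<Sum>r<3. int (part r))" by (simp only: card_less_sum card_row of_nat_sum)
  finally have n: "?a + ?b + ?c = int n" by (simp only: lt3)
  have dom: "(\<Sum>g\<in>symgrp n. idem g * of_int (perm_char n {0, 1, 2} (vec3 p q s) g)) = 0"
    if "p > ?a \<or> p + q > ?a + ?b" for p q s
    using that
  proof
    assume "p > ?a"
    then show ?thesis by (intro sum_idem_perm_char_dominant[of _ 1]) (auto simp: vec3_def)
  next
    assume "p + q > ?a + ?b"
    then show ?thesis
      by (intro sum_idem_perm_char_dominant[of _ 2]) (simp_all only: lt3, auto simp: vec3_def)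
  qed
  have main: "(\<Sum>g\<in>symgrp n. idem g * of_int (perm_char n {0, 1, 2} (vec3 ?a ?b ?c) g)) = 1"
    unfolding sum_idem_perm_char[of "{0, 1, 2}", simplified]
  proof (rule sum_stab_sum)
    show "r \<in> {0, 1, 2}" if "part r > 0" for r
      using that part[of r] by (cases "r \<ge> 3") auto
  qed (auto simp: vec3_def)
  \<comment> \<open>Every term of the determinant but the first has a larger first entry or a larger
    sum of the first two entries than the shape, so \<open>dom\<close> removes it.\<close>
  have "(\<Sum>g\<in>symgrp n. idem g * of_int (?det_char g)) = 1"
    using main dom[of "?a + 1" "?b - 1" ?c] dom[of ?a "?b + 1" "?c - 1"] dom[of "?a + 1" "?b + 1" "?c - 2"]
      dom[of "?a + 2" "?b - 1" "?c - 1"] dom[of "?a + 2" ?b "?c - 2"]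
    by (simp add: det_char_def distrib_left right_diff_distrib sum.distrib sum_subtractf)
  then have cp: "(\<Sum>g\<in>symgrp n. char g * of_int (?det_char g)) = fact n"
    by (subst sum_char_class) (simp_all add: det_char_conj)
  have "(\<Sum>g\<in>symgrp n. ?det_char g * ?det_char g) = fact n" by (rule sum_det_char_det_char) (use le n in auto)
  then have pp: "(\<Sum>g\<in>symgrp n. of_int (?det_char g) * of_int (?det_char g)) = (fact n :: complex)"
    by (metis (no_types, lifting) of_int_fact of_int_mult of_int_sum sum.cong)
  define d where "d g = Re (char g) - real_of_int (?det_char g)" for g
  have d: "of_real (d g) = char g - of_int (?det_char g)" for g
    using char_real[of g] by (simp add: d_def complex_is_Real_iff complex_eq_iff)
  \<comment> \<open>The squared norm of the difference expands to n! - 2 n! + n! = 0.\<close>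
  have "complex_of_real (\<Sum>g\<in>symgrp n. d g * d g)
      = (\<Sum>g\<in>symgrp n. char g * char g - 2 * (char g * of_int (?det_char g)) + of_int (?det_char g) * of_int (?det_char g))"
    unfolding of_real_sum of_real_mult d by (rule sum.cong[OF refl]) (simp add: algebra_simps)
  also have "\<dots> = 0"
    unfolding sum.distrib sum_subtractf sum_distrib_left[symmetric] by (simp only: sum_char_square cp pp) simp
  finally have "(\<Sum>g\<in>symgrp n. d g * d g) = 0" by (simp only: of_real_eq_0_iff)
  then have "\<forall>g\<in>symgrp n. d g * d g = 0"
    by (subst (asm) sum_nonneg_eq_0_iff) (auto simp: finite_symgrp)
  then show ?thesis using g d[of g] by simp
qed

end

section \<open>The row-by-row numbering of a partition\<close>

definition lpart :: "nat list \<Rightarrow> nat \<Rightarrow> nat" where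
  "lpart lam r = (if r < length lam then lam ! r else 0)"

definition tab_pos :: "nat list \<Rightarrow> nat \<Rightarrow> nat \<times> nat" where
  "tab_pos lam = inv_into {(r, c). c < lpart lam r} (\<lambda>(r, c). tab_entry lam r c)"

text \<open>The rows fill successive blocks of numbers, which gives injectivity; surjectivity
  follows by comparing cardinalities.\<close>

lemma bij_tab_entry:
  "bij_betw (\<lambda>(r, c). tab_entry lam r c) {(r, c). c < lpart lam r} {1..sum_list lam}"
proof -
  let ?D = "{(r, c). c < lpart lam r}"
  have D: "?D = (SIGMA r:{..<length lam}. {..<lam ! r})" by (auto simp: lpart_def split: if_splits)
  have step: "sum_list (take r lam) + lam ! r \<le> sum_list (take s lam)" if "r < s" "r < length lam" for r s
  proof -
    have "sum_list (take (Suc r) lam) \<le> sum_list (take s lam)"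
    proof -
      have "take s lam = take (Suc r) lam @ take (s - Suc r) (drop (Suc r) lam)"
        using that(1) by (metis Suc_leI le_add_diff_inverse take_add)
      then show ?thesis by simp
    qed
    then show ?thesis using that(2) by (simp add: take_Suc_conv_app_nth)
  qed
  have lt: "tab_entry lam r c < tab_entry lam s d" if "r < s" "r < length lam" "c < lam ! r" for r s c d
    using step[OF that(1,2)] that(3) by (simp add: tab_entry_def)
  have inj: "inj_on (\<lambda>(r, c). tab_entry lam r c) ?D"
  proof (rule inj_onI, clarify)
    fix r c s d assume *: "c < lpart lam r" "d < lpart lam s" "tab_entry lam r c = tab_entry lam s d"
    then have "r < length lam" "c < lam ! r" "s < length lam" "d < lam ! s"
      by (auto simp: lpart_def split: if_splits)
    then have "r = s" using lt[of r s c d] lt[of s r d c] *(3) by (metis less_irrefl linorder_neqE_nat)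
    then show "r = s \<and> c = d" using *(3) by (simp add: tab_entry_def)
  qed
  have sub: "(\<lambda>(r, c). tab_entry lam r c) ` ?D \<subseteq> {1..sum_list lam}"
  proof clarify
    fix r c assume "c < lpart lam r"
    then have "r < length lam" "c < lam ! r" by (auto simp: lpart_def split: if_splits)
    then show "tab_entry lam r c \<in> {1..sum_list lam}"
      using step[of r "length lam"] by (simp add: tab_entry_def)
  qed
  have "card ((\<lambda>(r, c). tab_entry lam r c) ` ?D) = card ?D" by (rule card_image[OF inj])
  also have "\<dots> = sum_list lam" unfolding D by (simp add: sum_list_sum_nth atLeast0LessThan)
  finally have "(\<lambda>(r, c). tab_entry lam r c) ` ?D = {1..sum_list lam}"
    by (intro card_subset_eq sub) simp_all
  then show ?thesis using inj by (simp add: bij_betw_def)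
qed

lemma bij_tab_pos: "bij_betw (tab_pos lam) {1..sum_list lam} {(r, c). c < lpart lam r}"
  unfolding tab_pos_def by (rule bij_betw_inv_into[OF bij_tab_entry])

lemma tab_pos_entry: "c < lpart lam r \<Longrightarrow> tab_pos lam (tab_entry lam r c) = (r, c)"
  using bij_betw_inv_into_left[OF bij_tab_entry, of "(r, c)" lam] by (simp add: tab_pos_def)

lemma tab_entry_pos: "v \<in> {1..sum_list lam} \<Longrightarrow> tab_entry lam (fst (tab_pos lam v)) (snd (tab_pos lam v)) = v"
  using bij_betw_inv_into_right[OF bij_tab_entry, of v lam] by (simp add: tab_pos_def case_prod_unfold)

lemma tab_entry_in: "c < lpart lam r \<Longrightarrow> tab_entry lam r c \<in> {1..sum_list lam}"
  using bij_betwE[OF bij_tab_entry, of lam] by fastforce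

lemma tab_pos_in: "v \<in> {1..sum_list lam} \<Longrightarrow> snd (tab_pos lam v) < lpart lam (fst (tab_pos lam v))"
  using bij_betwE[OF bij_tab_pos, of lam] by fastforce

lemma tab_row_eq: "tab_row lam r = {v\<in>{1..sum_list lam}. fst (tab_pos lam v) = r}"
proof (intro equalityI subsetI)
  fix v assume "v \<in> tab_row lam r"
  then obtain c where c: "v = tab_entry lam r c" "c < lpart lam r"
    by (auto simp: tab_row_def lpart_def)
  then show "v \<in> {v\<in>{1..sum_list lam}. fst (tab_pos lam v) = r}"
    using tab_entry_in[OF c(2)] tab_pos_entry[OF c(2)] by simp
next
  fix v assume v: "v \<in> {v\<in>{1..sum_list lam}. fst (tab_pos lam v) = r}"
  then have "v = tab_entry lam r (snd (tab_pos lam v))" "snd (tab_pos lam v) < lpart lam r"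
    using tab_entry_pos[of v lam] tab_pos_in[of v lam] by auto
  then show "v \<in> tab_row lam r"
    unfolding tab_row_def lpart_def by (auto split: if_splits)
qed

lemma tab_col_eq: "tab_col lam c = {v\<in>{1..sum_list lam}. snd (tab_pos lam v) = c}"
proof (intro equalityI subsetI)
  fix v assume "v \<in> tab_col lam c"
  then obtain r where r: "v = tab_entry lam r c" "c < lpart lam r"
    by (auto simp: tab_col_def lpart_def)
  then show "v \<in> {v\<in>{1..sum_list lam}. snd (tab_pos lam v) = c}"
    using tab_entry_in[OF r(2)] tab_pos_entry[OF r(2)] by simp
next
  fix v assume v: "v \<in> {v\<in>{1..sum_list lam}. snd (tab_pos lam v) = c}"
  then have "v = tab_entry lam (fst (tab_pos lam v)) c" "c < lpart lam (fst (tab_pos lam v))"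
    using tab_entry_pos[of v lam] tab_pos_in[of v lam] by auto
  then show "v \<in> tab_col lam c"
    unfolding tab_col_def lpart_def by (auto split: if_splits)
qed

text \<open>Translates the row and column groups, given by images of rows and columns, into
  conditions on the coordinates of boxes. A permutation that maps a finite fibre into itself maps it
  onto itself.\<close>

lemma fibres_preserved_iff:
  fixes f :: "nat \<Rightarrow> nat"
  assumes p: "p \<in> symgrp n"
  shows "(\<forall>r. p ` {v\<in>{1..n}. f v = r} = {v\<in>{1..n}. f v = r}) \<longleftrightarrow> (\<forall>v\<in>{1..n}. f (p v) = f v)"
proof
  assume "\<forall>r. p ` {v\<in>{1..n}. f v = r} = {v\<in>{1..n}. f v = r}"
  then show "\<forall>v\<in>{1..n}. f (p v) = f v" by blast
next
  assume f: "\<forall>v\<in>{1..n}. f (p v) = f v"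
  have p': "p permutes {1..n}" using p by (simp add: symgrp_def)
  show "\<forall>r. p ` {v\<in>{1..n}. f v = r} = {v\<in>{1..n}. f v = r}"
  proof
    fix r
    show "p ` {v\<in>{1..n}. f v = r} = {v\<in>{1..n}. f v = r}"
    proof (rule endo_inj_surj)
      show "p ` {v\<in>{1..n}. f v = r} \<subseteq> {v\<in>{1..n}. f v = r}"
        using f permutes_in_image[OF p'] by blast
      show "inj_on p {v\<in>{1..n}. f v = r}" using permutes_inj[OF p'] by (rule inj_on_subset) simp
    qed simp
  qed
qed

lemma diagram_partition:
  assumes "sorted_wrt (\<ge>) lam"
  shows "diagram (sum_list lam) (\<lambda>v. fst (tab_pos lam v)) (\<lambda>v. snd (tab_pos lam v)) (lpart lam)"
proof
  show "bij_betw (\<lambda>v. (fst (tab_pos lam v), snd (tab_pos lam v))) {1..sum_list lam} {(r, c). c < lpart lam r}"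
    using bij_tab_pos[of lam] by simp
  show "lpart lam s \<le> lpart lam r" if "r \<le> s" for r s
    using that assms by (cases "r = s") (auto simp: lpart_def sorted_wrt_iff_nth_less)
qed

section \<open>Kronecker coefficients\<close>

locale idempotent_pair =
  fixes n :: nat and e1 e2 :: "perm \<Rightarrow> complex"
  assumes e1: "primitive_idempotent n e1" and e2: "primitive_idempotent n e2"
begin

interpretation E1: primitive_idempotent n e1 by (rule e1)
interpretation E2: primitive_idempotent n e2 by (rule e2)
interpretation diag: symrep n diag_act by (rule symrep_diag_act)

definition tensor_module :: "(perm \<times> perm \<Rightarrow> complex) set" where
  "tensor_module = tensor_space (left_ideal n e1) (left_ideal n e2)"

definition perm_pairs :: "(perm \<times> perm) set" where "perm_pairs = symgrp n \<times> symgrp n"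

text \<open>Right multiplication by the tensor product of \<open>e1\<close> and \<open>e2\<close> in
  the group algebra of the product group. It projects onto the tensor module and, acting from the
  right, commutes with the diagonal action.\<close>

definition right_proj :: "(perm \<times> perm \<Rightarrow> complex) \<Rightarrow> perm \<times> perm \<Rightarrow> complex" where
  "right_proj F = (\<Sum>pq\<in>perm_pairs. cscale (F pq) (tensor (left_act (fst pq) e1) (left_act (snd pq) e2)))"

lemma finite_perm_pairs: "finite perm_pairs"
  by (simp add: perm_pairs_def finite_symgrp)

lemma right_proj_linear: "Vector_Spaces.linear cscale cscale right_proj"
  by (rule linear_cscaleI)
    (simp_all add: right_proj_def fun_eq_iff sum_fun_apply cscale_def distrib_right sum.distrib sum_distrib_left mult.assoc)

lemma right_proj_apply: "right_proj F (x, y) = (\<Sum>p\<in>symgrp n. \<Sum>q\<in>symgrp n. F (p, q) * (e1 (inv p \<circ> x) * e2 (inv q \<circ> y)))"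
  by (simp add: right_proj_def perm_pairs_def sum_fun_apply cscale_def tensor_def left_act_def sum.cartesian_product case_prod_unfold)

lemma right_proj_tensor: "right_proj (tensor v w) = tensor (grpalg_mult n v e1) (grpalg_mult n w e2)"
proof (rule ext, clarify)
  fix x y
  show "right_proj (tensor v w) (x, y) = tensor (grpalg_mult n v e1) (grpalg_mult n w e2) (x, y)"
    by (simp add: right_proj_apply tensor_def grpalg_mult_def sum_product mult_ac)
qed

lemma right_proj_diag_act:
  assumes g: "g \<in> symgrp n"
  shows "right_proj (diag_act g F) = diag_act g (right_proj F)"
proof (rule ext, clarify)
  fix x y
  let ?f = "\<lambda>p q. F (p, q) * (e1 (inv p \<circ> (inv g \<circ> x)) * e2 (inv q \<circ> (inv g \<circ> y)))"
  have gi: "inv g \<in> symgrp n" using g by (simp add: symgrp_group)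
  have "right_proj (diag_act g F) (x, y) = (\<Sum>p\<in>symgrp n. \<Sum>q\<in>symgrp n. ?f (inv g \<circ> p) (inv g \<circ> q))"
    unfolding right_proj_apply
  proof (intro sum.cong refl)
    fix p q assume p: "p \<in> symgrp n" and q: "q \<in> symgrp n"
    have "inv (inv g \<circ> h) \<circ> (inv g \<circ> z) = inv h \<circ> z" if "h \<in> symgrp n" for h z :: perm
      using that g by (simp add: symgrp_inv_comp[OF gi] symgrp_inverse(3)[OF g] comp_assoc symgrp_inverse(7)[OF g])
    then show "diag_act g F (p, q) * (e1 (inv p \<circ> x) * e2 (inv q \<circ> y)) = ?f (inv g \<circ> p) (inv g \<circ> q)"
      using p q by (simp add: diag_act_def)
  qed
  also have "\<dots> = (\<Sum>p\<in>symgrp n. \<Sum>q\<in>symgrp n. ?f (inv g \<circ> p) q)"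
    by (rule sum.cong[OF refl]) (rule sum_symgrp_comp_left[OF gi])
  also have "\<dots> = (\<Sum>p\<in>symgrp n. \<Sum>q\<in>symgrp n. ?f p q)"
    by (rule sum_symgrp_comp_left[OF gi, of "\<lambda>p. \<Sum>q\<in>symgrp n. ?f p q"])
  also have "\<dots> = diag_act g (right_proj F) (x, y)" by (simp add: diag_act_def right_proj_apply)
  finally show "right_proj (diag_act g F) (x, y) = diag_act g (right_proj F) (x, y)" .
qed

lemma tensor_in_tensor_module: "v \<in> left_ideal n e1 \<Longrightarrow> w \<in> left_ideal n e2 \<Longrightarrow> tensor v w \<in> tensor_module"
  unfolding tensor_module_def tensor_space_def by (rule cfun.span_base) blast

lemma subspace_tensor_module: "cfun.subspace tensor_module"
  unfolding tensor_module_def tensor_space_def by (rule cfun.subspace_span)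

lemma right_proj_in_tensor_module: "right_proj F \<in> tensor_module"
  unfolding right_proj_def
proof (intro cfun.subspace_sum[OF subspace_tensor_module] cfun.subspace_scale[OF subspace_tensor_module] tensor_in_tensor_module)
  fix pq assume "pq \<in> perm_pairs"
  then have "fst pq \<in> symgrp n" "snd pq \<in> symgrp n" by (auto simp: perm_pairs_def)
  then show "left_act (fst pq) e1 \<in> left_ideal n e1" "left_act (snd pq) e2 \<in> left_ideal n e2"
    using E1.submodule_left_ideal E2.submodule_left_ideal E1.e_in E1.e_idem E2.e_in E2.e_idem
    by (simp_all add: submodule_def E1.left_ideal_iff E2.left_ideal_iff)
qed

lemma right_proj_fixes_tensor_module:
  assumes "F \<in> tensor_module"
  shows "right_proj F = F"
proof -
  interpret right_proj: Vector_Spaces.linear cscale cscale right_proj by (rule right_proj_linear)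
  have "cfun.subspace {F. right_proj F = F}"
    by (rule cfun.subspaceI) (simp_all add: right_proj.add right_proj.scale)
  moreover have "{tensor v w | v w. v \<in> left_ideal n e1 \<and> w \<in> left_ideal n e2} \<subseteq> {F. right_proj F = F}"
    by (auto simp: right_proj_tensor E1.left_ideal_iff E2.left_ideal_iff)
  ultimately have "tensor_module \<subseteq> {F. right_proj F = F}"
    unfolding tensor_module_def tensor_space_def by (intro cfun.span_minimal)
  then show ?thesis using assms by auto
qed

lemma tensor_module_supported: "tensor_module \<subseteq> supported perm_pairs"
  unfolding tensor_module_def tensor_space_def
proof (rule cfun.span_minimal[OF _ subspace_supported])
  show "{tensor v w | v w. v \<in> left_ideal n e1 \<and> w \<in> left_ideal n e2} \<subseteq> supported perm_pairs"
    by (auto simp: E1.left_ideal_iff E2.left_ideal_iff grpalg_def supported_def perm_pairs_def tensor_def)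
qed

lemma submodule_tensor_module: "submodule (symgrp n) diag_act tensor_module"
  unfolding submodule_def
proof (intro conjI ballI subspace_tensor_module)
  fix g F assume "g \<in> symgrp n" "F \<in> tensor_module"
  then have "diag_act g F = right_proj (diag_act g F)" by (simp add: right_proj_diag_act right_proj_fixes_tensor_module)
  then show "diag_act g F \<in> tensor_module" using right_proj_in_tensor_module by metis
qed

theorem multiplicity_tensor:
  assumes e: "primitive_idempotent n e"
  shows "of_nat (multiplicity_rep (symgrp n) left_act (left_ideal n e) diag_act tensor_module) =
    (\<Sum>g\<in>symgrp n. e g * ((\<Sum>x\<in>symgrp n. e1 (inv x \<circ> inv g \<circ> x)) * (\<Sum>y\<in>symgrp n. e2 (inv y \<circ> inv g \<circ> y))))"
proof -
  interpret E: primitive_idempotent n e by (rule e)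
  interpret diag_e: symrep_idempotent n diag_act e by unfold_locales
  interpret right_proj: Vector_Spaces.linear cscale cscale right_proj by (rule right_proj_linear)
  interpret A: Vector_Spaces.linear cscale cscale "diag.act e" by (rule diag.act_linear)
  define P where "P F = diag.act e (right_proj F)" for F
  have act_tensor_module: "diag.act e F \<in> tensor_module" if "F \<in> tensor_module" for F
    by (rule diag.act_in_submodule[OF submodule_tensor_module that])
  have "P ` supported perm_pairs = diag.act e ` tensor_module"
  proof (intro equalityI subsetI)
    fix F assume "F \<in> P ` supported perm_pairs"
    then show "F \<in> diag.act e ` tensor_module" using right_proj_in_tensor_module by (auto simp: P_def)
  next
    fix F assume "F \<in> diag.act e ` tensor_module"
    then obtain G where G: "G \<in> tensor_module" "F = diag.act e G" by auto
    then have "F = P G" by (simp add: P_def right_proj_fixes_tensor_module)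
    then show "F \<in> P ` supported perm_pairs" using G(1) tensor_module_supported by blast
  qed
  then have "of_nat (multiplicity_rep (symgrp n) left_act (left_ideal n e) diag_act tensor_module) =
      (1 :: complex) * of_nat (cfun.dim (P ` supported perm_pairs))"
    using diag_e.multiplicity_rep_eq_dim[OF finite_perm_pairs submodule_tensor_module tensor_module_supported] by simp
  also have "\<dots> = (\<Sum>z\<in>perm_pairs. P (delta z) z)"
  proof (rule trace_quasi_idempotent[OF finite_perm_pairs, symmetric])
    show "Vector_Spaces.linear cscale cscale P"
      by (rule linear_cscaleI) (simp_all add: P_def right_proj.add right_proj.scale A.add A.scale)
    show "P F \<in> supported perm_pairs" for F
      unfolding P_def using act_tensor_module[OF right_proj_in_tensor_module] tensor_module_supported by blast
    \<comment> \<open>The action of e stays within the tensor module, on which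
      \<open>right_proj\<close> is the identity; so only the idempotency of e is left to
      use.\<close>
    show "P (P F) = cscale 1 (P F)" for F
      unfolding P_def right_proj_fixes_tensor_module[OF act_tensor_module[OF right_proj_in_tensor_module]] diag.act_mult[symmetric] E.e_idem by simp
  qed
  also have "\<dots> = (\<Sum>(x, y)\<in>perm_pairs. \<Sum>g\<in>symgrp n. e g * (e1 (inv x \<circ> inv g \<circ> x) * e2 (inv y \<circ> inv g \<circ> y)))"
  proof (rule sum.cong[OF refl], clarify)
    fix x y assume xy: "(x, y) \<in> perm_pairs"
    have "right_proj (delta (x, y)) (x', y') = e1 (inv x \<circ> x') * e2 (inv y \<circ> y')" for x' y'
    proof -
      have "right_proj (delta (x, y)) = tensor (left_act x e1) (left_act y e2)"
      proof -
        have "right_proj (delta (x, y)) = (\<Sum>pq\<in>perm_pairs. if pq = (x, y) then tensor (left_act x e1) (left_act y e2) else 0)"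
          unfolding right_proj_def by (rule sum.cong[OF refl]) (auto simp: delta_def)
        then show ?thesis using xy finite_perm_pairs by simp
      qed
      then show ?thesis by (simp add: tensor_def left_act_def)
    qed
    then show "P (delta (x, y)) (x, y)
        = (\<Sum>g\<in>symgrp n. e g * (e1 (inv x \<circ> inv g \<circ> x) * e2 (inv y \<circ> inv g \<circ> y)))"
      by (simp add: P_def diag.act_def sum_fun_apply cscale_def diag_act_def comp_assoc)
  qed
  also have "\<dots> = (\<Sum>g\<in>symgrp n. \<Sum>(x, y)\<in>perm_pairs. e g * (e1 (inv x \<circ> inv g \<circ> x) * e2 (inv y \<circ> inv g \<circ> y)))"
    unfolding case_prod_unfold by (rule sum.swap)
  also have "\<dots> = (\<Sum>g\<in>symgrp n. e g * ((\<Sum>x\<in>symgrp n. e1 (inv x \<circ> inv g \<circ> x)) * (\<Sum>y\<in>symgrp n. e2 (inv y \<circ> inv g \<circ> y))))"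
    by (rule sum.cong[OF refl])
      (simp only: perm_pairs_def sum.cartesian_product[symmetric] sum_product, simp only: sum_distrib_left)
  finally show ?thesis .
qed

end

abbreviation young_idem :: "nat list \<Rightarrow> perm \<Rightarrow> complex" where
  "young_idem lam \<equiv> diagram.idem (sum_list lam) (\<lambda>v. fst (tab_pos lam v)) (\<lambda>v. snd (tab_pos lam v))"

abbreviation young_char :: "nat list \<Rightarrow> perm \<Rightarrow> complex" where
  "young_char lam \<equiv> diagram.char (sum_list lam) (\<lambda>v. fst (tab_pos lam v)) (\<lambda>v. snd (tab_pos lam v))"

lemma specht_eq_left_ideal:
  assumes "sorted_wrt (\<ge>) lam"
  shows "specht lam = left_ideal (sum_list lam) (young_idem lam)"
proof -
  interpret D: diagram "sum_list lam" "\<lambda>v. fst (tab_pos lam v)" "\<lambda>v. snd (tab_pos lam v)" "lpart lam"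
    by (rule diagram_partition[OF assms])
  have "row_group lam = D.rowgrp"
    unfolding row_group_def D.rowgrp_def tab_row_eq
    by (intro Collect_cong conj_cong refl fibres_preserved_iff)
  moreover have "col_group lam = D.colgrp"
    unfolding col_group_def D.colgrp_def tab_col_eq
    by (intro Collect_cong conj_cong refl fibres_preserved_iff)
  ultimately have "young_symmetrizer lam = D.ysym"
    by (simp add: young_symmetrizer_def D.ysym_def row_symmetrizer_def D.rsym_def
        col_antisymmetrizer_def D.casym_def D.csgn_def cong: if_cong)
  then show ?thesis by (simp add: specht_def D.left_ideal_idem)
qed

text \<open>The trace formula has a bare idempotent for lam and characters at inverses for mu and
  nu. The inverses disappear by \<open>char_inv\<close>; as the other two factors are class
  functions, the idempotent may be averaged to a character at the cost of the factor n!.\<close>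

theorem kronecker_eq_sum_char:
  assumes "sorted_wrt (\<ge>) lam" "sorted_wrt (\<ge>) mu" "sorted_wrt (\<ge>) nu"
    and n: "sum_list lam = n" "sum_list mu = n" "sum_list nu = n"
  shows "fact n * of_nat (kronecker mu nu lam)
    = (\<Sum>g\<in>symgrp n. young_char lam g * (young_char mu g * young_char nu g))"
proof -
  interpret L: diagram n "\<lambda>v. fst (tab_pos lam v)" "\<lambda>v. snd (tab_pos lam v)" "lpart lam"
    using diagram_partition[OF assms(1)] n by simp
  interpret M: diagram n "\<lambda>v. fst (tab_pos mu v)" "\<lambda>v. snd (tab_pos mu v)" "lpart mu"
    using diagram_partition[OF assms(2)] n by simp
  interpret N: diagram n "\<lambda>v. fst (tab_pos nu v)" "\<lambda>v. snd (tab_pos nu v)" "lpart nu"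
    using diagram_partition[OF assms(3)] n by simp
  interpret T: idempotent_pair n M.idem N.idem
    by (rule idempotent_pair.intro[OF M.primitive_idem N.primitive_idem])
  have "kronecker mu nu lam = multiplicity_rep (symgrp n) left_act (left_ideal n L.idem) diag_act T.tensor_module"
    unfolding kronecker_def T.tensor_module_def specht_eq_left_ideal[OF assms(1)] specht_eq_left_ideal[OF assms(2)]
      specht_eq_left_ideal[OF assms(3)] n ..
  then have "of_nat (kronecker mu nu lam) = (\<Sum>g\<in>symgrp n. L.idem g * (M.char (inv g) * N.char (inv g)))"
    using T.multiplicity_tensor[OF L.primitive_idem] by (simp add: M.char_def N.char_def)
  also have "\<dots> = (\<Sum>g\<in>symgrp n. L.idem g * (M.char g * N.char g))"
    by (rule sum.cong[OF refl]) (simp add: M.char_inv N.char_inv)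
  finally have "fact n * of_nat (kronecker mu nu lam) = fact n * (\<Sum>g\<in>symgrp n. L.idem g * (M.char g * N.char g))"
    by simp
  also have "\<dots> = (\<Sum>g\<in>symgrp n. L.char g * (M.char g * N.char g))"
    by (rule L.sum_char_class[symmetric]) (simp only: M.char_conj N.char_conj)
  finally show ?thesis by (simp only: n)
qed

section \<open>Evaluation for shapes with at most three rows\<close>

lemma young_char_three:
  assumes "a \<ge> b" "b \<ge> c" "g \<in> symgrp (a + b + c)"
  shows "young_char [a, b, c] g = of_int (det_char (a + b + c) (int a) (int b) (int c) g)"
proof -
  have s: "sum_list [a, b, c] = a + b + c" by simp
  interpret D: diagram "sum_list [a, b, c]" "\<lambda>v. fst (tab_pos [a, b, c] v)" "\<lambda>v. snd (tab_pos [a, b, c] v)" "lpart [a, b, c]"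
    by (rule diagram_partition) (use assms in simp)
  have "young_char [a, b, c] g = of_int (det_char (sum_list [a, b, c]) (int (lpart [a, b, c] 0)) (int (lpart [a, b, c] 1)) (int (lpart [a, b, c] 2)) g)"
    by (rule D.char_eq_det_char) (use assms(3) in \<open>simp_all only: s, simp add: lpart_def\<close>)
  then show ?thesis by (simp only: s) (simp add: lpart_def)
qed

lemma young_char_two:
  assumes "a \<ge> b" "g \<in> symgrp (a + b)"
  shows "young_char [a, b] g = of_int (det_char (a + b) (int a) (int b) 0 g)"
proof -
  have s: "sum_list [a, b] = a + b" by simp
  interpret D: diagram "sum_list [a, b]" "\<lambda>v. fst (tab_pos [a, b] v)" "\<lambda>v. snd (tab_pos [a, b] v)" "lpart [a, b]"
    by (rule diagram_partition) (use assms in simp)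
  have "young_char [a, b] g = of_int (det_char (sum_list [a, b]) (int (lpart [a, b] 0)) (int (lpart [a, b] 1)) (int (lpart [a, b] 2)) g)"
    by (rule D.char_eq_det_char) (use assms(2) in \<open>simp_all only: s, simp add: lpart_def\<close>)
  then show ?thesis by (simp only: s) (simp add: lpart_def)
qed

lemma kronecker_even_three_rows:
  fixes x y z m N :: nat
  assumes "N \<ge> 1" "z \<ge> N" "y \<ge> z + N" "x \<ge> y + N" "m = x + y + z"
  shows "2 * int (kronecker [m, m] [m + N, m - N] [2 * x, 2 * y, 2 * z]) = int N + (if even N then 2 else - 1)"
proof -
  let ?n = "2 * m"
  let ?k = "kronecker [m, m] [m + N, m - N] [2 * x, 2 * y, 2 * z]"
  have "N < m" using assms by simp
  have n: "2 * x + 2 * y + 2 * z = ?n" "m + m = ?n" "m + N + (m - N) = ?n" using assms \<open>N < m\<close> by simp_all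
  have "fact ?n * of_nat ?k = (\<Sum>g\<in>symgrp ?n. young_char [2 * x, 2 * y, 2 * z] g
      * (young_char [m, m] g * young_char [m + N, m - N] g))"
    by (rule kronecker_eq_sum_char) (use assms n in simp_all)
  also have "\<dots> = (\<Sum>g\<in>symgrp ?n. of_int (det_char ?n (2 * int x) (2 * int y) (2 * int z) g
      * (det_char ?n (int m) (int m) 0 g * det_char ?n (int m + int N) (int m - int N) 0 g)))"
  proof (rule sum.cong[OF refl])
    fix g assume g: "g \<in> symgrp ?n"
    have "young_char [2 * x, 2 * y, 2 * z] g = of_int (det_char ?n (int (2 * x)) (int (2 * y)) (int (2 * z)) g)"
      by (rule young_char_three[of "2 * y" "2 * x" "2 * z" g, unfolded n]) (use assms(2-4) g in simp_all)
    then have "young_char [2 * x, 2 * y, 2 * z] g = of_int (det_char ?n (2 * int x) (2 * int y) (2 * int z) g)"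
      by (simp only: of_nat_mult of_nat_numeral)
    moreover have "young_char [m, m] g = of_int (det_char ?n (int m) (int m) 0 g)"
      by (rule young_char_two[of m m g, unfolded n]) (use g in simp_all)
    moreover have "young_char [m + N, m - N] g = of_int (det_char ?n (int (m + N)) (int (m - N)) 0 g)"
      by (rule young_char_two[of "m - N" "m + N" g, unfolded n]) (use g in simp_all)
    then have "young_char [m + N, m - N] g = of_int (det_char ?n (int m + int N) (int m - int N) 0 g)"
      using \<open>N < m\<close> by (simp only: of_nat_add of_nat_diff less_imp_le)
    ultimately show "young_char [2 * x, 2 * y, 2 * z] g * (young_char [m, m] g * young_char [m + N, m - N] g)
        = of_int (det_char ?n (2 * int x) (2 * int y) (2 * int z) g
          * (det_char ?n (int m) (int m) 0 g * det_char ?n (int m + int N) (int m - int N) 0 g))"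
      by (simp only: of_int_mult)
  qed
  also have "\<dots> = of_int (fact ?n * (rect_mult (2 * int x) (2 * int y) (2 * int z) (int m) (int N)
      - rect_mult (2 * int x) (2 * int y) (2 * int z) (int m) (int N + 1)))"
    unfolding of_int_sum[symmetric]
    by (subst sum_det_char_triple) (use assms \<open>N < m\<close> in simp_all)
  finally have "complex_of_int (fact ?n * int ?k) = of_int (fact ?n * (rect_mult (2 * int x) (2 * int y) (2 * int z) (int m) (int N)
      - rect_mult (2 * int x) (2 * int y) (2 * int z) (int m) (int N + 1)))"
    by simp
  then have "int ?k = rect_mult (2 * int x) (2 * int y) (2 * int z) (int m) (int N)
      - rect_mult (2 * int x) (2 * int y) (2 * int z) (int m) (int N + 1)"
    by (simp only: of_int_eq_iff mult_left_cancel fact_nonzero) simp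
  then show ?thesis
    using rect_mult_diff_even_parts[of "int N" "int z" "int y" "int x"] assms by (simp add: algebra_simps)
qed

theorem theorem2p2:
  fixes i j k :: nat and \<alpha> \<beta> \<gamma> :: "nat list"
  assumes "i > j" and "j > 0" and "k > 2 * i + j"
    and "\<alpha> = [k, k]"
    and "\<beta> = [k + 1, k - 1]"
    and "\<gamma> = [2 * k - 2 * i - 2 * j, 2 * i, 2 * j]"
  shows "(\<forall>N::nat. N > 0 \<longrightarrow>
            real (kronecker (dilate N \<alpha>) (dilate N \<beta>) (dilate N \<gamma>)) =
              real N / 2 + (if even N then 1 else - 1 / 2)) \<and>
         kronecker \<alpha> \<beta> \<gamma> = 0 \<and>
         (\<forall>N::nat. N > 1 \<longrightarrow> kronecker (dilate N \<alpha>) (dilate N \<beta>) (dilate N \<gamma>) > 0)"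
proof -
  have val: "real (kronecker (dilate N \<alpha>) (dilate N \<beta>) (dilate N \<gamma>)) =
      real N / 2 + (if even N then 1 else - 1 / 2)" if N: "N > 0" for N
  proof -
    \<comment> \<open>Strict inequalities between integers become gaps of N after dilation: i > j
      gives Ni \<ge> Nj + N, and k > 2i + j gives N(k - i - j) \<ge> Ni + N. The witnesses also
      remove the truncated subtractions.\<close>
    obtain d where d: "i = j + 1 + d" using assms(1) by (auto simp: less_iff_Suc_add)
    obtain f where f: "k = 2 * i + j + 1 + f" using assms(3) by (auto simp: less_iff_Suc_add)
    have dil: "dilate N \<alpha> = [N * k, N * k]" "dilate N \<beta> = [N * k + N, N * k - N]"
      "dilate N \<gamma> = [2 * (N * (k - i - j)), 2 * (N * i), 2 * (N * j)]"
      using assms by (simp_all add: dilate_def algebra_simps)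
    have "2 * int (kronecker (dilate N \<alpha>) (dilate N \<beta>) (dilate N \<gamma>)) = int N + (if even N then 2 else - 1)"
      unfolding dil
    proof (rule kronecker_even_three_rows)
      show "N \<ge> 1" using N by simp
      show "N \<le> N * j" using assms(2) by simp
      show "N * j + N \<le> N * i" using d by (simp add: algebra_simps)
      show "N * i + N \<le> N * (k - i - j)" using f by (simp add: algebra_simps)
      show "N * k = N * (k - i - j) + N * i + N * j" using f by (simp add: algebra_simps)
    qed
    then have "2 * real (kronecker (dilate N \<alpha>) (dilate N \<beta>) (dilate N \<gamma>)) = real N + (if even N then 2 else - 1)"
      by (smt (verit) of_int_of_nat_eq of_int_add of_int_mult of_int_numeral of_int_1 of_int_minus)
    then show ?thesis by (simp split: if_splits)
  qed
  moreover have "kronecker \<alpha> \<beta> \<gamma> = 0"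
    using val[of 1] by (simp add: dilate_def)
  moreover have "kronecker (dilate N \<alpha>) (dilate N \<beta>) (dilate N \<gamma>) > 0" if "N > 1" for N
  proof -
    have "real (kronecker (dilate N \<alpha>) (dilate N \<beta>) (dilate N \<gamma>)) > 0"
      using val[of N] that by (auto split: if_splits)
    then show ?thesis by simp
  qed
  ultimately show ?thesis by blast
qed

end
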